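(* Let $\mathcal{N}:=\{i^2-j^2:\ i,j\in\mathbb{N}\}$, let $m\in\mathbb{R}$ and $k\in\{1,2\}$. Assume that the real sequences $\{a_n^1\}_{n\in\mathbb{N}^*}$, $\{a_n^2\}_{n\in\mathbb{N}}$ satisfy, for some constants $c,C>0$, $$c\,n^{-m}<|a_n^k|<C\,n^{-m}\quad\text{for } k\in\{1,2\},\ n\in\mathbb{N}^*,\qquad a_0^2\ne0.$$ Then for any real $\lambda\notin\mathcal{N}$ there exists a real sequence $\{K_n^k\}_n$ satisfying (for some constants $c',C'>0$) - $K_0^2\neq0$ (when $k=2$); - $c'n^m<|K_n^k|<C'n^m$ for $n\in\mathbb{N}^*$; - $\{(\lambda+a_n^kK_n^k)n^r\}_n\in\ell^2$ for all $r\in[0,1/2)$; - the linear functional $K_k$ defined by $K_k(f_n^k)=K_n^k$ is bounded on $H_k^{m+1/2+}$; such that the linear operator $T_k:\mathcal{S}\to\mathcal{S}_k'$ defined by $$T_kf_n^k=-K_n^k\sum_p\frac{a_p^kf_p^k}{p^2+\lambda-n^2},\qquad T_kf_n^{3-k}=0,$$ can be linearly extended to $H^{m-3/2+}$, and - $T_k$ is an isomorphism on $H_k^{m+s}$ for any $s\in(-3/2,3/2)$; - $T_k\phi_k=\phi_k$ in $H_k^{m-1/2-}$; - for any $r\in(-1/2,1/2)$ and any $\varphi\in H_k^{m+r+1}$, $$(T_kA+T_k\phi_kK_k)\varphi=(AT_k-\lambda T_k)\varphi\quad\text{in }H_k^{m+r-1}.$$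
   Context: $\mathbb{T}=\mathbb{R}/2\pi\mathbb{Z}$, $\mathbb{N}=\{0,1,\dots\}$, $\mathbb{N}^*=\{1,2,\dots\}$; everything is real valued. $f_n^1=\frac{1}{\sqrt\pi}\sin nx$, $f_n^2=\frac1{\sqrt\pi}\cos nx$ for $n\ge1$, $f_0^2=\frac1{\sqrt{2\pi}}$; for $k=1$ the indices $n,p$ of $f^k,a^k,K^k$ range over $\mathbb{N}^*$, for $k=2$ over $\mathbb{N}$. $A=\Delta=\partial_x^2$, so $Af_n^k=-n^2f_n^k$. $\phi_k:=\sum_na_n^kf_n^k$. For $s\in\mathbb{R}$, $H^s=H^s(\mathbb{T})$ consists of $f=\sum_{n\ge1}b_n^1f_n^1+\sum_{n\ge0}b_n^2f_n^2$ with finite norm $\|f\|^2_{H^s}=(b_0^2)^2+\sum_{n\ge1}n^{2s}((b_n^1)^2+(b_n^2)^2)$; $H_1^s$ (resp. $H_2^s$) is the closed subspace of series in the $f_n^1$ only (odd functions) (resp. in the $f_n^2$ only (even functions)). $\mathcal{S}$ is the space of series with rapidly decaying coefficients, $\mathcal{S}'$ its dual, and $\mathcal{S}_k'$ the elements of $\mathcal{S}'$ vanishing on all $f_n^{3-k}$. A statement "in $H^{s-}$" means in $H^{s-\varepsilon}$ for all $\varepsilon>0$; "bounded on/extended to $H^{s+}$" means on/to $H^{s+\varepsilon}$ for all $\varepsilon>0$. $T_k\phi_kK_k$ denotes $\varphi\mapsto K_k(\varphi)\,T_k\phi_k$. *)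

theory Defs
  imports "HOL-Analysis.Analysis"
begin

text \<open>
  Functions on the torus are \<open>2\<pi>\<close>-periodic functions on the real line.
  \<open>fbasis 1 n\<close> is the sine mode \<open>f\<^sub>n\<^sup>1\<close> and \<open>fbasis 2 n\<close> the cosine mode \<open>f\<^sub>n\<^sup>2\<close>.
  The index pair \<open>(1, 0)\<close> does not occur in the mathematics; here
  \<open>fbasis 1 0\<close> is the zero function, so a sum over all \<open>n\<close> of multiples of \<open>fbasis 1 n\<close>
  is a sum over \<open>n \<ge> 1\<close>.
\<close>

definition fbasis :: "nat \<Rightarrow> nat \<Rightarrow> real \<Rightarrow> real" where
  "fbasis k n x =
     (if k = 1 then sin (real n * x) / sqrt pi
      else if n = 0 then 1 / sqrt (2 * pi)
      else cos (real n * x) / sqrt pi)"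

definition idx :: "nat \<Rightarrow> nat set" where
  "idx k = (if k = 1 then {1..} else UNIV)"

definition rapidly_decaying :: "(nat \<Rightarrow> real) \<Rightarrow> bool" where
  "rapidly_decaying b \<longleftrightarrow> (\<forall>N. \<exists>C. \<forall>n. real n ^ N * \<bar>b n\<bar> \<le> C)"

definition test_fun :: "(real \<Rightarrow> real) set" where
  "test_fun = {\<phi>. \<exists>b1 b2. rapidly_decaying b1 \<and> rapidly_decaying b2 \<and>
     (\<forall>x. \<phi> x = (\<Sum>n. b1 n * fbasis 1 n x) + (\<Sum>n. b2 n * fbasis 2 n x))}"

type_synonym functional = "(real \<Rightarrow> real) \<Rightarrow> real"

text \<open>
  Functionals on \<open>test_fun\<close> are total functions vanishing outside \<open>test_fun\<close>, so that HOL
  equality is equality of functionals. A test function is identified with the functional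
  given by the \<open>L\<^sup>2\<close> pairing.
\<close>

definition embed :: "(real \<Rightarrow> real) \<Rightarrow> functional" where
  "embed \<phi> = (\<lambda>\<psi>. if \<psi> \<in> test_fun then integral {0..2 * pi} (\<lambda>x. \<phi> x * \<psi> x) else 0)"

text \<open>
  The numbers \<open>u (fbasis k n)\<close> are the Fourier coefficients of \<open>u\<close>. Since \<open>0 powr a = 0\<close>,
  the terms with \<open>n = 0\<close> of the sums below vanish.
\<close>

definition Hnorm :: "real \<Rightarrow> functional \<Rightarrow> real" where
  "Hnorm s u = sqrt ((u (fbasis 2 0))\<^sup>2 +
     (\<Sum>n. real n powr (2 * s) * ((u (fbasis 1 n))\<^sup>2 + (u (fbasis 2 n))\<^sup>2)))"

definition linear_functional_on :: "('a \<Rightarrow> real) set \<Rightarrow> (('a \<Rightarrow> real) \<Rightarrow> real) \<Rightarrow> bool" where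
  "linear_functional_on V L \<longleftrightarrow>
     (\<forall>u\<in>V. \<forall>v\<in>V. \<forall>\<alpha> \<beta>. L (\<lambda>x. \<alpha> * u x + \<beta> * v x) = \<alpha> * L u + \<beta> * L v)"

definition linear_operator_on ::
    "('a \<Rightarrow> real) set \<Rightarrow> (('a \<Rightarrow> real) \<Rightarrow> ('b \<Rightarrow> real)) \<Rightarrow> bool" where
  "linear_operator_on V T \<longleftrightarrow>
     (\<forall>u\<in>V. \<forall>v\<in>V. \<forall>\<alpha> \<beta>.
        T (\<lambda>x. \<alpha> * u x + \<beta> * v x) = (\<lambda>y. \<alpha> * T u y + \<beta> * T v y))"

text \<open>
  The topology of \<open>test_fun\<close> is the one of rapidly decaying coefficients, generated by the
  increasing family of Sobolev norms of order \<open>N = 0, 1, 2, \<dots>\<close>.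
\<close>

definition continuous_on_test_fun :: "functional \<Rightarrow> bool" where
  "continuous_on_test_fun u \<longleftrightarrow>
     (\<exists>(N::nat) C. \<forall>\<phi>\<in>test_fun. \<bar>u \<phi>\<bar> \<le> C * Hnorm (real N) (embed \<phi>))"

definition distr :: "functional set" where
  "distr = {u. linear_functional_on test_fun u \<and> continuous_on_test_fun u \<and>
     (\<forall>\<phi>. \<phi> \<notin> test_fun \<longrightarrow> u \<phi> = 0)}"

definition distr_par :: "nat \<Rightarrow> functional set" where
  "distr_par k = {u \<in> distr. \<forall>n\<in>idx (3 - k). u (fbasis (3 - k) n) = 0}"

definition Hs :: "real \<Rightarrow> functional set" where
  "Hs s = {u \<in> distr.
     summable (\<lambda>n. real n powr (2 * s) * ((u (fbasis 1 n))\<^sup>2 + (u (fbasis 2 n))\<^sup>2))}"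

definition Hs_par :: "nat \<Rightarrow> real \<Rightarrow> functional set" where
  "Hs_par k s = Hs s \<inter> distr_par k"

text \<open>The series \<open>\<Sum>\<^sub>p c\<^sub>p f\<^sub>p\<^sup>k\<close>, converging weakly against test functions.\<close>

definition fseries :: "nat \<Rightarrow> (nat \<Rightarrow> real) \<Rightarrow> functional" where
  "fseries k c = (\<lambda>\<psi>. \<Sum>p. c p * embed (fbasis k p) \<psi>)"

text \<open>The operator \<open>A = \<partial>\<^sub>x\<^sup>2\<close>, acting on distributions by duality.\<close>

definition Lap :: "functional \<Rightarrow> functional" where
  "Lap u = (\<lambda>\<psi>. if \<psi> \<in> test_fun then u (deriv (deriv \<psi>)) else 0)"

definition sq_diffs :: "real set" where
  "sq_diffs = {(real i)\<^sup>2 - (real j)\<^sup>2 | i j. True}"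

text \<open>
  \<open>T0\<close> is the operator from test functions to distributions defined by its values on the
  basis. Continuity (for the weak topology on \<open>distr\<close>) makes these values determine \<open>T0\<close>.
\<close>

definition is_transform ::
    "nat \<Rightarrow> real \<Rightarrow> (nat \<Rightarrow> real) \<Rightarrow> (nat \<Rightarrow> real) \<Rightarrow> ((real \<Rightarrow> real) \<Rightarrow> functional) \<Rightarrow> bool" where
  "is_transform k lam a K T0 \<longleftrightarrow>
     (\<forall>\<phi>\<in>test_fun. T0 \<phi> \<in> distr_par k) \<and>
     linear_operator_on test_fun T0 \<and>
     (\<forall>\<psi>\<in>test_fun. continuous_on_test_fun (\<lambda>\<phi>. T0 \<phi> \<psi>)) \<and>
     (\<forall>n\<in>idx k. T0 (fbasis k n) =
        (\<lambda>\<psi>. - K n * fseries k (\<lambda>p. a p / ((real p)\<^sup>2 + lam - (real n)\<^sup>2)) \<psi>)) \<and>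
     (\<forall>n\<in>idx (3 - k). T0 (fbasis (3 - k) n) = (\<lambda>\<psi>. 0))"

definition is_extension_to ::
    "real \<Rightarrow> nat \<Rightarrow> ((real \<Rightarrow> real) \<Rightarrow> functional) \<Rightarrow> (functional \<Rightarrow> functional) \<Rightarrow> bool" where
  "is_extension_to s k T0 T \<longleftrightarrow>
     (\<forall>\<phi>\<in>test_fun. T (embed \<phi>) = T0 \<phi>) \<and>
     (\<forall>u\<in>Hs s. T u \<in> distr_par k) \<and>
     linear_operator_on (Hs s) T \<and>
     (\<forall>\<psi>\<in>test_fun. \<exists>C. \<forall>u\<in>Hs s. \<bar>T u \<psi>\<bar> \<le> C * Hnorm s u)"

definition bounded_functional_on_Hs_par :: "nat \<Rightarrow> real \<Rightarrow> (functional \<Rightarrow> real) \<Rightarrow> bool" where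
  "bounded_functional_on_Hs_par k s L \<longleftrightarrow>
     linear_functional_on (Hs_par k s) L \<and>
     (\<exists>C. \<forall>u\<in>Hs_par k s. \<bar>L u\<bar> \<le> C * Hnorm s u)"

text \<open>
  The two bounds express continuity of \<open>T\<close> and of its inverse.
\<close>

definition isomorphism_on_Hs_par :: "nat \<Rightarrow> real \<Rightarrow> (functional \<Rightarrow> functional) \<Rightarrow> bool" where
  "isomorphism_on_Hs_par k s T \<longleftrightarrow>
     linear_operator_on (Hs_par k s) T \<and>
     bij_betw T (Hs_par k s) (Hs_par k s) \<and>
     (\<exists>C. \<forall>u\<in>Hs_par k s. Hnorm s (T u) \<le> C * Hnorm s u) \<and>
     (\<exists>C. \<forall>u\<in>Hs_par k s. Hnorm s u \<le> C * Hnorm s (T u))"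

end

theory Submission
  imports Defs
begin

text \<open>
  In Fourier coefficients \<open>T\<^sub>k\<close> is, up to the diagonal factors \<open>- a\<^sub>p\<close> and \<open>K\<^sub>n\<close>, the Cauchy matrix
  \<open>1 / (p\<^sup>2 + \<lambda> - n\<^sup>2)\<close>. On sequences that are square summable with weight \<open>n\<^sup>s\<close>, \<open>\<bar>s\<bar> < 3/2\<close>, this
  matrix is a multiple of the identity plus a Hilbert-Schmidt operator, hence bounded.
  The condition \<open>T\<^sub>k \<phi>\<^sub>k = \<phi>\<^sub>k\<close> reads \<open>\<Sum>\<^sub>n a\<^sub>n K\<^sub>n / (p\<^sup>2 + \<lambda> - n\<^sup>2) = - 1\<close> for all \<open>p\<close>; it is solved by
  taking for \<open>a\<^sub>n K\<^sub>n\<close> the residue \<open>R\<^sub>n\<close> at \<open>z = n\<^sup>2\<close> of the product of the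
  \<open>(z - j\<^sup>2 - \<lambda>) / (z - j\<^sup>2)\<close>, by the partial fraction expansion of that product, which vanishes at
  \<open>z = p\<^sup>2 + \<lambda>\<close>. With \<open>S\<^sub>p\<close> the residues of the reciprocal product (the same construction for
  \<open>- \<lambda>\<close>), the classical inversion formula gives the inverse \<open>- R\<^sub>n S\<^sub>p / (p\<^sup>2 + \<lambda> - n\<^sup>2)\<close> of the Cauchy
  matrix, which is bounded for the same reason. All identities hold for finite products and pass to the limit
  by dominated convergence.
\<close>

section \<open>Weighted square summable sequences\<close>

text \<open>The Cauchy form is forced: once \<open>T_k\<close> fixes \<open>phi_k\<close>, comparing
  coefficients in the operator identity says that \<open>p^2 + lam - n^2\<close> times the entry (p,
  n) of \<open>T_k\<close> equals \<open>- a_p * K_n\<close>, so the freedom lies only in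
  \<open>K\<close>. The range 3/2 is that of the kernel \<open>1 / (p^2 - n^2)\<close>: with weight
  \<open>n^s\<close> a column behaves like \<open>p^(s - 2)\<close> and a row like
  \<open>n^(- s - 2)\<close>, square summable exactly for \<open>s < 3/2\<close> and
  \<open>s > -3/2\<close>. Since differences of squares are integers, excluding them keeps the
  denominators away from 0, and one positive kernel \<open>kap\<close>, the reciprocal of
  \<open>\<bar>p^2 - n^2\<bar>\<close> off the diagonal and 1 on it, dominates the matrix and its
  inverse alike after removal of the weights. All estimates are made with absolute values, because
  turning an entrywise inverse into an inverse operator is an exchange of two infinite sums. The
  obstacle in the limit is that the residues of a finite product depend on the finite index set, so
  they change together with the range of summation; their bounds are therefore proved uniformly in
  that set.\<close>

lemma suminf_swap:
  fixes f :: "nat \<Rightarrow> nat \<Rightarrow> real"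
  assumes "\<And>p. summable (\<lambda>n. \<bar>f p n\<bar>)" and "summable (\<lambda>p. \<Sum>n. \<bar>f p n\<bar>)"
  shows "\<And>n. summable (\<lambda>p. \<bar>f p n\<bar>)"
    and "summable (\<lambda>n. \<Sum>p. \<bar>f p n\<bar>)"
    and "(\<Sum>n. \<Sum>p. f p n) = (\<Sum>p. \<Sum>n. f p n)"
proof -
  \<comment> \<open>On absolutely summable series \<open>infsum\<close> and \<open>suminf\<close>
    agree, so the exchange can be done for unordered sums over pairs and carried back.\<close>
  have toinf: "infsum g UNIV = suminf g" if "summable (\<lambda>n. \<bar>g n\<bar>)" for g :: "nat \<Rightarrow> real"
    using that norm_summable_imp_has_sum[of g "suminf g"]
    by (simp add: infsumI summable_rabs_cancel summable_sums)
  have son: "(\<lambda>n. \<bar>f p n\<bar>) summable_on UNIV" for p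
    using assms(1) by (intro norm_summable_imp_summable_on) simp
  have 1: "(\<lambda>x. norm (case x of (p, n) \<Rightarrow> f p n)) summable_on (UNIV \<times> UNIV)"
  proof -
    have "(\<lambda>p. \<Sum>\<^sub>\<infinity>n. \<bar>f p n\<bar>) = (\<lambda>p. \<Sum>n. \<bar>f p n\<bar>)"
      using assms(1) by (intro ext toinf) simp
    moreover have "(\<lambda>p. \<Sum>n. \<bar>f p n\<bar>) summable_on UNIV"
      using assms by (intro norm_summable_imp_summable_on) (simp add: suminf_nonneg)
    ultimately have "(\<lambda>p. \<bar>\<Sum>\<^sub>\<infinity>n. \<bar>f p n\<bar>\<bar>) summable_on UNIV"
      by (simp add: infsum_nonneg)
    then show ?thesis
      using son
      by (subst Infinite_Sum.abs_summable_on_Sigma_iff) simp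
  qed
  then have 2: "(\<lambda>x. norm (case x of (n, p) \<Rightarrow> f p n)) summable_on (UNIV \<times> UNIV)"
    using summable_on_reindex_bij_betw[of prod.swap UNIV UNIV "\<lambda>(p, n). norm (f p n)"]
    by (simp add: case_prod_unfold bij_swap)
  have sn: "(\<lambda>p. \<bar>f p n\<bar>) summable_on UNIV" for n
    using 2 by (subst (asm) Infinite_Sum.abs_summable_on_Sigma_iff) simp
  show a: "summable (\<lambda>p. \<bar>f p n\<bar>)" for n
    using sn summable_on_imp_summable by blast
  have "(\<lambda>n. \<bar>\<Sum>\<^sub>\<infinity>p. \<bar>f p n\<bar>\<bar>) summable_on UNIV"
    using 2 by (subst (asm) Infinite_Sum.abs_summable_on_Sigma_iff) simp
  moreover have "(\<Sum>\<^sub>\<infinity>p. \<bar>f p n\<bar>) = (\<Sum>p. \<bar>f p n\<bar>)" for n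
    using a by (intro toinf) simp
  ultimately have "summable (\<lambda>n. \<bar>\<Sum>p. \<bar>f p n\<bar>\<bar>)"
    using summable_on_imp_summable by fastforce
  then show b: "summable (\<lambda>n. \<Sum>p. \<bar>f p n\<bar>)"
    using a by (simp add: suminf_nonneg)
  have "(\<lambda>(p, n). f p n) summable_on (UNIV \<times> UNIV)"
    by (rule Infinite_Sum.abs_summable_summable[OF 1])
  then have sw: "(\<Sum>\<^sub>\<infinity>p. \<Sum>\<^sub>\<infinity>n. f p n) = (\<Sum>\<^sub>\<infinity>n. \<Sum>\<^sub>\<infinity>p. f p n)"
    by (intro infsum_swap_banach) simp
  have c: "summable (\<lambda>p. \<bar>\<Sum>n. f p n\<bar>)"
    using assms summable_rabs by (intro summable_comparison_test[OF _ assms(2)]) auto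
  have d: "summable (\<lambda>n. \<bar>\<Sum>p. f p n\<bar>)"
    using a b summable_rabs by (intro summable_comparison_test[OF _ b]) auto
  have "(\<Sum>\<^sub>\<infinity>n. f p n) = (\<Sum>n. f p n)" for p
    using assms(1) by (intro toinf)
  moreover have "(\<Sum>\<^sub>\<infinity>p. f p n) = (\<Sum>p. f p n)" for n
    using a by (intro toinf)
  ultimately show "(\<Sum>n. \<Sum>p. f p n) = (\<Sum>p. \<Sum>n. f p n)"
    using sw toinf[OF c] toinf[OF d] by simp
qed

lemma summable_square_mult:
  fixes x y :: "nat \<Rightarrow> real"
  assumes "summable (\<lambda>n. (x n)\<^sup>2)" and "summable (\<lambda>n. (y n)\<^sup>2)"
  shows "summable (\<lambda>n. \<bar>x n * y n\<bar>)"
    and "(\<Sum>n. \<bar>x n * y n\<bar>)\<^sup>2 \<le> (\<Sum>n. (x n)\<^sup>2) * (\<Sum>n. (y n)\<^sup>2)"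
proof -
  have fin: "(\<Sum>n<N. \<bar>x n * y n\<bar>)\<^sup>2 \<le> (\<Sum>n. (x n)\<^sup>2) * (\<Sum>n. (y n)\<^sup>2)" for N
  proof -
    have "(\<Sum>n<N. \<bar>x n * y n\<bar>)\<^sup>2 \<le> (\<Sum>n<N. (x n)\<^sup>2) * (\<Sum>n<N. (y n)\<^sup>2)"
      using Cauchy_Schwarz_ineq_sum[of "\<lambda>n. \<bar>x n\<bar>" "\<lambda>n. \<bar>y n\<bar>" "{..<N}"] by (simp add: abs_mult)
    also have "\<dots> \<le> (\<Sum>n. (x n)\<^sup>2) * (\<Sum>n. (y n)\<^sup>2)"
      using assms by (intro mult_mono sum_le_suminf suminf_nonneg sum_nonneg) auto
    finally show ?thesis .
  qed
  have "(\<Sum>n<N. \<bar>x n * y n\<bar>) \<le> sqrt ((\<Sum>n. (x n)\<^sup>2) * (\<Sum>n. (y n)\<^sup>2))" for N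
    using fin by (simp add: real_le_rsqrt)
  then show s: "summable (\<lambda>n. \<bar>x n * y n\<bar>)"
    by (intro summableI_nonneg_bounded[where x = "sqrt ((\<Sum>n. (x n)\<^sup>2) * (\<Sum>n. (y n)\<^sup>2))"]) auto
  have "(\<lambda>N. (\<Sum>n<N. \<bar>x n * y n\<bar>)\<^sup>2) \<longlonglongrightarrow> (\<Sum>n. \<bar>x n * y n\<bar>)\<^sup>2"
    using s by (intro tendsto_power summable_LIMSEQ)
  then show "(\<Sum>n. \<bar>x n * y n\<bar>)\<^sup>2 \<le> (\<Sum>n. (x n)\<^sup>2) * (\<Sum>n. (y n)\<^sup>2)"
    using fin LIMSEQ_le_const2 by blast
qed

text \<open>Cauchy-Schwarz in each row. Absolute values stay inside the sums, so that the same bound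
  later licenses the exchange of two sums.\<close>

lemma hilbert_schmidt:
  fixes G :: "nat \<Rightarrow> nat \<Rightarrow> real" and x :: "nat \<Rightarrow> real"
  assumes "\<And>p. summable (\<lambda>n. (G p n)\<^sup>2)" and "summable (\<lambda>p. \<Sum>n. (G p n)\<^sup>2)"
    and "summable (\<lambda>n. (x n)\<^sup>2)"
  shows "\<And>p. summable (\<lambda>n. \<bar>G p n * x n\<bar>)"
    and "summable (\<lambda>p. (\<Sum>n. \<bar>G p n * x n\<bar>)\<^sup>2)"
    and "(\<Sum>p. (\<Sum>n. \<bar>G p n * x n\<bar>)\<^sup>2) \<le> (\<Sum>p. \<Sum>n. (G p n)\<^sup>2) * (\<Sum>n. (x n)\<^sup>2)"
proof -
  show "summable (\<lambda>n. \<bar>G p n * x n\<bar>)" for p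
    using summable_square_mult assms by blast
  have le: "(\<Sum>n. \<bar>G p n * x n\<bar>)\<^sup>2 \<le> (\<Sum>n. (G p n)\<^sup>2) * (\<Sum>n. (x n)\<^sup>2)" for p
    using summable_square_mult assms by blast
  have s: "summable (\<lambda>p. (\<Sum>n. (G p n)\<^sup>2) * (\<Sum>n. (x n)\<^sup>2))"
    using assms by (intro summable_mult2)
  show t: "summable (\<lambda>p. (\<Sum>n. \<bar>G p n * x n\<bar>)\<^sup>2)"
    using le by (intro summable_comparison_test[OF _ s]) auto
  show "(\<Sum>p. (\<Sum>n. \<bar>G p n * x n\<bar>)\<^sup>2) \<le> (\<Sum>p. \<Sum>n. (G p n)\<^sup>2) * (\<Sum>n. (x n)\<^sup>2)"
    using suminf_le[OF le t s] assms(2) by (simp add: suminf_mult2)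
qed

text \<open>\<open>(p - n) + (n - p)\<close> is the distance of \<open>p\<close> and
  \<open>n\<close> in truncated subtraction. Each distance occurs at most twice, hence the factor 2
  and a bound independent of \<open>p\<close>.\<close>

lemma summable_shifted:
  fixes h :: "nat \<Rightarrow> real" and p :: nat
  assumes "summable h" and nn: "\<And>n. h n \<ge> 0"
  shows "summable (\<lambda>n. h ((p - n) + (n - p)))"
    and "(\<Sum>n. h ((p - n) + (n - p))) \<le> 2 * suminf h"
proof -
  have *: "(\<Sum>n<M. h ((p - n) + (n - p))) \<le> 2 * suminf h" for M
  proof -
    have "(\<Sum>n<M. h ((p - n) + (n - p))) \<le> (\<Sum>n<p + M. h ((p - n) + (n - p)))"
      using nn by (intro sum_mono2) auto
    also have "\<dots> = (\<Sum>n<p. h ((p - n) + (n - p))) + (\<Sum>n<M. h ((p - (n + p)) + ((n + p) - p)))"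
      by (induction M) (simp_all add: add.commute)
    also have "(\<Sum>n<p. h ((p - n) + (n - p))) = (\<Sum>n<p. h (p - n))"
      by (intro sum.cong) auto
    also have "(\<Sum>n<p. h (p - n)) = (\<Sum>n<p. h (Suc n))"
      using sum.nat_diff_reindex[of "\<lambda>n. h (Suc n)" p] by (simp add: Suc_diff_Suc)
    also have "(\<Sum>n<p. h (Suc n)) \<le> (\<Sum>n<Suc p. h n)"
      using nn by (simp add: sum.lessThan_Suc_shift del: sum.lessThan_Suc)
    also have "\<dots> \<le> suminf h"
      using assms by (intro sum_le_suminf) auto
    also have "(\<Sum>n<M. h ((p - (n + p)) + ((n + p) - p))) \<le> suminf h"
      using assms by (auto intro!: sum_le_suminf)
    finally show ?thesis by simp
  qed
  show s: "summable (\<lambda>n. h ((p - n) + (n - p)))"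
    using * nn by (intro summableI_nonneg_bounded) auto
  show "(\<Sum>n. h ((p - n) + (n - p))) \<le> 2 * suminf h"
    using s * by (intro suminf_le_const)
qed

text \<open>The weight is \<open>1\<close> at \<open>n = 0\<close>, matching the zeroth term of \<open>Hnorm\<close>.\<close>

definition wt :: "real \<Rightarrow> nat \<Rightarrow> real" where
  "wt s n = real (max 1 n) powr s"

lemma wt_pos [simp]: "wt s n > 0"
  by (simp add: wt_def)

lemma wt_nonneg [simp]: "wt s n \<ge> 0"
  by (simp add: wt_def)

lemma wt_nz [simp]: "wt s n \<noteq> 0"
  using wt_pos[of s n] by linarith

lemma wt_add: "wt (s + t) n = wt s n * wt t n"
  by (simp add: wt_def powr_add)

lemma wt_0 [simp]: "wt 0 n = 1"
  by (simp add: wt_def)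

lemma wt_minus: "wt (- s) n = inverse (wt s n)"
  by (simp add: wt_def powr_minus)

lemma wt_mult_minus [simp]: "wt s n * wt (- s) n = 1" "wt (- s) n * wt s n = 1"
  by (simp_all add: wt_minus)

lemma wt_mono: "s \<le> t \<Longrightarrow> wt s n \<le> wt t n"
  by (simp add: wt_def powr_mono)

lemma wt_square: "(wt s n)\<^sup>2 = wt (2 * s) n"
  by (simp add: wt_add[symmetric] power2_eq_square)

lemma wt_pos_index: "n \<ge> 1 \<Longrightarrow> wt s n = real n powr s"
  by (simp add: wt_def max_def)

lemma summable_wt: 
  assumes "s < -1"
  shows "summable (wt s)"
proof -
  have "summable (\<lambda>n. real n powr s)"
    using assms by (simp add: summable_real_powr_iff)
  then show ?thesis
    by (rule summable_cong[THEN iffD1, rotated])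
      (auto simp: eventually_sequentially wt_pos_index intro!: exI[of _ 1])
qed

lemma summable_wt_bound:
  assumes "\<And>n. n \<ge> 1 \<Longrightarrow> \<bar>c n\<bar> \<le> B * wt t n" and "s + t < -1/2"
  shows "summable (\<lambda>n. (wt s n * c n)\<^sup>2)"
proof -
  have w: "summable (\<lambda>n. B\<^sup>2 * wt (2 * (s + t)) n)"
    using assms(2) by (intro summable_mult summable_wt) simp
  have "(wt s n * c n)\<^sup>2 \<le> B\<^sup>2 * wt (2 * (s + t)) n" if "n \<ge> 1" for n
  proof -
    have "\<bar>wt s n * c n\<bar> \<le> wt s n * (B * wt t n)"
      unfolding abs_mult using assms(1)[OF that] by (intro mult_mono) auto
    also have "\<dots> = B * wt (s + t) n" by (simp only: wt_add mult_ac)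
    finally have "\<bar>wt s n * c n\<bar> \<le> \<bar>B * wt (s + t) n\<bar>"
      by (rule order_trans[OF _ abs_ge_self])
    then have "(wt s n * c n)\<^sup>2 \<le> (B * wt (s + t) n)\<^sup>2"
      by (simp only: abs_le_square_iff)
    then show ?thesis by (simp add: power_mult_distrib wt_square)
  qed
  then show ?thesis
    by (intro summable_comparison_test[OF _ w]) (auto intro!: exI[of _ 1])
qed

section \<open>The model kernel on weighted square summable sequences\<close>

definition kap :: "nat \<Rightarrow> nat \<Rightarrow> real" where
  "kap p n = 1 / max 1 \<bar>(real p)\<^sup>2 - (real n)\<^sup>2\<bar>"

lemma kap_nonneg [simp]: "kap p n \<ge> 0"
  by (simp add: kap_def)

lemma kap_commute: "kap p n = kap n p"
  by (simp add: kap_def abs_minus_commute)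

lemma kap_diag [simp]: "kap p p = 1"
  by (simp add: kap_def)

lemma kap_le_1: "kap p n \<le> 1"
  by (simp add: kap_def)

lemma dist_nat: "real ((p - n) + (n - p)) = \<bar>real p - real n\<bar>"
  by linarith

lemma abs_diff_squares_nat:
  "\<bar>(real p)\<^sup>2 - (real n)\<^sup>2\<bar> = real ((p - n) + (n - p)) * (real p + real n)"
  by (simp only: dist_nat) (simp add: power2_eq_square square_diff_square_factored abs_mult)

lemma kap_off: "p \<noteq> n \<Longrightarrow> kap p n = 1 / (real ((p - n) + (n - p)) * (real p + real n))"
proof -
  assume "p \<noteq> n"
  then have "real ((p - n) + (n - p)) \<ge> 1" "real p + real n \<ge> 1"
    by linarith+
  from mult_mono[OF this] have "real ((p - n) + (n - p)) * (real p + real n) \<ge> 1"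
    by simp
  then show ?thesis
    by (simp only: kap_def abs_diff_squares_nat max_absorb2)
qed

text \<open>
  Off the diagonal the weighted kernel is square summable: writing \<open>d = \<bar>p - n\<bar>\<close> and
  \<open>a = min p n\<close>, its square is at most a multiple of \<open>d powr (t - 5/2) * a powr (- 3/2)\<close>.
\<close>

lemma weighted_kap_bound:
  assumes "p \<noteq> n" and s: "\<bar>s\<bar> \<le> t" and t: "1/2 \<le> t" "t < 3/2"
  shows "(wt s p * kap p n * wt (- s) n)\<^sup>2
    \<le> 16 * wt (t - 5/2) ((p - n) + (n - p)) * (wt (-3/2) p + wt (-3/2) n)"
proof -
  \<comment> \<open>\<open>a\<close> and \<open>b\<close> are the smaller and the larger index,
    raised to at least 1; \<open>d\<close> is the distance and \<open>q\<close> the sum. Whichever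
    of \<open>p\<close>, \<open>n\<close> is larger, the quotient of weights is at most
    \<open>(b / a) powr t\<close>, and \<open>b \<le> a + d\<close> reduces the estimate to the
    summands 1 and \<open>d / a\<close>.\<close>
  define d a b q where "d = real ((p - n) + (n - p))" and "a = real (max 1 (min p n))"
    and "b = real (max 1 (max p n))" and "q = real p + real n"
  have d1: "d \<ge> 1" and a1: "a \<ge> 1" and ab: "a \<le> b" and bd: "b \<le> a + d" and dq: "d \<le> q"
    and aq: "a \<le> q"
    using \<open>p \<noteq> n\<close> by (auto simp: d_def a_def b_def q_def)
  have ba: "b / a \<ge> 1" using ab a1 by simp
  have "wt s p * wt (- s) n \<le> (b / a) powr t"
  proof (cases "p < n")
    case True
    then have "wt s p = a powr s" "wt (- s) n = b powr (- s)"
      by (simp_all add: wt_def a_def b_def)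
    then have "wt s p * wt (- s) n = (b / a) powr (- s)"
      using a1 ab by (simp add: powr_minus powr_divide field_simps)
    also have "\<dots> \<le> (b / a) powr t"
      using ba s by (intro powr_mono) auto
    finally show ?thesis .
  next
    case False
    then have "wt s p = b powr s" "wt (- s) n = a powr (- s)"
      by (simp_all add: wt_def a_def b_def max_absorb1 min_absorb2)
    then have "wt s p * wt (- s) n = (b / a) powr s"
      using a1 ab by (simp add: powr_minus powr_divide field_simps)
    also have "\<dots> \<le> (b / a) powr t"
      using ba s by (intro powr_mono) auto
    finally show ?thesis .
  qed
  then have "(wt s p * wt (- s) n)\<^sup>2 \<le> ((b / a) powr t)\<^sup>2"
    by (intro power_mono) auto
  also have "\<dots> = (b / a) powr (2 * t)"
    by (simp add: power2_eq_square powr_add[symmetric])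
  finally have 1: "(wt s p * wt (- s) n)\<^sup>2 \<le> (b / a) powr (2 * t)" .
  \<comment> \<open>The constant 8 is \<open>2 powr 3\<close>, an upper bound for
    \<open>2 powr (2 * t)\<close> because \<open>t < 3/2\<close>.\<close>
  have split: "(b / a) powr (2 * t) \<le> 8 * (1 + (d / a) powr (2 * t))"
  proof -
    define e where "e = max 1 (d / a)"
    have e1: "e \<ge> 1" by (simp add: e_def)
    have "b / a \<le> 1 + d / a"
      using bd a1 by (simp add: field_simps)
    also have "\<dots> \<le> 2 * e" by (simp add: e_def max_def)
    finally have "(b / a) powr (2 * t) \<le> (2 * e) powr (2 * t)"
      using t ba by (intro powr_mono2) auto
    also have "\<dots> = 2 powr (2 * t) * e powr (2 * t)"
      by (simp add: powr_mult)
    also have "\<dots> \<le> 2 powr 3 * e powr (2 * t)"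
      using t by (intro mult_right_mono powr_mono) auto
    also have "2 powr 3 = (8::real)" by simp
    also have "e powr (2 * t) \<le> 1 + (d / a) powr (2 * t)"
      by (simp add: e_def max_def)
    finally show ?thesis by simp
  qed
  have q1: "q > 0" using aq a1 by simp
  have tail1: "1 / q\<^sup>2 \<le> a powr (-3/2)" 
  proof -
    have "1 / q\<^sup>2 = q powr (-2)" using q1 by (simp add: powr_minus powr_numeral field_simps)
    also have "\<dots> \<le> a powr (-2)" using aq a1 by (intro powr_mono2') auto
    also have "\<dots> \<le> a powr (-3/2)" using a1 by (intro powr_mono) auto
    finally show ?thesis .
  qed
  \<comment> \<open>\<open>1/2 \<le> t\<close> is what makes
    \<open>d powr (-2) \<le> d powr (t - 5/2)\<close> for \<open>d \<ge> 1\<close>.\<close>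
  have first: "1 / (d * q)\<^sup>2 \<le> d powr (t - 5/2) * a powr (-3/2)"
  proof -
    have "1 / (d * q)\<^sup>2 = d powr (-2) * (1 / q\<^sup>2)"
      using d1 by (simp add: powr_minus powr_numeral field_simps power_mult_distrib)
    also have "\<dots> \<le> d powr (t - 5/2) * a powr (-3/2)"
      using d1 t tail1 by (intro mult_mono powr_mono) auto
    finally show ?thesis .
  qed
  \<comment> \<open>The decay \<open>1 / q^2\<close> is shared: the power \<open>t + 1/2\<close> of
    \<open>q\<close> is spent on \<open>d\<close>, the power \<open>3/2 - t\<close>, positive by
    \<open>t < 3/2\<close>, on \<open>a\<close>. This balances the growth
    \<open>d powr (2 * t)\<close> and leaves \<open>d\<close> with the exponent
    \<open>t - 5/2 < -1\<close>, which is summable.\<close>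
  have second: "(d / a) powr (2 * t) / (d * q)\<^sup>2 \<le> d powr (t - 5/2) * a powr (-3/2)"
  proof -
    have "1 / q\<^sup>2 = q powr (- (t + 1/2)) * q powr (- (3/2 - t))"
      using q1 by (simp add: powr_add[symmetric] powr_minus powr_numeral field_simps)
    also have "\<dots> \<le> d powr (- (t + 1/2)) * a powr (- (3/2 - t))"
      using d1 a1 dq aq t by (intro mult_mono powr_mono2') auto
    finally have *: "1 / q\<^sup>2 \<le> d powr (- (t + 1/2)) * a powr (- (3/2 - t))" .
    have "(d / a) powr (2 * t) / (d * q)\<^sup>2 = (d powr (2 * t) * d powr (-2) * a powr (- 2 * t)) * (1 / q\<^sup>2)"
      using d1 a1 q1 by (simp add: powr_minus powr_numeral field_simps power_mult_distrib powr_divide)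
    also have "\<dots> \<le> (d powr (2 * t) * d powr (-2) * a powr (- 2 * t))
        * (d powr (- (t + 1/2)) * a powr (- (3/2 - t)))"
      using * by (intro mult_left_mono) auto
    also have "\<dots> = (d powr (2 * t) * d powr (-2) * d powr (- (t + 1/2)))
        * (a powr (- 2 * t) * a powr (- (3/2 - t)))"
      by (simp only: mult_ac)
    also have "\<dots> = d powr (t - 5/2) * a powr (- t - 3/2)"
      by (simp only: powr_add[symmetric]) (simp add: algebra_simps)
    also have "\<dots> \<le> d powr (t - 5/2) * a powr (-3/2)"
      using a1 t by (intro mult_left_mono powr_mono) auto
    finally show ?thesis .
  qed
  have kap2: "(kap p n)\<^sup>2 = 1 / (d * q)\<^sup>2"
    by (simp add: kap_off[OF \<open>p \<noteq> n\<close>] d_def q_def power_divide)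
  have "(wt s p * kap p n * wt (- s) n)\<^sup>2 = (wt s p * wt (- s) n)\<^sup>2 * (kap p n)\<^sup>2"
    by (simp add: power_mult_distrib)
  also have "\<dots> \<le> (8 * (1 + (d / a) powr (2 * t))) * (1 / (d * q)\<^sup>2)"
    unfolding kap2 by (intro mult_right_mono order_trans[OF 1 split]) auto
  also have "\<dots> = 8 * (1 / (d * q)\<^sup>2 + (d / a) powr (2 * t) / (d * q)\<^sup>2)"
    by (simp add: add_divide_distrib)
  also have "\<dots> \<le> 8 * (2 * (d powr (t - 5/2) * a powr (-3/2)))"
    by (rule mult_left_mono) (use add_mono[OF first second] in \<open>simp_all add: mult.commute\<close>)
  also have "\<dots> = 16 * wt (t - 5/2) ((p - n) + (n - p)) * a powr (-3/2)"
    using d1 by (simp add: wt_def d_def max_def)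
  \<comment> \<open>\<open>a\<close> is one of the two raised indices, so adding both weights gives
    a majorant symmetric in \<open>p\<close> and \<open>n\<close>.\<close>
  also have "\<dots> \<le> 16 * wt (t - 5/2) ((p - n) + (n - p)) * (wt (-3/2) p + wt (-3/2) n)"
    by (intro mult_left_mono) (auto simp: wt_def a_def min_def max_def)
  finally show ?thesis .
qed

text \<open>The diagonal is removed because its weighted entries are all 1, which no square summable
  matrix can have; it becomes the identity in \<open>kap_bounded\<close>.\<close>

lemma square_summable_weighted_kap:
  fixes s :: real
  assumes s: "\<bar>s\<bar> < 3/2"
  defines "G \<equiv> \<lambda>p n. if p = n then 0 else wt s p * kap p n * wt (- s) n"
  shows "\<And>p. summable (\<lambda>n. (G p n)\<^sup>2)" and "summable (\<lambda>p. \<Sum>n. (G p n)\<^sup>2)"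
proof -
  \<comment> \<open>Raised to at least 1/2, as \<open>weighted_kap_bound\<close> demands;
    \<open>t < 3/2\<close> is kept.\<close>
  define t where "t = max (1/2) \<bar>s\<bar>"
  have t: "\<bar>s\<bar> \<le> t" "1/2 \<le> t" "t < 3/2" using s by (auto simp: t_def)
  define h where "h = wt (t - 5/2)"
  have h: "summable h" "\<And>n. h n \<ge> 0"
    using t by (auto simp: h_def intro!: summable_wt)
  have w: "summable (wt (-3/2))" by (intro summable_wt) auto
  define D where "D p n = (p - n) + (n - p)" for p n :: nat
  \<comment> \<open>One half of the majorant: with \<open>p\<close> fixed it depends on
    \<open>n\<close> only through the distance, so its row sums are controlled by
    \<open>summable_shifted\<close>. The other half is the transpose, reached by exchanging the
    sums.\<close>
  define E where "E p n = h (D p n) * wt (-3/2) p" for p n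
  have E0: "E p n \<ge> 0" for p n by (simp add: E_def h)
  have E1: "summable (\<lambda>n. \<bar>E p n\<bar>)" for p
    using summable_shifted(1)[OF h, of p] E0 by (simp add: E_def D_def summable_mult2)
  have "(\<Sum>n. \<bar>E p n\<bar>) \<le> 2 * suminf h * wt (-3/2) p" for p
    using summable_shifted[OF h, of p] E0
    by (simp add: E_def D_def suminf_mult2[symmetric] mult_right_mono)
  then have E2: "summable (\<lambda>p. \<Sum>n. \<bar>E p n\<bar>)"
    using E1 w
    by (intro summable_comparison_test[OF _ summable_mult[OF w, of "2 * suminf h"]])
       (auto simp: suminf_nonneg)
  note sw = suminf_swap[of E, OF E1 E2]
  have D_comm: "D p n = D n p" for p n by (simp add: D_def)
  have bound: "(G p n)\<^sup>2 \<le> 16 * (\<bar>E p n\<bar> + \<bar>E n p\<bar>)" for p n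
  proof (cases "p = n")
    case False
    then have "(G p n)\<^sup>2 \<le> 16 * h (D p n) * (wt (-3/2) p + wt (-3/2) n)"
      using weighted_kap_bound[OF False t] by (simp add: G_def h_def D_def)
    also have "\<dots> = 16 * (\<bar>E p n\<bar> + \<bar>E n p\<bar>)"
      using E0 by (simp only: abs_of_nonneg) (simp add: E_def D_comm[of n p] algebra_simps)
    finally show ?thesis .
  qed (simp add: G_def)
  have s1: "summable (\<lambda>n. 16 * (\<bar>E p n\<bar> + \<bar>E n p\<bar>))" for p
    using E1 sw(1) by (intro summable_mult summable_add)
  show g: "summable (\<lambda>n. (G p n)\<^sup>2)" for p
    using bound by (intro summable_comparison_test[OF _ s1[of p]]) auto
  have "(\<Sum>n. (G p n)\<^sup>2) \<le> 16 * ((\<Sum>n. \<bar>E p n\<bar>) + (\<Sum>n. \<bar>E n p\<bar>))" for p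
  proof -
    have "(\<Sum>n. (G p n)\<^sup>2) \<le> (\<Sum>n. 16 * (\<bar>E p n\<bar> + \<bar>E n p\<bar>))"
      using bound g s1 by (intro suminf_le)
    also have "\<dots> = 16 * ((\<Sum>n. \<bar>E p n\<bar>) + (\<Sum>n. \<bar>E n p\<bar>))"
      using E1 sw(1) by (subst suminf_mult) (simp_all only: suminf_add summable_add)
    finally show ?thesis .
  qed
  then show "summable (\<lambda>p. \<Sum>n. (G p n)\<^sup>2)"
    using g by (intro summable_comparison_test[OF _ summable_mult[OF summable_add[OF E2 sw(2)], of 16]])
       (auto simp: suminf_nonneg)
qed

text \<open>In the variable \<open>wt s n * v n\<close> the kernel is the identity plus the
  Hilbert-Schmidt matrix \<open>G\<close>. The inequality
  \<open>(x + y)^2 \<le> 2 * x^2 + 2 * y^2\<close> then gives \<open>Z = 2 + 2 * H\<close>, with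
  \<open>H\<close> the squared Hilbert-Schmidt norm of \<open>G\<close>.\<close>

lemma kap_bounded:
  assumes s: "\<bar>s\<bar> < 3/2"
  obtains Z where "Z \<ge> 0"
    and "\<And>v p. summable (\<lambda>n. (wt s n * v n)\<^sup>2) \<Longrightarrow> summable (\<lambda>n. kap p n * \<bar>v n\<bar>)"
    and "\<And>v. summable (\<lambda>n. (wt s n * v n)\<^sup>2) \<Longrightarrow>
      summable (\<lambda>p. (wt s p * (\<Sum>n. kap p n * \<bar>v n\<bar>))\<^sup>2)"
    and "\<And>v. summable (\<lambda>n. (wt s n * v n)\<^sup>2) \<Longrightarrow>
      (\<Sum>p. (wt s p * (\<Sum>n. kap p n * \<bar>v n\<bar>))\<^sup>2) \<le> Z * (\<Sum>n. (wt s n * v n)\<^sup>2)"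
proof -
  define G where "G p n = (if p = n then 0 else wt s p * kap p n * wt (- s) n)" for p n
  have G: "\<And>p. summable (\<lambda>n. (G p n)\<^sup>2)" "summable (\<lambda>p. \<Sum>n. (G p n)\<^sup>2)"
    unfolding G_def using square_summable_weighted_kap[OF s] by auto
  define H where "H = (\<Sum>p. \<Sum>n. (G p n)\<^sup>2)"
  have H0: "H \<ge> 0" unfolding H_def using G by (intro suminf_nonneg) auto
  have main: "summable (\<lambda>n. kap p n * \<bar>v n\<bar>)"
     "summable (\<lambda>p. (wt s p * (\<Sum>n. kap p n * \<bar>v n\<bar>))\<^sup>2)"
     "(\<Sum>p. (wt s p * (\<Sum>n. kap p n * \<bar>v n\<bar>))\<^sup>2) \<le> (2 + 2 * H) * (\<Sum>n. (wt s n * v n)\<^sup>2)"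
    if v: "summable (\<lambda>n. (wt s n * v n)\<^sup>2)" for v p
  proof -
    define x where "x n = wt s n * v n" for n
    have x: "summable (\<lambda>n. (x n)\<^sup>2)" using v by (simp add: x_def)
    note hs = hilbert_schmidt[OF G x]
    have summand: "kap p n * \<bar>v n\<bar> = wt (- s) p * ((if n = p then \<bar>x p\<bar> else 0) + \<bar>G p n * x n\<bar>)" for p n
    proof (cases "n = p")
      case True
      have "wt (- s) p * \<bar>x p\<bar> = (wt (- s) p * wt s p) * \<bar>v p\<bar>"
        by (simp only: x_def abs_mult abs_of_pos wt_pos mult.assoc)
      then show ?thesis using True by (simp add: G_def)
    next
      case False
      then have "wt (- s) p * \<bar>G p n * x n\<bar>
        = (wt (- s) p * wt s p) * (wt (- s) n * wt s n) * (kap p n * \<bar>v n\<bar>)"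
        by (simp add: G_def x_def abs_mult mult_ac del: wt_mult_minus)
      then show ?thesis using False by simp
    qed
    have sd: "(\<lambda>n. if n = p then \<bar>x p\<bar> else 0) sums \<bar>x p\<bar>" for p
      using sums_single[of p "\<lambda>_. \<bar>x p\<bar>"] by simp
    have sm: "(\<lambda>n. kap p n * \<bar>v n\<bar>) sums (wt (- s) p * (\<bar>x p\<bar> + (\<Sum>n. \<bar>G p n * x n\<bar>)))" for p
      unfolding summand using hs(1) sd by (intro sums_mult sums_add) (auto simp: summable_sums)
    show "summable (\<lambda>n. kap p n * \<bar>v n\<bar>)"
      using sm sums_summable by blast
    define g where "g p = (\<Sum>n. \<bar>G p n * x n\<bar>)" for p
    have eq: "wt s p * (\<Sum>n. kap p n * \<bar>v n\<bar>) = \<bar>x p\<bar> + g p" for p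
    proof -
      have "wt s p * (\<Sum>n. kap p n * \<bar>v n\<bar>) = (wt s p * wt (- s) p) * (\<bar>x p\<bar> + g p)"
        using sm[of p] by (simp only: sums_iff g_def mult.assoc)
      then show ?thesis by simp
    qed
    have le: "(\<bar>x p\<bar> + g p)\<^sup>2 \<le> 2 * (x p)\<^sup>2 + 2 * (g p)\<^sup>2" for p
      using sum_squares_bound[of "\<bar>x p\<bar>" "g p"] by (simp add: power2_sum)
    have s2: "summable (\<lambda>p. 2 * (x p)\<^sup>2 + 2 * (g p)\<^sup>2)"
      using x hs(2) by (intro summable_add summable_mult) (auto simp: g_def)
    show s3: "summable (\<lambda>p. (wt s p * (\<Sum>n. kap p n * \<bar>v n\<bar>))\<^sup>2)"
      unfolding eq using le by (intro summable_comparison_test[OF _ s2]) auto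
    have "(\<Sum>p. (wt s p * (\<Sum>n. kap p n * \<bar>v n\<bar>))\<^sup>2) \<le> (\<Sum>p. 2 * (x p)\<^sup>2 + 2 * (g p)\<^sup>2)"
      using le s2 s3 unfolding eq by (intro suminf_le)
    also have "\<dots> = 2 * (\<Sum>p. (x p)\<^sup>2) + 2 * (\<Sum>p. (g p)\<^sup>2)"
      using x hs(2) by (simp add: g_def suminf_add[symmetric] suminf_mult summable_mult)
    also have "\<dots> \<le> (2 + 2 * H) * (\<Sum>n. (x n)\<^sup>2)"
      using hs(3) by (simp add: g_def H_def algebra_simps)
    finally show "(\<Sum>p. (wt s p * (\<Sum>n. kap p n * \<bar>v n\<bar>))\<^sup>2) \<le> (2 + 2 * H) * (\<Sum>n. (wt s n * v n)\<^sup>2)"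
      by (simp add: x_def)
  qed
  show ?thesis
    using main H0 by (intro that[of "2 + 2 * H"]) auto
qed

section \<open>Matrices dominated by the model kernel, and their inverses\<close>

lemma summable_weighted_mono:
  assumes "summable (\<lambda>n. (wt t n * v n)\<^sup>2)" and "s \<le> t"
  shows "summable (\<lambda>n. (wt s n * v n)\<^sup>2)"
    and "(\<Sum>n. (wt s n * v n)\<^sup>2) \<le> (\<Sum>n. (wt t n * v n)\<^sup>2)"
proof -
  have le: "(wt s n * v n)\<^sup>2 \<le> (wt t n * v n)\<^sup>2" for n
    unfolding power_mult_distrib using assms(2)
    by (intro mult_right_mono power_mono wt_mono) auto
  show s: "summable (\<lambda>n. (wt s n * v n)\<^sup>2)"
    using le by (intro summable_comparison_test[OF _ assms(1)]) auto
  show "(\<Sum>n. (wt s n * v n)\<^sup>2) \<le> (\<Sum>n. (wt t n * v n)\<^sup>2)"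
    using le s assms(1) by (intro suminf_le)
qed

text \<open>Conjugation with the weight of order \<open>m\<close> turns such a bound into one by
  \<open>kap\<close>, so boundedness at order \<open>m + s\<close> is that of \<open>kap\<close> at
  order \<open>s\<close>. The matrix of the transform and its inverse are both of this kind.\<close>

definition kernel :: "real \<Rightarrow> (nat \<Rightarrow> nat \<Rightarrow> real) \<Rightarrow> bool" where
  "kernel m L \<longleftrightarrow> (\<exists>B. \<forall>p n. \<bar>L p n\<bar> \<le> B * (wt (- m) p * kap p n * wt m n))"

lemma kernel_bounded:
  assumes "kernel m L" and s: "\<bar>s\<bar> < 3/2"
  obtains Z where "Z \<ge> 0"
    and "\<And>u p. summable (\<lambda>n. (wt (m + s) n * u n)\<^sup>2) \<Longrightarrow> summable (\<lambda>n. \<bar>L p n * u n\<bar>)"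
    and "\<And>u. summable (\<lambda>n. (wt (m + s) n * u n)\<^sup>2) \<Longrightarrow>
      summable (\<lambda>p. (wt (m + s) p * (\<Sum>n. \<bar>L p n * u n\<bar>))\<^sup>2)"
    and "\<And>u. summable (\<lambda>n. (wt (m + s) n * u n)\<^sup>2) \<Longrightarrow>
      (\<Sum>p. (wt (m + s) p * (\<Sum>n. \<bar>L p n * u n\<bar>))\<^sup>2) \<le> Z * (\<Sum>n. (wt (m + s) n * u n)\<^sup>2)"
proof -
  obtain B where B: "\<And>p n. \<bar>L p n\<bar> \<le> B * (wt (- m) p * kap p n * wt m n)"
    using assms(1) by (auto simp: kernel_def)
  obtain Z where Z: "Z \<ge> 0"
    "\<And>v p. summable (\<lambda>n. (wt s n * v n)\<^sup>2) \<Longrightarrow> summable (\<lambda>n. kap p n * \<bar>v n\<bar>)"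
    "\<And>v. summable (\<lambda>n. (wt s n * v n)\<^sup>2) \<Longrightarrow>
      summable (\<lambda>p. (wt s p * (\<Sum>n. kap p n * \<bar>v n\<bar>))\<^sup>2)"
    "\<And>v. summable (\<lambda>n. (wt s n * v n)\<^sup>2) \<Longrightarrow>
      (\<Sum>p. (wt s p * (\<Sum>n. kap p n * \<bar>v n\<bar>))\<^sup>2) \<le> Z * (\<Sum>n. (wt s n * v n)\<^sup>2)"
    using kap_bounded[OF s] by blast
  have main: "summable (\<lambda>n. \<bar>L p n * u n\<bar>)"
     "summable (\<lambda>p. (wt (m + s) p * (\<Sum>n. \<bar>L p n * u n\<bar>))\<^sup>2)"
     "(\<Sum>p. (wt (m + s) p * (\<Sum>n. \<bar>L p n * u n\<bar>))\<^sup>2) \<le> (B\<^sup>2 * Z) * (\<Sum>n. (wt (m + s) n * u n)\<^sup>2)"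
    if u: "summable (\<lambda>n. (wt (m + s) n * u n)\<^sup>2)" for u p
  proof -
    define v where "v n = wt m n * u n" for n
    have wv: "wt s n * v n = wt (m + s) n * u n" for n
      by (simp add: v_def wt_add)
    have v: "summable (\<lambda>n. (wt s n * v n)\<^sup>2)" using u by (simp add: wv)
    have le: "\<bar>L p n * u n\<bar> \<le> B * wt (- m) p * (kap p n * \<bar>v n\<bar>)" for p n
      using mult_right_mono[OF B[of p n], of "\<bar>u n\<bar>"] by (simp add: v_def abs_mult mult_ac)
    have s1: "summable (\<lambda>n. B * wt (- m) p * (kap p n * \<bar>v n\<bar>))" for p
      using Z(2)[OF v] by (intro summable_mult)
    show s2: "summable (\<lambda>n. \<bar>L p n * u n\<bar>)" for p
      using le by (intro summable_comparison_test[OF _ s1]) auto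
    have le1: "wt (m + s) p * (\<Sum>n. \<bar>L p n * u n\<bar>) \<le> B * (wt s p * (\<Sum>n. kap p n * \<bar>v n\<bar>))" for p
    proof -
      have "(\<Sum>n. \<bar>L p n * u n\<bar>) \<le> B * wt (- m) p * (\<Sum>n. kap p n * \<bar>v n\<bar>)"
        using suminf_le[OF le s2 s1] Z(2)[OF v] by (simp add: suminf_mult)
      then have "wt (m + s) p * (\<Sum>n. \<bar>L p n * u n\<bar>)
          \<le> wt (m + s) p * (B * wt (- m) p * (\<Sum>n. kap p n * \<bar>v n\<bar>))"
        by (intro mult_left_mono) auto
      also have "\<dots> = (wt m p * wt (- m) p) * (B * (wt s p * (\<Sum>n. kap p n * \<bar>v n\<bar>)))"
        by (simp only: wt_add mult_ac)
      finally show ?thesis by simp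
    qed
    have le2: "(wt (m + s) p * (\<Sum>n. \<bar>L p n * u n\<bar>))\<^sup>2 \<le> B\<^sup>2 * (wt s p * (\<Sum>n. kap p n * \<bar>v n\<bar>))\<^sup>2" for p
    proof -
      have "(wt (m + s) p * (\<Sum>n. \<bar>L p n * u n\<bar>))\<^sup>2 \<le> (B * (wt s p * (\<Sum>n. kap p n * \<bar>v n\<bar>)))\<^sup>2"
        using le1 s2 by (intro power_mono mult_nonneg_nonneg suminf_nonneg) auto
      then show ?thesis by (simp add: power_mult_distrib)
    qed
    have s3: "summable (\<lambda>p. B\<^sup>2 * (wt s p * (\<Sum>n. kap p n * \<bar>v n\<bar>))\<^sup>2)"
      using Z(3)[OF v] by (intro summable_mult)
    show s4: "summable (\<lambda>p. (wt (m + s) p * (\<Sum>n. \<bar>L p n * u n\<bar>))\<^sup>2)"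
      using le2 by (intro summable_comparison_test[OF _ s3]) auto
    have "(\<Sum>p. (wt (m + s) p * (\<Sum>n. \<bar>L p n * u n\<bar>))\<^sup>2)
        \<le> B\<^sup>2 * (\<Sum>p. (wt s p * (\<Sum>n. kap p n * \<bar>v n\<bar>))\<^sup>2)"
      using suminf_le[OF le2 s4 s3] Z(3)[OF v] by (simp add: suminf_mult)
    also have "\<dots> \<le> B\<^sup>2 * (Z * (\<Sum>n. (wt s n * v n)\<^sup>2))"
      using Z(4)[OF v] by (intro mult_left_mono) auto
    finally show "(\<Sum>p. (wt (m + s) p * (\<Sum>n. \<bar>L p n * u n\<bar>))\<^sup>2)
        \<le> (B\<^sup>2 * Z) * (\<Sum>n. (wt (m + s) n * u n)\<^sup>2)"
      by (simp add: wv mult.assoc)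
  qed
  show ?thesis
    using main Z(1) by (intro that[of "B\<^sup>2 * Z"]) auto
qed

text \<open>The weighted spaces shrink as \<open>s\<close> grows, so orders above the range of
  \<open>kernel_bounded\<close> are treated as order \<open>min s 0\<close>, which is enough for
  convergence of a single row.\<close>

lemma kernel_summable:
  assumes "kernel m L" and "s > -3/2" and u: "summable (\<lambda>n. (wt (m + s) n * u n)\<^sup>2)"
  shows "summable (\<lambda>n. \<bar>L p n * u n\<bar>)"
proof -
  have "\<bar>min s 0\<bar> < 3/2" using assms(2) by auto
  then have "summable (\<lambda>n. (wt (m + min s 0) n * u n)\<^sup>2) \<Longrightarrow> summable (\<lambda>n. \<bar>L p n * u n\<bar>)"
    by (rule kernel_bounded[OF assms(1)])
  moreover have "summable (\<lambda>n. (wt (m + min s 0) n * u n)\<^sup>2)"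
    by (rule summable_weighted_mono(1)[OF u]) simp
  ultimately show ?thesis .
qed

text \<open>Passing from an entrywise product to a composition is an exchange of sums. Summing
  \<open>\<bar>L' n q * u q\<bar>\<close> over \<open>q\<close> stays in the weighted space, on
  which the rows of \<open>L\<close> act absolutely, so the double series converges
  absolutely.\<close>

lemma kernel_inverse:
  assumes L: "kernel m L" and L': "kernel m L'" and s: "\<bar>s\<bar> < 3/2"
    and u: "summable (\<lambda>n. (wt (m + s) n * u n)\<^sup>2)"
    and id: "\<And>p q. (\<Sum>n. L p n * L' n q) = (if p = q \<and> p \<in> J then 1 else 0)"
    and supp: "\<And>q. q \<notin> J \<Longrightarrow> u q = 0"
  shows "(\<Sum>n. L p n * (\<Sum>q. L' n q * u q)) = u p"
proof -
  have Z: "summable (\<lambda>n. \<bar>L' p n * u n\<bar>)"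
    "summable (\<lambda>p. (wt (m + s) p * (\<Sum>n. \<bar>L' p n * u n\<bar>))\<^sup>2)" for p
    using kernel_bounded[OF L' s] u by blast+
  have Z': "summable (\<lambda>n. (wt (m + s) n * v n)\<^sup>2) \<Longrightarrow> summable (\<lambda>n. \<bar>L p n * v n\<bar>)" for v
    by (rule kernel_bounded[OF L s])
  define f where "f n q = L p n * (L' n q * u q)" for n q
  have f1: "summable (\<lambda>q. \<bar>f n q\<bar>)" for n
    using Z(1) by (simp add: f_def abs_mult[of "L p n"] summable_mult)
  have eq: "(\<Sum>q. \<bar>f n q\<bar>) = \<bar>L p n * (\<Sum>q. \<bar>L' n q * u q\<bar>)\<bar>" for n
    using Z(1) by (simp add: f_def abs_mult[of "L p n"] suminf_mult suminf_nonneg)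
  have f2: "summable (\<lambda>n. \<Sum>q. \<bar>f n q\<bar>)"
    unfolding eq by (intro Z' Z(2))
  note sw = suminf_swap[of f, OF f1 f2]
  have "(\<Sum>n. L p n * (\<Sum>q. L' n q * u q)) = (\<Sum>n. \<Sum>q. f n q)"
    by (simp add: f_def suminf_mult summable_rabs_cancel[OF Z(1)])
  also have "\<dots> = (\<Sum>q. \<Sum>n. f n q)" by (simp add: sw(3))
  also have "\<dots> = (\<Sum>q. if q = p then u p else 0)"
  proof (intro suminf_cong)
    fix q
    show "(\<Sum>n. f n q) = (if q = p then u p else 0)"
    proof (cases "u q = 0")
      case False
      then have "q \<in> J" using supp by blast
      \<comment> \<open>The hypothesis \<open>id\<close> gives only the value of a
        \<open>suminf\<close>, not its convergence; for \<open>u q \<noteq> 0\<close> convergence is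
        recovered from the exchange of sums.\<close>
      have "summable (\<lambda>n. f n q)" by (rule summable_rabs_cancel[OF sw(1)])
      then have "summable (\<lambda>n. L p n * L' n q)"
        using False summable_mult2[of "\<lambda>n. f n q" "1 / u q"] by (simp add: f_def)
      then have "(\<Sum>n. f n q) = (\<Sum>n. L p n * L' n q) * u q"
        by (simp add: f_def suminf_mult2 mult.assoc)
      then show ?thesis using id \<open>q \<in> J\<close> by auto
    qed (auto simp: f_def)
  qed
  also have "\<dots> = u p"
    using sums_single[of p "\<lambda>_. u p"] by (simp add: sums_iff)
  finally show ?thesis .
qed

section \<open>Cauchy matrices\<close>

text \<open>The factor \<open>- lam\<close> is the residue contributed by the pole of the factor
  \<open>j = n\<close>; the remaining factors are evaluated at \<open>z = n^2\<close>.\<close>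

definition res_fin :: "real \<Rightarrow> nat set \<Rightarrow> nat \<Rightarrow> real" where
  "res_fin lam S n = - lam * (\<Prod>j\<in>S - {n}. 1 - lam / ((real n)\<^sup>2 - (real j)\<^sup>2))"

lemma res_fin_insert:
  assumes "finite S" "m \<notin> S" "n \<in> S"
  shows "res_fin lam (insert m S) n = res_fin lam S n * (1 - lam / ((real n)\<^sup>2 - (real m)\<^sup>2))"
proof -
  have "insert m S - {n} = insert m (S - {n})" "m \<notin> S - {n}"
    using assms by auto
  then show ?thesis using assms(1) by (simp add: res_fin_def mult_ac)
qed

text \<open>Induction on \<open>S\<close> with \<open>z\<close> arbitrary: the coefficient at the
  new pole is \<open>- lam\<close> times the old product at that pole, which the induction
  hypothesis expands once more.\<close>

lemma partial_fractions:
  assumes "finite S" and "\<And>n. n \<in> S \<Longrightarrow> z \<noteq> (real n)\<^sup>2"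
  shows "(\<Prod>j\<in>S. 1 - lam / (z - (real j)\<^sup>2)) = 1 + (\<Sum>n\<in>S. res_fin lam S n / (z - (real n)\<^sup>2))"
  using assms
proof (induction S arbitrary: z rule: finite_induct)
  case (insert m S)
  define R where "R = res_fin lam S"
  define y where "y n = (real n)\<^sup>2" for n :: nat
  have yinj: "y n \<noteq> y m" if "n \<in> S" for n
    using that insert(2) by (auto simp: y_def)
  have zn: "z \<noteq> y n" if "n \<in> insert m S" for n
    using insert.prems that by (simp add: y_def)
  have Rm: "res_fin lam (insert m S) m = - lam * (1 + (\<Sum>n\<in>S. R n / (y m - y n)))"
    using insert.IH[of "y m"] yinj insert(2) by (force simp: res_fin_def R_def y_def)
  \<comment> \<open>An old simple fraction times the new factor, split again into simple fractions.
    The part at the old pole is the updated residue of \<open>res_fin_insert\<close>; the parts at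
    the new pole add up to its residue.\<close>
  have pf: "R n / (z - y n) * (1 - lam / (z - y m)) =
      R n * (1 - lam / (y n - y m)) / (z - y n) - lam * (R n / (y m - y n)) / (z - y m)"
    if n: "n \<in> S" for n
  proof -
    define u w where "u = z - y n" and "w = y n - y m"
    have d: "u \<noteq> 0" "w \<noteq> 0" "u + w \<noteq> 0"
      using zn[of n] zn[of m] yinj[OF n] n by (auto simp: u_def w_def)
    have e: "z - y m = u + w" "y m - y n = - w" by (simp_all add: u_def w_def)
    show ?thesis
      unfolding e u_def[symmetric] w_def[symmetric]
      using d by (simp add: divide_simps) (simp add: algebra_simps)
  qed
  have "(\<Prod>j\<in>insert m S. 1 - lam / (z - y j))
      = (1 + (\<Sum>n\<in>S. R n / (z - y n))) * (1 - lam / (z - y m))"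
    using insert.IH[of z] insert.prems insert.hyps by (simp add: R_def y_def mult.commute)
  also have "\<dots> = 1 - lam / (z - y m) + (\<Sum>n\<in>S. R n / (z - y n) * (1 - lam / (z - y m)))"
    by (simp only: distrib_right sum_distrib_right) simp
  also have "(\<Sum>n\<in>S. R n / (z - y n) * (1 - lam / (z - y m)))
      = (\<Sum>n\<in>S. R n * (1 - lam / (y n - y m)) / (z - y n) - lam * (R n / (y m - y n)) / (z - y m))"
    by (intro sum.cong refl pf)
  also have "\<dots> = (\<Sum>n\<in>S. res_fin lam (insert m S) n / (z - y n))
      - lam * (\<Sum>n\<in>S. R n / (y m - y n)) / (z - y m)"
    using insert(1,2)
    by (simp add: sum_subtractf sum_distrib_left sum_divide_distrib res_fin_insert R_def y_def)
  also have "1 - lam / (z - y m) + \<dots> = 1 + (\<Sum>n\<in>insert m S. res_fin lam (insert m S) n / (z - y n))"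
    using insert(1,2) by (simp add: Rm diff_divide_distrib add_divide_distrib distrib_left)
  finally show ?case by (simp add: y_def)
qed simp

section \<open>Finite Cauchy matrices: row sums and orthogonality\<close>

lemma sq_diffs_iff: "lam \<notin> sq_diffs \<longleftrightarrow> (\<forall>i j. lam \<noteq> (real i)\<^sup>2 - (real j)\<^sup>2)"
  by (auto simp: sq_diffs_def)

lemma sq_diffs_uminus: "lam \<notin> sq_diffs \<Longrightarrow> - lam \<notin> sq_diffs"
  unfolding sq_diffs_iff by (metis minus_diff_eq minus_minus)

lemma sq_diffs_nz:
  assumes "lam \<notin> sq_diffs"
  shows "lam \<noteq> 0" and "(real p)\<^sup>2 + lam - (real n)\<^sup>2 \<noteq> 0"
proof -
  show "lam \<noteq> 0" using assms[unfolded sq_diffs_iff, rule_format, of 0 0] by simp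
  show "(real p)\<^sup>2 + lam - (real n)\<^sup>2 \<noteq> 0" 
    using assms[unfolded sq_diffs_iff, rule_format, of n p] by auto
qed

lemma cauchy_row_fin:
  assumes lam: "lam \<notin> sq_diffs" and "finite S" "p \<in> S"
  shows "(\<Sum>n\<in>S. res_fin lam S n / ((real p)\<^sup>2 + lam - (real n)\<^sup>2)) = -1"
proof -
  have "(\<Prod>j\<in>S. 1 - lam / ((real p)\<^sup>2 + lam - (real j)\<^sup>2)) = 0"
    using assms sq_diffs_nz(1)[OF lam] by (intro prod_zero bexI[of _ p]) auto
  moreover have "\<And>n. (real p)\<^sup>2 + lam \<noteq> (real n)\<^sup>2"
    using sq_diffs_nz(2)[OF lam] by (metis diff_self)
  ultimately show ?thesis
    using partial_fractions[OF assms(2), of "(real p)\<^sup>2 + lam" lam] by simp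
qed

text \<open>For \<open>p \<noteq> q\<close> the product of two fractions splits into a difference of
  two row sums, both equal to -1. For \<open>p = q\<close> the sum is minus the derivative of the
  rational product at its zero \<open>p^2 + lam\<close>; it is found without differentiation by
  taking out the factor of index \<open>p\<close>, with the result \<open>- P / lam\<close>.\<close>

lemma cauchy_orth_fin:
  assumes lam: "lam \<notin> sq_diffs" and S: "finite S" "p \<in> S" "q \<in> S"
  shows "res_fin (- lam) S p *
    (\<Sum>n\<in>S. res_fin lam S n / (((real p)\<^sup>2 + lam - (real n)\<^sup>2) * ((real q)\<^sup>2 + lam - (real n)\<^sup>2)))
    = (if p = q then -1 else 0)"
proof -
  define y where "y n = (real n)\<^sup>2" for n :: nat
  define x where "x n = y n + lam" for n
  note nz = sq_diffs_nz[OF lam]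
  have xy: "x i - y j \<noteq> 0" for i j using nz(2)[of i j] by (simp add: x_def y_def)
  show ?thesis
  proof (cases "p = q")
    case False
    then have pq: "x q - x p \<noteq> 0" by (simp add: x_def y_def)
    have "R / ((x p - y n) * (x q - y n)) = (R / (x p - y n) - R / (x q - y n)) / (x q - x p)" for n R
      using xy[of p n] xy[of q n] pq by (simp add: divide_simps) (simp add: algebra_simps)
    then have "(\<Sum>n\<in>S. res_fin lam S n / ((x p - y n) * (x q - y n)))
      = ((\<Sum>n\<in>S. res_fin lam S n / (x p - y n)) - (\<Sum>n\<in>S. res_fin lam S n / (x q - y n))) / (x q - x p)"
      by (simp add: sum_subtractf sum_divide_distrib[symmetric])
    also have "\<dots> = 0"
      using cauchy_row_fin[OF lam S(1)] S(2,3) by (simp add: x_def y_def)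
    finally show ?thesis using False by (simp add: x_def y_def)
  next
    case True
    define S' where "S' = S - {p}"
    have S': "finite S'" "p \<notin> S'" "S = insert p S'" using S by (auto simp: S'_def)
    define R where "R = res_fin lam S'"
    define A where "A = (\<Sum>n\<in>S'. R n / (y p - y n))"
    define P where "P = (\<Prod>j\<in>S'. 1 - lam / (x p - y j))"
    have ypn: "y n - y p \<noteq> 0" if "n \<in> S'" for n
      using that S'(2) by (auto simp: y_def)
    have P: "P = 1 + (\<Sum>n\<in>S'. R n / (x p - y n))"
      using partial_fractions[OF S'(1), of "x p" lam] xy
      by (force simp: P_def R_def y_def)
    have "(\<Prod>j\<in>S'. 1 - lam / (y p - y j)) = 1 + A"
      using partial_fractions[OF S'(1), of "y p" lam] ypn
      by (force simp: A_def R_def y_def)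
    then have Rp: "res_fin lam S p = - lam * (1 + A)"
      by (simp add: res_fin_def S'_def y_def)
    \<comment> \<open>Restoring the index \<open>p\<close> multiplies \<open>R n\<close> by
      \<open>(x p - y n) / (y p - y n)\<close>, which cancels one of the two equal
      denominators.\<close>
    have summand: "res_fin lam S n / ((x p - y n) * (x p - y n))
        = (R n / (y p - y n) - R n / (x p - y n)) / lam" if n: "n \<in> S'" for n
    proof -
      have d: "y p - y n \<noteq> 0" "y n - y p \<noteq> 0" "x p - y n \<noteq> 0"
        using ypn[OF n] xy[of p n] by auto
      have x: "x p = y p + lam" by (simp add: x_def)
      have "res_fin lam S n = R n * ((x p - y n) / (y p - y n))"
        using d res_fin_insert[OF S'(1,2) n, of lam] S'(3)
        by (simp add: R_def y_def x divide_simps) (simp add: algebra_simps)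
      then have "res_fin lam S n / ((x p - y n) * (x p - y n)) = R n / ((y p - y n) * (x p - y n))"
        using d by simp
      also have "\<dots> = (R n / (y p - y n) - R n / (x p - y n)) / lam"
        using d nz(1) by (simp add: divide_simps) (simp add: x algebra_simps)
      finally show ?thesis .
    qed
    have "(\<Sum>n\<in>S. res_fin lam S n / ((x p - y n) * (x p - y n)))
        = res_fin lam S p / (lam * lam) + (\<Sum>n\<in>S'. res_fin lam S n / ((x p - y n) * (x p - y n)))"
      using S' by (simp add: x_def)
    also have "(\<Sum>n\<in>S'. res_fin lam S n / ((x p - y n) * (x p - y n))) = (A - (P - 1)) / lam"
      unfolding P A_def by (simp add: summand sum_subtractf sum_divide_distrib[symmetric])
    also have "res_fin lam S p / (lam * lam) + (A - (P - 1)) / lam = - P / lam"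
      using nz(1) by (simp add: Rp divide_simps)
    finally have sum: "(\<Sum>n\<in>S. res_fin lam S n / ((x p - y n) * (x p - y n))) = - P / lam" .
    \<comment> \<open>The residue for \<open>- lam\<close> at \<open>y p\<close> and the product for
      \<open>lam\<close> at \<open>x p = y p + lam\<close> are reciprocal factor by factor, up to
      the leading factor \<open>lam\<close>.\<close>
    have "res_fin (- lam) S p * P = lam * (\<Prod>j\<in>S'. (1 + lam / (y p - y j)) * (1 - lam / (x p - y j)))"
      by (simp add: res_fin_def P_def S'_def[symmetric] y_def prod.distrib)
    also have "\<dots> = lam * (\<Prod>j\<in>S'. 1)"
    proof (intro arg_cong[where f = "\<lambda>t. lam * t"] prod.cong refl)
      fix j assume j: "j \<in> S'"
      have d: "y p - y j \<noteq> 0" "x p - y j \<noteq> 0"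
        using ypn[OF j] xy[of p j] by auto
      show "(1 + lam / (y p - y j)) * (1 - lam / (x p - y j)) = 1"
        using d by (simp add: divide_simps) (simp add: x_def algebra_simps)
    qed
    finally have "res_fin (- lam) S p * P = lam" by simp
    then have "res_fin (- lam) S p * (- P / lam) = -1" using nz(1) by simp
    then show ?thesis using sum True by (simp add: x_def y_def)
  qed
qed

section \<open>Residues of infinite products, with bounds uniform in the truncation\<close>

lemma sum_inverse_diff_squares:
  assumes "0 < \<delta>" "\<delta> < 1"
  shows "\<exists>C. \<forall>n S. finite S \<longrightarrow>
    (\<Sum>j\<in>S - {n}. 1 / \<bar>(real n)\<^sup>2 - (real j)\<^sup>2\<bar>) \<le> C * wt (\<delta> - 1) n"
proof (intro exI allI impI)
  fix n :: nat and S :: "nat set"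
  assume S: "finite S"
  define h where "h = wt (- 1 - \<delta>)"
  have h: "summable h" "\<And>n. h n \<ge> 0"
    using assms by (auto simp: h_def intro!: summable_wt)
  have "1 / \<bar>(real n)\<^sup>2 - (real j)\<^sup>2\<bar> \<le> h ((n - j) + (j - n)) * wt (\<delta> - 1) n" if "j \<noteq> n" for j
  proof -
    define d q a where "d = real ((n - j) + (j - n))" and "q = real n + real j"
      and "a = real (max 1 n)"
    have d: "d \<ge> 1" "d \<le> q" "a \<ge> 1" "a \<le> q" using that by (auto simp: d_def q_def a_def)
    \<comment> \<open>The sum is at most of order \<open>log n / n\<close>. Spending a power
      \<open>\<delta>\<close> of \<open>q\<close> on the distance makes the sum over
      \<open>j\<close> converge and leaves \<open>n powr (\<delta> - 1)\<close>, so no logarithm has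
      to be handled.\<close>
    have "1 / q = q powr (- \<delta>) * q powr (\<delta> - 1)"
      using d by (simp add: powr_add[symmetric] powr_neg_one)
    also have "\<dots> \<le> d powr (- \<delta>) * a powr (\<delta> - 1)"
      using d assms by (intro mult_mono powr_mono2') auto
    finally have "1 / d * (1 / q) \<le> d powr (- 1) * (d powr (- \<delta>) * a powr (\<delta> - 1))"
      using d by (intro mult_mono) (auto simp: powr_minus field_simps)
    also have "\<dots> = d powr (- 1 - \<delta>) * a powr (\<delta> - 1)"
      by (simp only: powr_add[symmetric] mult.assoc[symmetric]) simp
    also have "d powr (- 1 - \<delta>) = h ((n - j) + (j - n))"
      using d by (simp add: h_def wt_def d_def max_def)
    finally show ?thesis
      by (simp only: abs_diff_squares_nat d_def[symmetric] q_def[symmetric])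
         (simp add: a_def wt_def)
  qed
  then have "(\<Sum>j\<in>S - {n}. 1 / \<bar>(real n)\<^sup>2 - (real j)\<^sup>2\<bar>)
      \<le> (\<Sum>j\<in>S - {n}. h ((n - j) + (j - n)) * wt (\<delta> - 1) n)"
    by (intro sum_mono) auto
  also have "\<dots> = (\<Sum>j\<in>S - {n}. h ((n - j) + (j - n))) * wt (\<delta> - 1) n"
    by (simp add: sum_distrib_right)
  also have "\<dots> \<le> (2 * suminf h) * wt (\<delta> - 1) n"
    using S h summable_shifted[OF h, of n]
    by (intro mult_right_mono order_trans[OF sum_le_suminf]) auto
  finally show "(\<Sum>j\<in>S - {n}. 1 / \<bar>(real n)\<^sup>2 - (real j)\<^sup>2\<bar>) \<le> (2 * suminf h) * wt (\<delta> - 1) n" 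
    unfolding h_def .
qed

text \<open>A product of factors \<open>1 + z j\<close> differs from 1 by at most
  \<open>\<sigma> * exp \<sigma>\<close>, with \<open>\<sigma>\<close> the sum of the
  \<open>\<bar>z j\<bar>\<close>. Uniformity in \<open>S\<close> is the point: the bound survives
  the limit and supplies the domination in \<open>res_sum_tendsto\<close>.\<close>

lemma res_fin_near:
  assumes "0 < \<delta>" "\<delta> < 1"
  shows "\<exists>C. \<forall>n S. finite S \<longrightarrow> \<bar>res_fin lam S n + lam\<bar> \<le> C * wt (\<delta> - 1) n"
proof -
  obtain C where C: "\<And>n S. finite S \<Longrightarrow>
    (\<Sum>j\<in>S - {n}. 1 / \<bar>(real n)\<^sup>2 - (real j)\<^sup>2\<bar>) \<le> C * wt (\<delta> - 1) n"
    using sum_inverse_diff_squares[OF assms] by blast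
  have C0: "C \<ge> 0" using C[of "{}" 0] by (simp add: wt_def)
  show ?thesis
  proof (intro exI allI impI)
    fix n :: nat and S :: "nat set"
    assume S: "finite S"
    define z where "z j = - lam / ((real n)\<^sup>2 - (real j)\<^sup>2)" for j :: nat
    define \<sigma> where "\<sigma> = (\<Sum>j\<in>S - {n}. \<bar>z j\<bar>)"
    have "\<sigma> = \<bar>lam\<bar> * (\<Sum>j\<in>S - {n}. 1 / \<bar>(real n)\<^sup>2 - (real j)\<^sup>2\<bar>)"
      by (simp add: \<sigma>_def z_def abs_divide sum_distrib_left)
    also have "\<dots> \<le> \<bar>lam\<bar> * (C * wt (\<delta> - 1) n)"
      using C[OF S] by (intro mult_left_mono) auto
    finally have \<sigma>: "\<sigma> \<le> \<bar>lam\<bar> * C * wt (\<delta> - 1) n" by simp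
    have "wt (\<delta> - 1) n \<le> wt 0 n" using assms by (intro wt_mono) auto
    then have "\<bar>lam\<bar> * C * wt (\<delta> - 1) n \<le> \<bar>lam\<bar> * C * 1"
      using C0 by (intro mult_left_mono) auto
    then have \<sigma>1: "\<sigma> \<le> \<bar>lam\<bar> * C" using \<sigma> by simp
    have \<sigma>0: "\<sigma> \<ge> 0" by (simp add: \<sigma>_def sum_nonneg)
    have "\<bar>(\<Prod>j\<in>S - {n}. 1 + z j) - 1\<bar> \<le> (\<Prod>j\<in>S - {n}. 1 + \<bar>z j\<bar>) - 1"
      using norm_prod_minus1_le_prod_minus1[of z "S - {n}"] by simp
    also have "(\<Prod>j\<in>S - {n}. 1 + \<bar>z j\<bar>) \<le> exp \<sigma>"
      unfolding \<sigma>_def by (rule prod_le_exp_sum) auto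
    also have "exp \<sigma> - 1 \<le> \<sigma> * exp \<sigma>"
      using exp_ge_add_one_self[of "- \<sigma>"] by (simp add: exp_minus field_simps)
    also have "\<dots> \<le> (\<bar>lam\<bar> * C * wt (\<delta> - 1) n) * exp (\<bar>lam\<bar> * C)"
      using \<sigma> \<sigma>1 \<sigma>0 by (intro mult_mono) auto
    finally have *: "\<bar>(\<Prod>j\<in>S - {n}. 1 + z j) - 1\<bar> \<le> \<bar>lam\<bar> * C * exp (\<bar>lam\<bar> * C) * wt (\<delta> - 1) n"
      by (simp add: mult_ac)
    have "res_fin lam S n + lam = - lam * ((\<Prod>j\<in>S - {n}. 1 + z j) - 1)"
      by (simp add: res_fin_def z_def algebra_simps)
    then have "\<bar>res_fin lam S n + lam\<bar> = \<bar>lam\<bar> * \<bar>(\<Prod>j\<in>S - {n}. 1 + z j) - 1\<bar>"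
      by (simp add: abs_mult)
    also have "\<dots> \<le> \<bar>lam\<bar> * (\<bar>lam\<bar> * C * exp (\<bar>lam\<bar> * C) * wt (\<delta> - 1) n)"
      using * by (intro mult_left_mono) auto
    finally show "\<bar>res_fin lam S n + lam\<bar>
        \<le> (\<bar>lam\<bar> * (\<bar>lam\<bar> * C * exp (\<bar>lam\<bar> * C))) * wt (\<delta> - 1) n"
      by (simp add: mult_ac)
  qed
qed

text \<open>
  \<open>res J lam n\<close> is the residue at \<open>z = n\<^sup>2\<close> of \<open>\<Prod>j\<in>J. (z - j\<^sup>2 - lam) / (z - j\<^sup>2)\<close>.
\<close>

definition res :: "nat set \<Rightarrow> real \<Rightarrow> nat \<Rightarrow> real" where
  "res J lam n = (if n \<in> J then lim (\<lambda>N. res_fin lam (J \<inter> {..N}) n) else 0)"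

lemma res_fin_tendsto:
  assumes "n \<in> J"
  shows "(\<lambda>N. res_fin lam (J \<inter> {..N}) n) \<longlonglongrightarrow> res J lam n"
proof -
  define f where "f j = (if j \<in> J - {n} then 1 - lam / ((real n)\<^sup>2 - (real j)\<^sup>2) else 1)" for j
  obtain C where C: "\<And>n S. finite S \<Longrightarrow>
    (\<Sum>j\<in>S - {n}. 1 / \<bar>(real n)\<^sup>2 - (real j)\<^sup>2\<bar>) \<le> C * wt (1/2 - 1) n"
    using sum_inverse_diff_squares[of "1/2"] by auto
  have "summable (\<lambda>j. norm (f j - 1))"
  proof (rule summableI_nonneg_bounded)
    fix N
    have le: "norm (f j - 1) \<le> \<bar>lam\<bar> * (1 / \<bar>(real n)\<^sup>2 - (real j)\<^sup>2\<bar>)" for j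
      by (simp add: f_def abs_divide)
    have "(\<Sum>j<N. norm (f j - 1)) = (\<Sum>j\<in>{..<N} - {n}. norm (f j - 1))"
      by (rule sum.mono_neutral_right) (auto simp: f_def)
    also have "\<dots> \<le> (\<Sum>j\<in>{..<N} - {n}. \<bar>lam\<bar> * (1 / \<bar>(real n)\<^sup>2 - (real j)\<^sup>2\<bar>))"
      by (intro sum_mono le)
    also have "\<dots> \<le> \<bar>lam\<bar> * (C * wt (1/2 - 1) n)"
      unfolding sum_distrib_left[symmetric] by (intro mult_left_mono C) auto
    finally show "(\<Sum>j<N. norm (f j - 1)) \<le> \<bar>lam\<bar> * (C * wt (1/2 - 1) n)" .
  qed auto
  then have "convergent_prod f"
    by (intro abs_convergent_prod_imp_convergent_prod) (simp add: abs_convergent_prod_conv_summable)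
  then have c: "convergent (\<lambda>N. - lam * (\<Prod>i\<le>N. f i))"
    by (intro convergent_mult convergent_const convergent_prod_imp_convergent)
  have "(\<Prod>i\<le>N. f i) = (\<Prod>j\<in>J \<inter> {..N} - {n}. 1 - lam / ((real n)\<^sup>2 - (real j)\<^sup>2))" for N
    by (rule prod.mono_neutral_cong_right) (auto simp: f_def)
  then have "convergent (\<lambda>N. res_fin lam (J \<inter> {..N}) n)"
    using c by (simp add: res_fin_def)
  then show ?thesis using assms by (simp add: res_def convergent_LIMSEQ_iff)
qed

text \<open>Source of the decay of \<open>lam + a_n * K_n\<close>: for small \<open>\<delta>\<close>
  the power \<open>\<delta> - 1\<close> stays square summable against \<open>n powr r\<close> for
  any given \<open>r < 1/2\<close>.\<close>

lemma res_near:
  assumes "0 < \<delta>" "\<delta> < 1"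
  shows "\<exists>C. \<forall>n\<in>J. \<bar>res J lam n + lam\<bar> \<le> C * wt (\<delta> - 1) n"
proof -
  obtain C where C: "\<And>n S. finite S \<Longrightarrow> \<bar>res_fin lam S n + lam\<bar> \<le> C * wt (\<delta> - 1) n"
    using res_fin_near[OF assms] by blast
  have "\<bar>res J lam n + lam\<bar> \<le> C * wt (\<delta> - 1) n" if "n \<in> J" for n
  proof (rule LIMSEQ_le_const2)
    show "(\<lambda>N. \<bar>res_fin lam (J \<inter> {..N}) n + lam\<bar>) \<longlonglongrightarrow> \<bar>res J lam n + lam\<bar>"
      by (intro tendsto_intros res_fin_tendsto that)
  qed (use C in auto)
  then show ?thesis by blast
qed

lemma res_fin_bounded: "\<exists>C. \<forall>n S. finite S \<longrightarrow> \<bar>res_fin lam S n\<bar> \<le> C"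
proof -
  obtain C where C: "\<And>n S. finite S \<Longrightarrow> \<bar>res_fin lam S n + lam\<bar> \<le> C * wt (1/2 - 1) n"
    using res_fin_near[of "1/2" lam] by auto
  have "\<bar>res_fin lam S n\<bar> \<le> \<bar>C\<bar> + \<bar>lam\<bar>" if "finite S" for n S
  proof -
    have "wt (1/2 - 1) n \<le> wt 0 n" by (intro wt_mono) auto
    then have "C * wt (1/2 - 1) n \<le> \<bar>C\<bar> * 1" by (intro mult_mono) auto
    then show ?thesis using C[OF that, of n] by linarith
  qed
  then show ?thesis by blast
qed

lemma res_bounded: "\<exists>C. \<forall>n. \<bar>res J lam n\<bar> \<le> C"
proof -
  obtain C where C: "\<And>n S. finite S \<Longrightarrow> \<bar>res_fin lam S n\<bar> \<le> C"
    using res_fin_bounded by blast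
  have "\<bar>res J lam n\<bar> \<le> C" for n
  proof (cases "n \<in> J")
    case True
    show ?thesis
    proof (rule LIMSEQ_le_const2)
      show "(\<lambda>N. \<bar>res_fin lam (J \<inter> {..N}) n\<bar>) \<longlonglongrightarrow> \<bar>res J lam n\<bar>"
        by (intro tendsto_intros res_fin_tendsto True)
    qed (use C in auto)
  next
    case False
    then show ?thesis using C[of "{}" 0] by (simp add: res_def)
  qed
  then show ?thesis by blast
qed

lemma res_sum_tendsto:
  assumes "summable (\<lambda>n. \<bar>g n\<bar>)"
  shows "(\<lambda>N. \<Sum>n\<in>J \<inter> {..N}. res_fin lam (J \<inter> {..N}) n * g n) \<longlonglongrightarrow> (\<Sum>n. res J lam n * g n)"
proof -
  obtain C where C: "\<And>n S. finite S \<Longrightarrow> \<bar>res_fin lam S n\<bar> \<le> C"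
    using res_fin_bounded by blast
  have C0: "C \<ge> 0" using C[of "{}" 0] by (meson abs_ge_zero finite.emptyI order_trans)
  \<comment> \<open>Terms and range both vary with \<open>N\<close>; extension by zero turns the
    truncated sums into series over a fixed index set, to which dominated convergence
    applies.\<close>
  define a where "a n N = (if n \<in> J \<inter> {..N} then res_fin lam (J \<inter> {..N}) n * g n else 0)" for n N
  have lim: "(\<lambda>N. a n N) \<longlonglongrightarrow> res J lam n * g n" for n
  proof (cases "n \<in> J")
    case True
    have "(\<lambda>N. res_fin lam (J \<inter> {..N}) n * g n) \<longlonglongrightarrow> res J lam n * g n"
      by (intro tendsto_mult_right res_fin_tendsto True)
    moreover have "\<forall>\<^sub>F N in sequentially. res_fin lam (J \<inter> {..N}) n * g n = a n N"
      using True by (auto simp: eventually_sequentially a_def)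
    ultimately show ?thesis by (rule Lim_transform_eventually)
  qed (simp add: a_def res_def)
  have bd: "norm (a n N) \<le> C * \<bar>g n\<bar>" for n N
    using C[of "J \<inter> {..N}" n] C0 by (auto simp: a_def abs_mult mult_right_mono)
  have "(\<lambda>N. \<Sum>n. a n N) \<longlonglongrightarrow> (\<Sum>n. res J lam n * g n)"
    using tannerys_theorem[of a _ sequentially, OF lim _ summable_mult[OF assms, of C]] bd
    by (simp add: case_prod_unfold)
  moreover have "(\<Sum>n. a n N) = (\<Sum>n\<in>J \<inter> {..N}. res_fin lam (J \<inter> {..N}) n * g n)" for N
    by (subst suminf_finite[of "J \<inter> {..N}"]) (auto simp: a_def)
  ultimately show ?thesis by simp
qed

section \<open>The infinite Cauchy matrix: row sums, orthogonality, nonvanishing residues\<close>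

lemma cauchy_kernel_bound:
  assumes lam: "lam \<notin> sq_diffs"
  shows "\<exists>B. \<forall>p n. \<bar>1 / ((real p)\<^sup>2 + lam - (real n)\<^sup>2)\<bar> \<le> B * kap p n"
proof -
  \<comment> \<open>Differences of squares are integers, so only finitely many are bounded by
    \<open>2 * \<bar>lam\<bar>\<close>; on these \<open>\<bar>x + lam\<bar>\<close> has a positive
    minimum. For all others \<open>\<bar>x + lam\<bar>\<close> is at least half of
    \<open>\<bar>x\<bar>\<close>.\<close>
  define F where "F = {x \<in> sq_diffs. \<bar>x\<bar> \<le> 2 * \<bar>lam\<bar>}"
  have int: "\<exists>i. x = real_of_int i" if x: "x \<in> sq_diffs" for x
  proof -
    obtain a b where "x = (real a)\<^sup>2 - (real b)\<^sup>2" using x unfolding sq_diffs_def by blast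
    then have "x = real_of_int ((int a)\<^sup>2 - (int b)\<^sup>2)" by simp
    then show ?thesis by blast
  qed
  have "F \<subseteq> real_of_int ` {- \<lceil>2 * \<bar>lam\<bar>\<rceil> .. \<lceil>2 * \<bar>lam\<bar>\<rceil>}"
  proof
    fix x assume x: "x \<in> F"
    then obtain i where i: "x = real_of_int i" using int by (auto simp: F_def)
    then have "\<bar>real_of_int i\<bar> \<le> 2 * \<bar>lam\<bar>" using x by (simp add: F_def)
    then have "i \<in> {- \<lceil>2 * \<bar>lam\<bar>\<rceil> .. \<lceil>2 * \<bar>lam\<bar>\<rceil>}"
      using le_of_int_ceiling[of "2 * \<bar>lam\<bar>"] by simp linarith
    then show "x \<in> real_of_int ` {- \<lceil>2 * \<bar>lam\<bar>\<rceil> .. \<lceil>2 * \<bar>lam\<bar>\<rceil>}" using i by blast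
  qed
  then have fin: "finite F" using finite_surj by blast
  have nz: "x + lam \<noteq> 0" if "x \<in> F" for x
  proof -
    obtain i j where "x = (real i)\<^sup>2 - (real j)\<^sup>2"
      using \<open>x \<in> F\<close> unfolding F_def sq_diffs_def by blast
    then show ?thesis using sq_diffs_nz(2)[OF lam, of i j] by (simp add: algebra_simps)
  qed
  define \<mu> where "\<mu> = Min (insert 1 ((\<lambda>x. \<bar>x + lam\<bar>) ` F))"
  have \<mu>: "\<mu> > 0" unfolding \<mu>_def using fin nz by (subst Min_gr_iff) auto
  have \<mu>_le: "\<mu> \<le> \<bar>x + lam\<bar>" if "x \<in> F" for x
    unfolding \<mu>_def using fin that by (intro Min_le) auto
  \<comment> \<open>The summand 2 serves the large values of \<open>x\<close>; the other one serves
    \<open>F\<close>, where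
    \<open>max 1 \<bar>x\<bar> \<le> 1 + 2 * \<bar>lam\<bar>\<close>.\<close>
  define B where "B = 2 + (1 + 2 * \<bar>lam\<bar>) / \<mu>"
  have key: "max 1 \<bar>x\<bar> \<le> B * \<bar>x + lam\<bar>" if x_sq: "x \<in> sq_diffs" for x
  proof (cases "x \<in> F")
    case True
    have "max 1 \<bar>x\<bar> \<le> 1 + 2 * \<bar>lam\<bar>" using True by (auto simp: F_def)
    also have "\<dots> = (1 + 2 * \<bar>lam\<bar>) / \<mu> * \<mu>" using \<mu> by simp
    also have "\<dots> \<le> B * \<bar>x + lam\<bar>"
      using \<mu>_le[OF True] \<mu> unfolding B_def by (intro mult_mono) auto
    finally show ?thesis .
  next
    case False
    then have x: "\<bar>x\<bar> > 2 * \<bar>lam\<bar>" using x_sq by (auto simp: F_def)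
    obtain i where i: "x = real_of_int i" using int[OF x_sq] by blast
    have "i \<noteq> 0" using x i by auto
    then have "\<bar>x\<bar> \<ge> 1" using i by linarith
    then have "max 1 \<bar>x\<bar> = \<bar>x\<bar>" by simp
    also have "\<dots> \<le> 2 * \<bar>x + lam\<bar>"
      using x abs_triangle_ineq4[of "x + lam" lam] by simp
    also have "\<dots> \<le> B * \<bar>x + lam\<bar>"
      using \<mu> unfolding B_def by (intro mult_right_mono) auto
    finally show ?thesis .
  qed
  have "\<bar>1 / ((real p)\<^sup>2 + lam - (real n)\<^sup>2)\<bar> \<le> B * kap p n" for p n
  proof -
    define x where "x = (real p)\<^sup>2 - (real n)\<^sup>2"
    have "x \<in> sq_diffs" by (auto simp: x_def sq_diffs_def)
    from key[OF this] have k: "max 1 \<bar>x\<bar> \<le> B * \<bar>x + lam\<bar>" .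
    have e: "(real p)\<^sup>2 + lam - (real n)\<^sup>2 = x + lam" by (simp add: x_def)
    have "\<bar>x + lam\<bar> > 0" using sq_diffs_nz(2)[OF lam, of p n] e by simp
    moreover have "max 1 \<bar>x\<bar> > 0" by simp
    ultimately have "1 / \<bar>x + lam\<bar> \<le> B / max 1 \<bar>x\<bar>"
      using k by (simp only: divide_le_eq le_divide_eq pos_le_divide_eq) (simp add: field_simps)
    then show ?thesis by (simp add: e kap_def x_def[symmetric])
  qed
  then show ?thesis by blast
qed

text \<open>The constant sequence 1 lies in the weighted space of order -1, which is within the
  range \<open>\<bar>s\<bar> < 3/2\<close> of \<open>kap_bounded\<close>.\<close>

lemma summable_kap: "summable (kap p)"
proof -
  have s: "\<bar>-1 :: real\<bar> < 3/2" by simp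
  have w: "summable (\<lambda>n. (wt (-1) n * 1)\<^sup>2)"
    by (simp add: wt_square summable_wt)
  have "summable (\<lambda>n. (wt (-1) n * 1)\<^sup>2) \<Longrightarrow> summable (\<lambda>n. kap p n * \<bar>1\<bar>)"
    using s by (rule kap_bounded)
  from this[OF w]
  show ?thesis by simp
qed

lemma summable_cauchy:
  assumes lam: "lam \<notin> sq_diffs"
  shows "summable (\<lambda>n. \<bar>1 / ((real p)\<^sup>2 + lam - (real n)\<^sup>2)\<bar>)"
proof -
  obtain B where B: "\<And>p n. \<bar>1 / ((real p)\<^sup>2 + lam - (real n)\<^sup>2)\<bar> \<le> B * kap p n"
    using cauchy_kernel_bound[OF lam] by blast
  show ?thesis
    by (rule summable_comparison_test[OF _ summable_mult[OF summable_kap, of B]])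
       (use B in auto)
qed

lemma cauchy_row:
  assumes lam: "lam \<notin> sq_diffs" and "p \<in> J"
  shows "(\<Sum>n. res J lam n * (1 / ((real p)\<^sup>2 + lam - (real n)\<^sup>2))) = -1"
proof (rule LIMSEQ_unique[OF res_sum_tendsto])
  show "summable (\<lambda>n. \<bar>1 / ((real p)\<^sup>2 + lam - (real n)\<^sup>2)\<bar>)"
    by (rule summable_cauchy[OF lam])
  have "(\<Sum>n\<in>J \<inter> {..N}. res_fin lam (J \<inter> {..N}) n * (1 / ((real p)\<^sup>2 + lam - (real n)\<^sup>2))) = -1"
    if "N \<ge> p" for N
    using cauchy_row_fin[OF lam, of "J \<inter> {..N}" p] that assms(2) by simp
  then show "(\<lambda>N. \<Sum>n\<in>J \<inter> {..N}. res_fin lam (J \<inter> {..N}) n * (1 / ((real p)\<^sup>2 + lam - (real n)\<^sup>2)))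
      \<longlonglongrightarrow> -1"
    by (intro tendsto_eventually) (auto simp: eventually_sequentially)
qed

lemma cauchy_orth:
  assumes lam: "lam \<notin> sq_diffs" and "p \<in> J" "q \<in> J"
  shows "res J (- lam) p * (\<Sum>n. res J lam n *
    (1 / ((real p)\<^sup>2 + lam - (real n)\<^sup>2) * (1 / ((real q)\<^sup>2 + lam - (real n)\<^sup>2))))
    = (if p = q then -1 else 0)"
proof -
  obtain B where B: "\<And>p n. \<bar>1 / ((real p)\<^sup>2 + lam - (real n)\<^sup>2)\<bar> \<le> B * kap p n"
    using cauchy_kernel_bound[OF lam] by blast
  have B0: "B \<ge> 0" using order_trans[OF abs_ge_zero B[of 0 0]] by simp
  have B1: "\<bar>1 / ((real p)\<^sup>2 + lam - (real n)\<^sup>2)\<bar> \<le> B" for p n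
    using B[of p n] mult_left_mono[OF kap_le_1 B0, of p n] by simp
  have s: "summable (\<lambda>n. \<bar>1 / ((real p)\<^sup>2 + lam - (real n)\<^sup>2) * (1 / ((real q)\<^sup>2 + lam - (real n)\<^sup>2))\<bar>)"
    unfolding abs_mult
    by (rule summable_comparison_test[OF _ summable_mult2[OF summable_cauchy[OF lam, of p], of B]])
       (intro exI allI impI, simp only: real_norm_def abs_mult[symmetric] abs_abs,
        simp only: abs_mult, intro mult_left_mono B1 abs_ge_zero)
  have "(\<lambda>N. res_fin (- lam) (J \<inter> {..N}) p * (\<Sum>n\<in>J \<inter> {..N}. res_fin lam (J \<inter> {..N}) n *
    (1 / ((real p)\<^sup>2 + lam - (real n)\<^sup>2) * (1 / ((real q)\<^sup>2 + lam - (real n)\<^sup>2)))))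
    \<longlonglongrightarrow> res J (- lam) p * (\<Sum>n. res J lam n *
    (1 / ((real p)\<^sup>2 + lam - (real n)\<^sup>2) * (1 / ((real q)\<^sup>2 + lam - (real n)\<^sup>2))))"
    by (intro tendsto_mult res_fin_tendsto res_sum_tendsto s assms)
  moreover have "res_fin (- lam) (J \<inter> {..N}) p * (\<Sum>n\<in>J \<inter> {..N}. res_fin lam (J \<inter> {..N}) n *
    (1 / ((real p)\<^sup>2 + lam - (real n)\<^sup>2) * (1 / ((real q)\<^sup>2 + lam - (real n)\<^sup>2))))
    = (if p = q then -1 else 0)" if "N \<ge> max p q" for N
    using cauchy_orth_fin[OF lam, of "J \<inter> {..N}" p q] that assms(2,3) by simp
  ultimately show ?thesis
    by (elim LIMSEQ_unique, intro tendsto_eventually eventually_sequentiallyI[of "max p q"])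
qed

text \<open>A limit of nonzero products could vanish; here the diagonal case of
  \<open>cauchy_orth\<close> for \<open>- lam\<close> exhibits \<open>res J lam n\<close> as a
  factor of -1.\<close>

lemma res_nz:
  assumes "lam \<notin> sq_diffs" "n \<in> J"
  shows "res J lam n \<noteq> 0"
  using cauchy_orth[OF sq_diffs_uminus[OF assms(1)] assms(2,2)] by auto

text \<open>For large \<open>n\<close> the residue is within \<open>\<bar>lam\<bar> / 2\<close> of
  \<open>- lam\<close>; the finitely many remaining ones are nonzero by
  \<open>res_nz\<close>.\<close>

lemma res_bounded_below:
  assumes lam: "lam \<notin> sq_diffs"
  shows "\<exists>c > 0. \<forall>n\<in>J. c \<le> \<bar>res J lam n\<bar>"
proof -
  have l: "\<bar>lam\<bar> > 0" using sq_diffs_nz(1)[OF lam] by simp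
  obtain C where C: "\<And>n. n \<in> J \<Longrightarrow> \<bar>res J lam n + lam\<bar> \<le> C * wt (-1/2) n"
    using res_near[of "1/2" J lam] by auto
  have "(\<lambda>n. C * real n powr (-1/2)) \<longlonglongrightarrow> C * 0"
    by (intro tendsto_mult_left tendsto_neg_powr filterlim_real_sequentially) auto
  then have "\<forall>\<^sub>F n in sequentially. C * real n powr (-1/2) < \<bar>lam\<bar> / 2"
    using l by (intro order_tendstoD(2)) auto
  then obtain N where N: "\<And>n. n \<ge> N \<Longrightarrow> C * real n powr (-1/2) < \<bar>lam\<bar> / 2"
    by (auto simp: eventually_sequentially)
  define c where "c = Min (insert (\<bar>lam\<bar> / 2) ((\<lambda>n. \<bar>res J lam n\<bar>) ` (J \<inter> {..N})))"
  have "c > 0"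
    unfolding c_def using l res_nz[OF lam] by (subst Min_gr_iff) auto
  moreover have "c \<le> \<bar>res J lam n\<bar>" if n: "n \<in> J" for n
  proof (cases "n \<le> N")
    case True
    then show ?thesis unfolding c_def using n by (intro Min_le) auto
  next
    case False
    then have "\<bar>lam\<bar> / 2 \<le> \<bar>res J lam n\<bar>"
      using C[OF n] N[of n] by (simp add: wt_pos_index)
    moreover have "c \<le> \<bar>lam\<bar> / 2" unfolding c_def by (intro Min_le) auto
    ultimately show ?thesis by simp
  qed
  ultimately show ?thesis by blast
qed

section \<open>Fourier coefficients of test functions and distributions\<close>

lemma fbasis_1_0 [simp]: "fbasis 1 0 = (\<lambda>x. 0)" "fbasis (Suc 0) 0 = (\<lambda>x. 0)"
  by (simp_all add: fbasis_def fun_eq_iff)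

lemma abs_fbasis_le: "\<bar>fbasis k n x\<bar> \<le> 1"
proof -
  have "sqrt pi \<ge> 1" "sqrt (2 * pi) \<ge> 1"
    using pi_gt3 by simp_all
  then have "\<bar>y / sqrt pi\<bar> \<le> 1" if "\<bar>y\<bar> \<le> 1" for y
    using that order_trans[of "\<bar>y\<bar>" 1 "sqrt pi"] by auto
  moreover have "\<bar>1 / sqrt (2 * pi)\<bar> \<le> 1" using \<open>sqrt (2 * pi) \<ge> 1\<close> by simp
  ultimately show ?thesis by (simp add: fbasis_def)
qed

lemma continuous_on_fbasis [continuous_intros]: "continuous_on S (fbasis k n)"
  unfolding fbasis_def [abs_def]
  by (cases "k = 1"; cases "n = 0") (auto intro!: continuous_intros)

lemma integral_cos_int:
  "((\<lambda>x. cos (of_int d * x)) has_integral (if d = 0 then 2 * pi else 0)) {0..2 * pi}"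
proof (cases "d = 0")
  case True
  then show ?thesis using has_integral_const_real[of "1 :: real" 0 "2 * pi"] by simp
next
  case False
  have "((\<lambda>x. cos (of_int d * x)) has_integral
      (sin (of_int d * (2 * pi)) / of_int d - sin (of_int d * 0) / of_int d)) {0..2 * pi}"
    using False by (intro fundamental_theorem_of_calculus)
      (auto intro!: derivative_eq_intros simp: has_real_derivative_iff_has_vector_derivative[symmetric])
  then show ?thesis using False sin_int_2pin[of d] by (simp add: mult.commute)
qed

lemma integral_sin_int: "((\<lambda>x. sin (of_int d * x)) has_integral 0) {0..2 * pi}"
proof (cases "d = 0")
  case False
  have "((\<lambda>x. sin (of_int d * x)) has_integral
      (- cos (of_int d * (2 * pi)) / of_int d - (- cos (of_int d * 0) / of_int d))) {0..2 * pi}"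
    using False by (intro fundamental_theorem_of_calculus)
      (auto intro!: derivative_eq_intros simp: has_real_derivative_iff_has_vector_derivative[symmetric])
  then show ?thesis using False cos_int_2pin[of d] by (simp add: mult.commute)
qed auto

lemma fbasis_orthonormal:
  assumes "k \<in> {1, 2}" "j \<in> {1, 2}"
  shows "integral {0..2 * pi} (\<lambda>x. fbasis k n x * fbasis j m x)
    = (if k = j \<and> n = m \<and> n \<in> idx k then 1 else 0)"
proof -
  define c s where "c d x = cos (of_int d * x)" and "s d x = sin (of_int d * x)" for d :: int and x :: real
  have c: "(c d has_integral (if d = 0 then 2 * pi else 0)) {0..2 * pi}" for d
    unfolding c_def by (rule integral_cos_int)
  have s: "(s d has_integral 0) {0..2 * pi}" for d
    unfolding s_def by (rule integral_sin_int)
  let ?p = "int n + int m" and ?q = "int n - int m"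
  have sq: "sqrt pi * sqrt pi = pi" by simp
  have SS: "((\<lambda>x. (sin (real n * x) / sqrt pi) * (sin (real m * x) / sqrt pi)) has_integral
      ((if ?q = 0 then 2 * pi else 0) - (if ?p = 0 then 2 * pi else 0)) / (2 * pi)) {0..2 * pi}"
  proof -
    have "(\<lambda>x. (sin (real n * x) / sqrt pi) * (sin (real m * x) / sqrt pi)) = (\<lambda>x. (c ?q x - c ?p x) / (2 * pi))"
      by (rule ext) (simp add: c_def sin_times_sin mult.assoc[symmetric] distrib_right left_diff_distrib)
    then show ?thesis by (simp only:) (intro has_integral_divide has_integral_diff c)
  qed
  have CC: "((\<lambda>x. (cos (real n * x) / sqrt pi) * (cos (real m * x) / sqrt pi)) has_integral
      ((if ?q = 0 then 2 * pi else 0) + (if ?p = 0 then 2 * pi else 0)) / (2 * pi)) {0..2 * pi}"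
  proof -
    have "(\<lambda>x. (cos (real n * x) / sqrt pi) * (cos (real m * x) / sqrt pi)) = (\<lambda>x. (c ?q x + c ?p x) / (2 * pi))"
      by (rule ext) (simp add: c_def cos_times_cos mult.assoc[symmetric] distrib_right left_diff_distrib)
    then show ?thesis by (simp only:) (intro has_integral_divide has_integral_add c)
  qed
  have SC: "((\<lambda>x. (sin (real n * x) / sqrt pi) * (cos (real m * x) / sqrt pi)) has_integral (0 + 0) / (2 * pi)) {0..2 * pi}"
  proof -
    have "(\<lambda>x. (sin (real n * x) / sqrt pi) * (cos (real m * x) / sqrt pi)) = (\<lambda>x. (s ?p x + s ?q x) / (2 * pi))"
      by (rule ext) (simp add: s_def sin_times_cos mult.assoc[symmetric] distrib_right left_diff_distrib)
    then show ?thesis by (simp only:) (intro has_integral_divide has_integral_add s)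
  qed
  have CS: "((\<lambda>x. (cos (real n * x) / sqrt pi) * (sin (real m * x) / sqrt pi)) has_integral (0 - 0) / (2 * pi)) {0..2 * pi}"
  proof -
    have "(\<lambda>x. (cos (real n * x) / sqrt pi) * (sin (real m * x) / sqrt pi)) = (\<lambda>x. (s ?p x - s ?q x) / (2 * pi))"
      by (rule ext) (simp add: s_def cos_times_sin mult.assoc[symmetric] distrib_right left_diff_distrib)
    then show ?thesis by (simp only:) (intro has_integral_divide has_integral_diff s)
  qed
  have f2: "fbasis 2 i x = (if i = 0 then 1 / sqrt 2 else 1) * (cos (real i * x) / sqrt pi)" for i x
    by (simp add: fbasis_def real_sqrt_mult)
  have f1: "fbasis 1 i x = sin (real i * x) / sqrt pi" for i x
    by (simp add: fbasis_def)
  \<comment> \<open>\<open>r\<close> rescales the mode of index 0, so that the constant mode is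
    treated as a cosine. For \<open>n = m = 0\<close> both frequencies vanish and the doubled
    integral is compensated by \<open>r 0 * r 0 = 1 / 2\<close>.\<close>
  define r where "r i = (if i = 0 then 1 / sqrt 2 else 1 :: real)" for i :: nat
  have r0: "r 0 * r 0 = 1 / 2" by (simp add: r_def)
  from assms consider "k = 1" "j = 1" | "k = 1" "j = 2" | "k = 2" "j = 1" | "k = 2" "j = 2" by blast
  then show ?thesis
  proof cases
    case 1
    then have "integral {0..2 * pi} (\<lambda>x. fbasis k n x * fbasis j m x)
      = ((if ?q = 0 then 2 * pi else 0) - (if ?p = 0 then 2 * pi else 0)) / (2 * pi)"
      using SS by (simp only: f1 integral_unique)
    then show ?thesis using 1 by (auto simp: idx_def)
  next
    case 2
    have "integral {0..2 * pi} (\<lambda>x. fbasis k n x * fbasis j m x)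
      = integral {0..2 * pi} (\<lambda>x. r m * ((sin (real n * x) / sqrt pi) * (cos (real m * x) / sqrt pi)))"
      unfolding 2 f1 f2 r_def by (simp only: mult_ac)
    also have "\<dots> = r m * ((0 + 0) / (2 * pi))"
      using SC by (simp only: integral_mult_right integral_unique)
    finally show ?thesis using 2 by simp
  next
    case 3
    have "integral {0..2 * pi} (\<lambda>x. fbasis k n x * fbasis j m x)
      = integral {0..2 * pi} (\<lambda>x. r n * ((cos (real n * x) / sqrt pi) * (sin (real m * x) / sqrt pi)))"
      unfolding 3 f1 f2 r_def by (simp only: mult_ac)
    also have "\<dots> = r n * ((0 - 0) / (2 * pi))"
      using CS by (simp only: integral_mult_right integral_unique)
    finally show ?thesis using 3 by simp
  next
    case 4
    have "integral {0..2 * pi} (\<lambda>x. fbasis k n x * fbasis j m x)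
      = integral {0..2 * pi} (\<lambda>x. (r n * r m) * ((cos (real n * x) / sqrt pi) * (cos (real m * x) / sqrt pi)))"
      unfolding 4 f2 r_def by (simp only: mult_ac)
    also have "\<dots> = (r n * r m) *
        (((if ?q = 0 then 2 * pi else 0) + (if ?p = 0 then 2 * pi else 0)) / (2 * pi))"
      using CC by (simp only: integral_mult_right integral_unique)
    finally show ?thesis using 4 r0 by (auto simp: idx_def r_def)
  qed
qed

section \<open>Rapidly decaying coefficients and the test functions they define\<close>

lemma rapidly_decaying_iff: "rapidly_decaying b \<longleftrightarrow> (\<forall>s. summable (\<lambda>n. wt s n * \<bar>b n\<bar>))"
proof
  assume b: "rapidly_decaying b"
  show "\<forall>s. summable (\<lambda>n. wt s n * \<bar>b n\<bar>)"
  proof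
    fix s :: real
    \<comment> \<open>Two powers beyond \<open>s\<close> leave the summable factor
      \<open>wt (-2) n\<close>.\<close>
    define N where "N = nat \<lceil>s + 2\<rceil>"
    obtain C where C: "\<And>n. real n ^ N * \<bar>b n\<bar> \<le> C"
      using b by (auto simp: rapidly_decaying_def)
    have "s + 2 \<le> real N" unfolding N_def by linarith
    then have "wt s n * \<bar>b n\<bar> \<le> C * wt (-2) n" if "n \<ge> 1" for n
    proof -
      have "wt s n * \<bar>b n\<bar> = wt (s + 2) n * wt (- 2) n * \<bar>b n\<bar>"
        by (simp add: wt_add[symmetric])
      also have "\<dots> \<le> wt (real N) n * wt (- 2) n * \<bar>b n\<bar>"
        using \<open>s + 2 \<le> real N\<close> by (intro mult_right_mono wt_mono) auto
      also have "\<dots> = (real n ^ N * \<bar>b n\<bar>) * wt (- 2) n"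
        using that by (simp add: wt_pos_index powr_realpow)
      also have "\<dots> \<le> C * wt (- 2) n" by (intro mult_right_mono C) auto
      finally show ?thesis .
    qed
    then show "summable (\<lambda>n. wt s n * \<bar>b n\<bar>)"
      by (intro summable_comparison_test[OF _ summable_mult[OF summable_wt[of "-2"], of C]])
         (auto intro!: exI[of _ 1])
  qed
next
  assume s: "\<forall>s. summable (\<lambda>n. wt s n * \<bar>b n\<bar>)"
  show "rapidly_decaying b"
    unfolding rapidly_decaying_def
  proof (intro allI exI)
    fix N n
    have "real n ^ N * \<bar>b n\<bar> \<le> wt (real N) n * \<bar>b n\<bar>"
    proof (cases "n = 0")
      case True
      then have "real n ^ N \<le> wt (real N) n" by (cases N) (auto simp: wt_def)
      then show ?thesis by (intro mult_right_mono) auto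
    qed (auto simp: wt_pos_index powr_realpow)
    also have "\<dots> \<le> (\<Sum>n. wt (real N) n * \<bar>b n\<bar>)"
      using s sum_le_suminf[of "\<lambda>n. wt (real N) n * \<bar>b n\<bar>" "{n}"] by simp
    finally show "real n ^ N * \<bar>b n\<bar> \<le> (\<Sum>n. wt (real N) n * \<bar>b n\<bar>)" .
  qed
qed

lemma rapidly_decaying_summable: "rapidly_decaying b \<Longrightarrow> summable (\<lambda>n. \<bar>b n\<bar>)"
  using rapidly_decaying_iff[of b] by (auto dest: spec[of _ 0])

lemma rapidly_decaying_le:
  assumes "rapidly_decaying b" and "\<And>n. \<bar>c n\<bar> \<le> B * wt t n * \<bar>b n\<bar>"
  shows "rapidly_decaying c"
  unfolding rapidly_decaying_iff
proof
  fix s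
  have "summable (\<lambda>n. B * (wt (s + t) n * \<bar>b n\<bar>))"
    using assms(1) unfolding rapidly_decaying_iff by (intro summable_mult) auto
  then show "summable (\<lambda>n. wt s n * \<bar>c n\<bar>)"
  proof (rule summable_comparison_test[rotated], intro exI allI impI)
    fix n
    have "wt s n * \<bar>c n\<bar> \<le> wt s n * (B * wt t n * \<bar>b n\<bar>)"
      by (intro mult_left_mono assms) auto
    then show "norm (wt s n * \<bar>c n\<bar>) \<le> B * (wt (s + t) n * \<bar>b n\<bar>)"
      by (simp add: wt_add mult_ac)
  qed
qed

lemma rapidly_decaying_add:
  assumes "rapidly_decaying b" "rapidly_decaying c"
  shows "rapidly_decaying (\<lambda>n. \<alpha> * b n + \<beta> * c n)"
  unfolding rapidly_decaying_iff
proof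
  fix s
  have "summable (\<lambda>n. \<bar>\<alpha>\<bar> * (wt s n * \<bar>b n\<bar>) + \<bar>\<beta>\<bar> * (wt s n * \<bar>c n\<bar>))"
    using assms unfolding rapidly_decaying_iff by (intro summable_add summable_mult) auto
  then show "summable (\<lambda>n. wt s n * \<bar>\<alpha> * b n + \<beta> * c n\<bar>)"
  proof (rule summable_comparison_test[rotated], intro exI allI impI)
    fix n
    have "wt s n * \<bar>\<alpha> * b n + \<beta> * c n\<bar> \<le> wt s n * (\<bar>\<alpha> * b n\<bar> + \<bar>\<beta> * c n\<bar>)"
      by (intro mult_left_mono abs_triangle_ineq) auto
    then show "norm (wt s n * \<bar>\<alpha> * b n + \<beta> * c n\<bar>)
        \<le> \<bar>\<alpha>\<bar> * (wt s n * \<bar>b n\<bar>) + \<bar>\<beta>\<bar> * (wt s n * \<bar>c n\<bar>)"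
      by (simp add: abs_mult algebra_simps)
  qed
qed

lemma rapidly_decaying_zero: "rapidly_decaying (\<lambda>n. 0)"
  by (simp add: rapidly_decaying_iff)

lemma rapidly_decaying_square_summable:
  assumes "rapidly_decaying b"
  shows "summable (\<lambda>n. (wt s n * b n)\<^sup>2)"
proof -
  have "summable (\<lambda>n. norm (wt s n * b n))"
    using assms by (simp add: rapidly_decaying_iff abs_mult)
  then show ?thesis
    by (rule summable_comparison_test_ev[rotated])
       (use summable_LIMSEQ_zero[OF \<open>summable (\<lambda>n. norm (wt s n * b n))\<close>] in
        \<open>auto simp: power2_eq_square abs_mult elim!: eventually_mono[OF order_tendstoD(2)[of _ 0 _ 1]] intro: mult_left_le\<close>)
qed

text \<open>\<open>b1 0\<close> multiplies the zero function, so it cannot be recovered from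
  \<open>tf b1 b2\<close>; \<open>cf_tf\<close> returns 0 at that index.\<close>

definition tf :: "(nat \<Rightarrow> real) \<Rightarrow> (nat \<Rightarrow> real) \<Rightarrow> real \<Rightarrow> real" where
  "tf b1 b2 x = (\<Sum>n. b1 n * fbasis 1 n x) + (\<Sum>n. b2 n * fbasis 2 n x)"

lemma tf_in_test_fun: "rapidly_decaying b1 \<Longrightarrow> rapidly_decaying b2 \<Longrightarrow> tf b1 b2 \<in> test_fun"
  unfolding test_fun_def tf_def by blast

lemma test_funE:
  assumes "\<phi> \<in> test_fun"
  obtains b1 b2 where "rapidly_decaying b1" "rapidly_decaying b2" "\<phi> = tf b1 b2"
  using assms unfolding test_fun_def tf_def by blast

lemma summable_fbasis:
  assumes "rapidly_decaying b"
  shows "summable (\<lambda>n. b n * fbasis k n x)"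
proof (rule summable_comparison_test[OF _ rapidly_decaying_summable[OF assms]], intro exI allI impI)
  show "norm (b n * fbasis k n x) \<le> \<bar>b n\<bar>" for n
    using mult_left_mono[OF abs_fbasis_le[of k n x], of "\<bar>b n\<bar>"] by (simp add: abs_mult)
qed

lemma tf_linear:
  assumes "rapidly_decaying b1" "rapidly_decaying b2" "rapidly_decaying c1" "rapidly_decaying c2"
  shows "tf (\<lambda>n. \<alpha> * b1 n + \<beta> * c1 n) (\<lambda>n. \<alpha> * b2 n + \<beta> * c2 n) x
    = \<alpha> * tf b1 b2 x + \<beta> * tf c1 c2 x"
proof -
  have "(\<Sum>n. (\<alpha> * b n + \<beta> * c n) * fbasis k n x)
      = \<alpha> * (\<Sum>n. b n * fbasis k n x) + \<beta> * (\<Sum>n. c n * fbasis k n x)"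
    if "rapidly_decaying b" "rapidly_decaying c" for k b c
  proof -
    have "(\<lambda>n. \<alpha> * (b n * fbasis k n x) + \<beta> * (c n * fbasis k n x)) sums
        (\<alpha> * (\<Sum>n. b n * fbasis k n x) + \<beta> * (\<Sum>n. c n * fbasis k n x))"
      by (intro sums_add sums_mult summable_sums summable_fbasis that)
    then show ?thesis by (simp add: sums_iff algebra_simps)
  qed
  from this[OF assms(1,3)] this[OF assms(2,4)] show ?thesis
    by (simp add: tf_def algebra_simps)
qed

lemma test_fun_linear:
  assumes "\<phi> \<in> test_fun" "\<psi> \<in> test_fun"
  shows "(\<lambda>x. \<alpha> * \<phi> x + \<beta> * \<psi> x) \<in> test_fun"
proof -
  obtain b1 b2 where b: "rapidly_decaying b1" "rapidly_decaying b2" "\<phi> = tf b1 b2"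
    using assms(1) by (rule test_funE)
  obtain c1 c2 where c: "rapidly_decaying c1" "rapidly_decaying c2" "\<psi> = tf c1 c2"
    using assms(2) by (rule test_funE)
  have "(\<lambda>x. \<alpha> * \<phi> x + \<beta> * \<psi> x) = tf (\<lambda>n. \<alpha> * b1 n + \<beta> * c1 n) (\<lambda>n. \<alpha> * b2 n + \<beta> * c2 n)"
    using tf_linear[OF b(1,2) c(1,2)] b(3) c(3) by auto
  then show ?thesis
    using tf_in_test_fun rapidly_decaying_add b c by simp
qed

lemma rapidly_decaying_unit: "rapidly_decaying (\<lambda>m. if m = n then 1 else 0)"
proof -
  have "(\<lambda>m. wt s m * \<bar>if m = n then 1 else 0\<bar>) = (\<lambda>m. if m = n then wt s m else 0)" for s
    by auto
  then show ?thesis by (simp add: rapidly_decaying_iff)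
qed

lemma fbasis_tf:
  "fbasis 1 n = tf (\<lambda>m. if m = n then 1 else 0) (\<lambda>m. 0)"
  "fbasis 2 n = tf (\<lambda>m. 0) (\<lambda>m. if m = n then 1 else 0)"
proof -
  have "(\<Sum>m. (if m = n then 1 else 0) * fbasis k m x) = fbasis k n x" for k x
    by (subst suminf_finite[of "{n}"]) auto
  then show "fbasis 1 n = tf (\<lambda>m. if m = n then 1 else 0) (\<lambda>m. 0)"
    "fbasis 2 n = tf (\<lambda>m. 0) (\<lambda>m. if m = n then 1 else 0)"
    by (simp_all add: tf_def fun_eq_iff)
qed

lemma fbasis_in_test_fun:
  assumes "k \<in> {1, 2}"
  shows "fbasis k n \<in> test_fun"
  using assms fbasis_tf rapidly_decaying_unit rapidly_decaying_zero
  by (auto intro!: tf_in_test_fun simp del: One_nat_def)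

text \<open>The basis functions are bounded by 1, so the Weierstrass test with majorant
  \<open>\<bar>b n\<bar>\<close> gives uniform convergence and hence termwise integration.\<close>

lemma series_integral:
  assumes b: "rapidly_decaying b" and g: "continuous_on {0..2 * pi} g"
  shows "(\<lambda>n. b n * integral {0..2 * pi} (\<lambda>x. fbasis k n x * g x)) sums
      integral {0..2 * pi} (\<lambda>x. (\<Sum>n. b n * fbasis k n x) * g x)"
    and "continuous_on {0..2 * pi} (\<lambda>x. \<Sum>n. b n * fbasis k n x)"
proof -
  obtain G where G: "\<And>x. x \<in> {0..2 * pi} \<Longrightarrow> \<bar>g x\<bar> \<le> G"
    using compact_imp_bounded[OF compact_continuous_image[OF g]]
    by (auto simp: bounded_iff simp del: atLeastAtMost_iff)
  have sG: "summable (\<lambda>n. \<bar>b n\<bar> * \<bar>G\<bar>)"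
    using rapidly_decaying_summable[OF b] by (intro summable_mult2)
  have bd: "norm (b n * fbasis k n x) \<le> \<bar>b n\<bar>" for n x
    using mult_left_mono[OF abs_fbasis_le[of k n x], of "\<bar>b n\<bar>"] by (simp add: abs_mult)
  have u: "uniform_limit {0..2 * pi} (\<lambda>N x. \<Sum>n<N. b n * fbasis k n x) (\<lambda>x. \<Sum>n. b n * fbasis k n x) sequentially"
    by (rule Weierstrass_m_test[OF _ rapidly_decaying_summable[OF b]]) (use bd in auto)
  show cont: "continuous_on {0..2 * pi} (\<lambda>x. \<Sum>n. b n * fbasis k n x)"
    by (rule uniform_limit_theorem[OF _ u]) (auto intro!: always_eventually continuous_intros)
  have "uniform_limit {0..2 * pi} (\<lambda>N x. \<Sum>n<N. b n * fbasis k n x * g x)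
      (\<lambda>x. \<Sum>n. b n * fbasis k n x * g x) sequentially"
  proof (rule Weierstrass_m_test[OF _ sG])
    show "norm (b n * fbasis k n x * g x) \<le> \<bar>b n\<bar> * \<bar>G\<bar>" if "x \<in> {0..2 * pi}" for n x
      unfolding norm_mult[of "b n * fbasis k n x"] using bd G[OF that] by (intro mult_mono) auto
  qed
  moreover have "(\<Sum>n. b n * fbasis k n x * g x) = (\<Sum>n. b n * fbasis k n x) * g x" for x
    using summable_fbasis[OF b] by (simp add: suminf_mult2)
  ultimately have u2: "uniform_limit {0..2 * pi} (\<lambda>N x. \<Sum>n<N. b n * fbasis k n x * g x)
      (\<lambda>x. (\<Sum>n. b n * fbasis k n x) * g x) sequentially" by simp
  have cs: "continuous_on {0..2 * pi} (\<lambda>x. \<Sum>n<N. b n * fbasis k n x * g x)" for N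
    using g by (auto intro!: continuous_intros)
  obtain I J where IJ: "\<And>N. ((\<lambda>x. \<Sum>n<N. b n * fbasis k n x * g x) has_integral I N) {0..2 * pi}"
    "((\<lambda>x. (\<Sum>n. b n * fbasis k n x) * g x) has_integral J) {0..2 * pi}" "I \<longlonglongrightarrow> J"
    by (rule uniform_limit_integral[OF u2 cs sequentially_bot], rule that)
  have "I N = (\<Sum>n<N. b n * integral {0..2 * pi} (\<lambda>x. fbasis k n x * g x))" for N
  proof -
    have "((\<lambda>x. \<Sum>n<N. b n * (fbasis k n x * g x)) has_integral
        (\<Sum>n<N. b n * integral {0..2 * pi} (\<lambda>x. fbasis k n x * g x))) {0..2 * pi}"
      using g by (intro has_integral_sum has_integral_mult_right integrable_integral
          integrable_continuous_real continuous_intros) auto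
    then show ?thesis using IJ(1)[of N] by (simp add: mult.assoc has_integral_unique)
  qed
  then have "I = (\<lambda>N. \<Sum>n<N. b n * integral {0..2 * pi} (\<lambda>x. fbasis k n x * g x))"
    by (rule ext)
  then show "(\<lambda>n. b n * integral {0..2 * pi} (\<lambda>x. fbasis k n x * g x)) sums
      integral {0..2 * pi} (\<lambda>x. (\<Sum>n. b n * fbasis k n x) * g x)"
    using IJ(2,3) by (simp add: sums_def integral_unique)
qed

lemma test_fun_continuous: "\<phi> \<in> test_fun \<Longrightarrow> continuous_on {0..2 * pi} \<phi>"
  by (erule test_funE) (auto simp: tf_def[abs_def] intro!: continuous_on_add series_integral(2)[where g = "\<lambda>_. 0"])

text \<open>Note that \<open>cf 1 0 \<phi> = 0\<close>, since \<open>fbasis 1 0\<close> is the zero function.\<close>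

abbreviation cf :: "nat \<Rightarrow> nat \<Rightarrow> functional" where
  "cf k n \<equiv> embed (fbasis k n)"

lemma tf_pairing:
  assumes b: "rapidly_decaying b1" "rapidly_decaying b2" and \<psi>: "\<psi> \<in> test_fun"
  shows "(\<lambda>n. b1 n * cf 1 n \<psi>) sums (\<Sum>n. b1 n * cf 1 n \<psi>)"
    and "(\<lambda>n. b2 n * cf 2 n \<psi>) sums (\<Sum>n. b2 n * cf 2 n \<psi>)"
    and "integral {0..2 * pi} (\<lambda>x. tf b1 b2 x * \<psi> x)
      = (\<Sum>n. b1 n * cf 1 n \<psi>) + (\<Sum>n. b2 n * cf 2 n \<psi>)"
proof -
  note c = test_fun_continuous[OF \<psi>]
  note s1 = series_integral[OF b(1) c, of 1] and s2 = series_integral[OF b(2) c, of 2]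
  have e: "cf k n \<psi> = integral {0..2 * pi} (\<lambda>x. fbasis k n x * \<psi> x)" for k n
    using \<psi> by (simp add: embed_def)
  show "(\<lambda>n. b1 n * cf 1 n \<psi>) sums (\<Sum>n. b1 n * cf 1 n \<psi>)"
    unfolding e using s1(1) by (intro summable_sums sums_summable)
  show "(\<lambda>n. b2 n * cf 2 n \<psi>) sums (\<Sum>n. b2 n * cf 2 n \<psi>)"
    unfolding e using s2(1) by (intro summable_sums sums_summable)
  have "integral {0..2 * pi} (\<lambda>x. tf b1 b2 x * \<psi> x)
      = integral {0..2 * pi} (\<lambda>x. (\<Sum>n. b1 n * fbasis 1 n x) * \<psi> x + (\<Sum>n. b2 n * fbasis 2 n x) * \<psi> x)"
    by (simp add: tf_def distrib_right)
  also have "\<dots> = integral {0..2 * pi} (\<lambda>x. (\<Sum>n. b1 n * fbasis 1 n x) * \<psi> x)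
      + integral {0..2 * pi} (\<lambda>x. (\<Sum>n. b2 n * fbasis 2 n x) * \<psi> x)"
    by (intro integral_add integrable_continuous_real continuous_on_mult s1(2) s2(2) c)
  also have "\<dots> = (\<Sum>n. b1 n * cf 1 n \<psi>) + (\<Sum>n. b2 n * cf 2 n \<psi>)"
    using s1(1) s2(1) by (simp only: e sums_iff)
  finally show "integral {0..2 * pi} (\<lambda>x. tf b1 b2 x * \<psi> x)
      = (\<Sum>n. b1 n * cf 1 n \<psi>) + (\<Sum>n. b2 n * cf 2 n \<psi>)" .
qed

section \<open>Fourier coefficients of test functions\<close>

lemma cf_fbasis:
  assumes "k \<in> {1, 2}" "j \<in> {1, 2}"
  shows "cf k n (fbasis j m) = (if k = j \<and> n = m \<and> n \<in> idx k then 1 else 0)"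
  unfolding embed_def using fbasis_orthonormal[OF assms] fbasis_in_test_fun[OF assms(2)] by simp

lemma embed_commute: "\<phi> \<in> test_fun \<Longrightarrow> \<psi> \<in> test_fun \<Longrightarrow> embed \<phi> \<psi> = embed \<psi> \<phi>"
  by (simp add: embed_def mult.commute)

lemma cf_tf:
  assumes b: "rapidly_decaying b1" "rapidly_decaying b2"
  shows "cf 1 n (tf b1 b2) = (if n = 0 then 0 else b1 n)" and "cf 2 n (tf b1 b2) = b2 n"
proof -
  have *: "cf k n (tf b1 b2) = (\<Sum>m. b1 m * cf 1 m (fbasis k n)) + (\<Sum>m. b2 m * cf 2 m (fbasis k n))"
    if "k \<in> {1, 2}" for k n
    using embed_commute[OF fbasis_in_test_fun[OF that] tf_in_test_fun[OF b]]
      tf_pairing(3)[OF b fbasis_in_test_fun[OF that]] fbasis_in_test_fun[OF that]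
    by (simp add: embed_def)
  have "b1 m * cf 1 m (fbasis 1 n) = (if m = n then (if n = 0 then 0 else b1 n) else 0)"
    "b2 m * cf 2 m (fbasis 1 n) = 0" for m
    using cf_fbasis[of 1 1 m n] cf_fbasis[of 2 1 m n] by (auto simp: idx_def)
  then have "cf 1 n (tf b1 b2) = (\<Sum>m. if m = n then (if n = 0 then 0 else b1 n) else 0) + (\<Sum>m. 0)"
    using *[of 1 n] by (simp only: insertI1)
  then show "cf 1 n (tf b1 b2) = (if n = 0 then 0 else b1 n)"
    using sums_single[of n "\<lambda>_. if n = 0 then 0 else b1 n"] by (simp add: sums_iff)
  have "b2 m * cf 2 m (fbasis 2 n) = (if m = n then b2 n else 0)"
    "b1 m * cf 1 m (fbasis 2 n) = 0" for m
    using cf_fbasis[of 2 2 m n] cf_fbasis[of 1 2 m n] by (auto simp: idx_def)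
  then have "cf 2 n (tf b1 b2) = (\<Sum>m. 0) + (\<Sum>m. if m = n then b2 n else 0)"
    using *[of 2 n] by (simp only: insert_iff simp_thms)
  then show "cf 2 n (tf b1 b2) = b2 n"
    using sums_single[of n "\<lambda>_. b2 n"] by (simp add: sums_iff)
qed

lemma embed_zero [simp]: "embed (\<lambda>x. 0) \<psi> = 0"
  by (simp add: embed_def)

lemma test_fun_expansion:
  assumes "\<phi> \<in> test_fun"
  shows "rapidly_decaying (\<lambda>n. cf 1 n \<phi>)" "rapidly_decaying (\<lambda>n. cf 2 n \<phi>)"
    and "\<phi> = tf (\<lambda>n. cf 1 n \<phi>) (\<lambda>n. cf 2 n \<phi>)"
proof -
  obtain b1 b2 where b: "rapidly_decaying b1" "rapidly_decaying b2" "\<phi> = tf b1 b2"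
    using assms by (rule test_funE)
  show "rapidly_decaying (\<lambda>n. cf 1 n \<phi>)"
    by (rule rapidly_decaying_le[OF b(1), of _ 1 0]) (simp add: b(3) cf_tf[OF b(1,2), simplified])
  show "rapidly_decaying (\<lambda>n. cf 2 n \<phi>)"
    using b by (simp add: cf_tf)
  have "(\<Sum>n. cf 1 n \<phi> * fbasis 1 n x) = (\<Sum>n. b1 n * fbasis 1 n x)" for x
    by (intro suminf_cong) (use cf_tf(1)[OF b(1,2)] b(3) in auto)
  moreover have "cf 2 n \<phi> = b2 n" for n using b by (simp add: cf_tf)
  ultimately show "\<phi> = tf (\<lambda>n. cf 1 n \<phi>) (\<lambda>n. cf 2 n \<phi>)"
    by (simp only: tf_def fun_eq_iff b(3)) simp
qed

lemma rapidly_decaying_cf: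
  assumes "k \<in> {1, 2}" "\<phi> \<in> test_fun"
  shows "rapidly_decaying (\<lambda>n. cf k n \<phi>)"
  using assms test_fun_expansion by auto

lemma embed_linear_right:
  assumes "\<phi> \<in> test_fun" "\<psi> \<in> test_fun" and g: "continuous_on {0..2 * pi} g"
  shows "embed g (\<lambda>x. \<alpha> * \<phi> x + \<beta> * \<psi> x) = \<alpha> * embed g \<phi> + \<beta> * embed g \<psi>"
proof -
  have "integral {0..2 * pi} (\<lambda>x. g x * (\<alpha> * \<phi> x + \<beta> * \<psi> x))
      = integral {0..2 * pi} (\<lambda>x. \<alpha> * (g x * \<phi> x) + \<beta> * (g x * \<psi> x))"
    by (simp add: algebra_simps)
  also have "\<dots> = integral {0..2 * pi} (\<lambda>x. \<alpha> * (g x * \<phi> x)) + integral {0..2 * pi} (\<lambda>x. \<beta> * (g x * \<psi> x))"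
    using g test_fun_continuous[OF assms(1)] test_fun_continuous[OF assms(2)]
    by (intro integral_add integrable_continuous_real continuous_intros)
  finally show ?thesis using assms test_fun_linear[OF assms(1,2)] by (simp add: embed_def)
qed

section \<open>Termwise differentiation of test functions\<close>

lemma tf_has_derivative:
  assumes b: "rapidly_decaying b1" "rapidly_decaying b2"
  shows "(tf b1 b2 has_real_derivative tf (\<lambda>n. - real n * b2 n) (\<lambda>n. real n * b1 n) x) (at x)"
proof -
  have f1: "fbasis 1 n = (\<lambda>x. sin (real n * x) / sqrt pi)" for n
    by (simp add: fbasis_def fun_eq_iff)
  have f2: "fbasis 2 n = (if n = 0 then (\<lambda>x. 1 / sqrt (2 * pi)) else (\<lambda>x. cos (real n * x) / sqrt pi))" for n
    by (simp add: fbasis_def fun_eq_iff)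
  have "((\<lambda>x. sin (real n * x) / sqrt pi) has_real_derivative cos (real n * x) * real n / sqrt pi) (at x)"
    "((\<lambda>x. cos (real n * x) / sqrt pi) has_real_derivative - sin (real n * x) * real n / sqrt pi) (at x)" for n x
    by (rule DERIV_cdivide; auto intro!: derivative_eq_intros)+
  \<comment> \<open>At \<open>n = 0\<close> both sides vanish, so the different normalisation of the
    constant mode does no harm.\<close>
  then have term_deriv: "(fbasis 1 n has_real_derivative real n * fbasis 2 n x) (at x)"
      "(fbasis 2 n has_real_derivative - real n * fbasis 1 n x) (at x)" for n x
    unfolding f1 f2 by (cases "n = 0"; simp add: mult.commute)+
  have series: "((\<lambda>x. \<Sum>n. b n * fbasis k n x) has_real_derivative (\<Sum>n. b n * (e n * fbasis j n x))) (at x)"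
    if b: "rapidly_decaying b" and e: "\<And>n. \<bar>e n\<bar> \<le> real n"
      and d: "\<And>n x. (fbasis k n has_real_derivative e n * fbasis j n x) (at x)" for b e k j
  proof (rule has_field_derivative_series'(2)[of UNIV _ _ 0])
    show "((\<lambda>x. b n * fbasis k n x) has_real_derivative b n * (e n * fbasis j n x)) (at x)" for n x
      using d by (intro DERIV_cmult)
    have "rapidly_decaying (\<lambda>n. real n * b n)"
      by (rule rapidly_decaying_le[OF b, of _ 1 1]) (auto simp: abs_mult wt_def intro!: mult_right_mono)
    then have s: "summable (\<lambda>n. \<bar>real n * b n\<bar>)" by (rule rapidly_decaying_summable)
    show "uniformly_convergent_on UNIV (\<lambda>N x. \<Sum>n<N. b n * (e n * fbasis j n x))"
    proof (rule Weierstrass_m_test'[OF _ s])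
      fix n x
      have "\<bar>b n\<bar> * (\<bar>e n\<bar> * \<bar>fbasis j n x\<bar>) \<le> \<bar>b n\<bar> * (real n * 1)"
        using e abs_fbasis_le by (intro mult_left_mono mult_mono) auto
      then show "norm (b n * (e n * fbasis j n x)) \<le> \<bar>real n * b n\<bar>"
        by (simp add: abs_mult mult.commute)
    qed
    show "summable (\<lambda>n. b n * fbasis k n 0)" by (rule summable_fbasis[OF b])
  qed auto
  have "(tf b1 b2 has_real_derivative
      (\<Sum>n. b1 n * (real n * fbasis 2 n x)) + (\<Sum>n. b2 n * (- real n * fbasis 1 n x))) (at x)"
    unfolding tf_def [abs_def] using term_deriv
    by (intro DERIV_add series b) auto
  then show ?thesis by (simp add: tf_def mult_ac add.commute)
qed

lemma rapidly_decaying_index: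
  assumes "rapidly_decaying b"
  shows "rapidly_decaying (\<lambda>n. real n * b n)" "rapidly_decaying (\<lambda>n. - real n * b n)"
  by (rule rapidly_decaying_le[OF assms, of _ 1 1],
      auto simp: abs_mult wt_def intro!: mult_right_mono)+

lemma deriv2_test_fun:
  assumes "\<phi> \<in> test_fun" and k: "k \<in> {1, 2}"
  shows "deriv (deriv \<phi>) \<in> test_fun" and "cf k n (deriv (deriv \<phi>)) = - (real n)\<^sup>2 * cf k n \<phi>"
proof -
  obtain b1 b2 where b: "rapidly_decaying b1" "rapidly_decaying b2" "\<phi> = tf b1 b2"
    using assms(1) by (rule test_funE)
  note b' = rapidly_decaying_index[OF b(1)] rapidly_decaying_index[OF b(2)]
  note b'' = rapidly_decaying_index[OF b'(1)] rapidly_decaying_index[OF b'(4)]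
  have 1: "deriv \<phi> = tf (\<lambda>n. - real n * b2 n) (\<lambda>n. real n * b1 n)"
    unfolding b(3) by (rule ext) (intro DERIV_imp_deriv tf_has_derivative b)
  have 2: "deriv (deriv \<phi>)
      = tf (\<lambda>n. - real n * (real n * b1 n)) (\<lambda>n. real n * (- real n * b2 n))"
    unfolding 1 by (rule ext) (intro DERIV_imp_deriv tf_has_derivative b')
  show "deriv (deriv \<phi>) \<in> test_fun"
    unfolding 2 by (intro tf_in_test_fun b'')
  show "cf k n (deriv (deriv \<phi>)) = - (real n)\<^sup>2 * cf k n \<phi>"
    using k
  proof safe
    show "cf 1 n (deriv (deriv \<phi>)) = - (real n)\<^sup>2 * cf 1 n \<phi>"
      using cf_tf(1)[OF b''(2,3), of n] cf_tf(1)[OF b(1,2), of n]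
      unfolding 2[symmetric] b(3)[symmetric] by (simp add: power2_eq_square)
    show "cf 2 n (deriv (deriv \<phi>)) = - (real n)\<^sup>2 * cf 2 n \<phi>"
      using cf_tf(2)[OF b''(2,3), of n] cf_tf(2)[OF b(1,2), of n]
      unfolding 2[symmetric] b(3)[symmetric] by (simp add: power2_eq_square)
  qed
qed

section \<open>Distributions and Sobolev norms in terms of coefficients\<close>

lemma distr_linear:
  assumes "u \<in> distr" "\<phi> \<in> test_fun" "\<psi> \<in> test_fun"
  shows "u (\<lambda>x. \<alpha> * \<phi> x + \<beta> * \<psi> x) = \<alpha> * u \<phi> + \<beta> * u \<psi>"
  using assms by (simp add: distr_def linear_functional_on_def)

lemma distr_fbasis_1_0 [simp]:
  assumes "u \<in> distr"
  shows "u (\<lambda>x. 0) = 0"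
  using distr_linear[OF assms fbasis_in_test_fun[of 1 0] fbasis_in_test_fun[of 1 0], of 0 0] by simp

lemma powr_eq_wt_square: "n \<ge> 1 \<Longrightarrow> real n powr (2 * s) = (wt s n)\<^sup>2"
  unfolding wt_square by (simp add: wt_pos_index)

text \<open>The separate zeroth term of \<open>Hnorm\<close> is absorbed by the weight 1 at index 0;
  the assumption \<open>u (\<lambda>x. 0) = 0\<close> removes the contribution of the nonexistent
  mode (1, 0).\<close>

lemma Hnorm_eq:
  assumes "u (\<lambda>x. 0) = 0" and s1: "summable (\<lambda>n. (wt s n * u (fbasis 1 n))\<^sup>2)"
    and s2: "summable (\<lambda>n. (wt s n * u (fbasis 2 n))\<^sup>2)"
  shows "Hnorm s u = sqrt ((\<Sum>n. (wt s n * u (fbasis 1 n))\<^sup>2) + (\<Sum>n. (wt s n * u (fbasis 2 n))\<^sup>2))"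
    and "summable (\<lambda>n. real n powr (2 * s) * ((u (fbasis 1 n))\<^sup>2 + (u (fbasis 2 n))\<^sup>2))"
proof -
  define h where "h n = (wt s n * u (fbasis 1 n))\<^sup>2 + (wt s n * u (fbasis 2 n))\<^sup>2" for n
  define g where "g n = real n powr (2 * s) * ((u (fbasis 1 n))\<^sup>2 + (u (fbasis 2 n))\<^sup>2)" for n
  have gh: "g (Suc n) = h (Suc n)" for n
    using powr_eq_wt_square[of "Suc n" s] by (simp add: g_def h_def power_mult_distrib distrib_left)
  have h: "summable h" unfolding h_def using s1 s2 by (rule summable_add)
  have "summable (\<lambda>n. g (Suc n))" unfolding gh using h by (simp add: summable_Suc_iff)
  then have g: "summable g" by (simp add: summable_Suc_iff)
  then show "summable (\<lambda>n. real n powr (2 * s) * ((u (fbasis 1 n))\<^sup>2 + (u (fbasis 2 n))\<^sup>2))"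
    unfolding g_def .
  have "suminf g = suminf h - h 0"
    using suminf_split_head[OF g] suminf_split_head[OF h] by (simp add: gh) (simp add: g_def)
  moreover have "h 0 = (u (fbasis 2 0))\<^sup>2"
    using assms(1) by (simp add: h_def wt_def)
  ultimately have "(u (fbasis 2 0))\<^sup>2 + suminf g = suminf h" by simp
  moreover have "suminf h = (\<Sum>n. (wt s n * u (fbasis 1 n))\<^sup>2) + (\<Sum>n. (wt s n * u (fbasis 2 n))\<^sup>2)"
    unfolding h_def using suminf_add[OF s1 s2] by simp
  ultimately show "Hnorm s u
      = sqrt ((\<Sum>n. (wt s n * u (fbasis 1 n))\<^sup>2) + (\<Sum>n. (wt s n * u (fbasis 2 n))\<^sup>2))"
    by (simp add: Hnorm_def g_def [abs_def])
qed

lemma Hs_iff: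
  "u \<in> Hs s \<longleftrightarrow> u \<in> distr \<and> summable (\<lambda>n. (wt s n * u (fbasis 1 n))\<^sup>2)
    \<and> summable (\<lambda>n. (wt s n * u (fbasis 2 n))\<^sup>2)"
proof
  assume u: "u \<in> Hs s"
  define g where "g n = real n powr (2 * s) * ((u (fbasis 1 n))\<^sup>2 + (u (fbasis 2 n))\<^sup>2)" for n
  have g: "summable g" using u unfolding Hs_def g_def by blast
  have "(wt s n * u (fbasis 1 n))\<^sup>2 \<le> g n" "(wt s n * u (fbasis 2 n))\<^sup>2 \<le> g n" if "n \<ge> 1" for n
    using powr_eq_wt_square[OF that, of s] by (simp_all add: g_def power_mult_distrib distrib_left)
  then have "summable (\<lambda>n. (wt s n * u (fbasis 1 n))\<^sup>2)" "summable (\<lambda>n. (wt s n * u (fbasis 2 n))\<^sup>2)"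
    by (auto intro!: summable_comparison_test[OF _ g] exI[of _ 1])
  then show "u \<in> distr \<and> summable (\<lambda>n. (wt s n * u (fbasis 1 n))\<^sup>2)
      \<and> summable (\<lambda>n. (wt s n * u (fbasis 2 n))\<^sup>2)"
    using u by (auto simp: Hs_def)
next
  assume "u \<in> distr \<and> summable (\<lambda>n. (wt s n * u (fbasis 1 n))\<^sup>2)
    \<and> summable (\<lambda>n. (wt s n * u (fbasis 2 n))\<^sup>2)"
  then show "u \<in> Hs s" using Hnorm_eq(2)[of u s] by (simp add: Hs_def)
qed

lemma Hs_coeff:
  assumes "u \<in> Hs s" "k \<in> {1, 2}"
  shows "summable (\<lambda>n. (wt s n * u (fbasis k n))\<^sup>2)"
    and "(\<Sum>n. (wt s n * u (fbasis k n))\<^sup>2) \<le> (Hnorm s u)\<^sup>2"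
    and "Hnorm s u \<ge> 0"
proof -
  have s: "summable (\<lambda>n. (wt s n * u (fbasis 1 n))\<^sup>2)" "summable (\<lambda>n. (wt s n * u (fbasis 2 n))\<^sup>2)"
    and u: "u \<in> distr"
    using assms(1) by (simp_all add: Hs_iff)
  show "summable (\<lambda>n. (wt s n * u (fbasis k n))\<^sup>2)" using s assms(2) by auto
  have n: "(\<Sum>n. (wt s n * u (fbasis 1 n))\<^sup>2) \<ge> 0" "(\<Sum>n. (wt s n * u (fbasis 2 n))\<^sup>2) \<ge> 0"
    using s by (simp_all add: suminf_nonneg)
  note h = Hnorm_eq(1)[of u s, OF distr_fbasis_1_0[OF u] s]
  show "(\<Sum>n. (wt s n * u (fbasis k n))\<^sup>2) \<le> (Hnorm s u)\<^sup>2"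
    using n h assms(2) by auto
  show "Hnorm s u \<ge> 0" using n h by simp
qed

lemma Hs_mono: "s \<le> t \<Longrightarrow> Hs t \<subseteq> Hs s"
  by (auto simp: Hs_iff intro: summable_weighted_mono(1))

text \<open>Polynomially bounded sequences: by \<open>fseries_distr\<close> and
  \<open>distr_slow\<close> these are the coefficient sequences of distributions.\<close>

definition slow :: "(nat \<Rightarrow> real) \<Rightarrow> bool" where
  "slow c \<longleftrightarrow> (\<exists>C s. \<forall>n. \<bar>c n\<bar> \<le> C * wt s n)"

lemma slow_linear:
  assumes "slow c" "slow d"
  shows "slow (\<lambda>n. \<alpha> * c n + \<beta> * d n)"
proof -
  obtain C s D t where C: "\<And>n. \<bar>c n\<bar> \<le> C * wt s n" and D: "\<And>n. \<bar>d n\<bar> \<le> D * wt t n"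
    using assms unfolding slow_def by blast
  have "\<bar>\<alpha> * c n + \<beta> * d n\<bar> \<le> (\<bar>\<alpha>\<bar> * \<bar>C\<bar> + \<bar>\<beta>\<bar> * \<bar>D\<bar>) * wt (max s t) n" for n
  proof -
    have "\<bar>c n\<bar> \<le> \<bar>C\<bar> * wt (max s t) n" "\<bar>d n\<bar> \<le> \<bar>D\<bar> * wt (max s t) n"
      using C[of n] D[of n] by (auto elim!: order_trans intro!: mult_mono wt_mono)
    then have "\<bar>\<alpha>\<bar> * \<bar>c n\<bar> + \<bar>\<beta>\<bar> * \<bar>d n\<bar>
        \<le> \<bar>\<alpha>\<bar> * (\<bar>C\<bar> * wt (max s t) n) + \<bar>\<beta>\<bar> * (\<bar>D\<bar> * wt (max s t) n)"
      by (intro add_mono mult_left_mono) auto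
    moreover have "\<bar>\<alpha> * c n + \<beta> * d n\<bar> \<le> \<bar>\<alpha>\<bar> * \<bar>c n\<bar> + \<bar>\<beta>\<bar> * \<bar>d n\<bar>"
      using abs_triangle_ineq[of "\<alpha> * c n" "\<beta> * d n"] by (simp add: abs_mult)
    ultimately show ?thesis by (simp add: algebra_simps)
  qed
  then show ?thesis unfolding slow_def by blast
qed

lemma slow_square_summable:
  assumes "summable (\<lambda>n. (wt s n * c n)\<^sup>2)"
  shows "slow c"
proof -
  define X where "X = (\<Sum>n. (wt s n * c n)\<^sup>2)"
  have "\<bar>c n\<bar> \<le> sqrt X * wt (- s) n" for n
  proof -
    have "(wt s n * c n)\<^sup>2 \<le> X"
      unfolding X_def using sum_le_suminf[OF assms, of "{n}"] by simp
    then have "\<bar>wt s n * c n\<bar> \<le> sqrt X" using real_le_rsqrt[of "\<bar>wt s n * c n\<bar>" X] by simp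
    then have "\<bar>wt s n * c n\<bar> * wt (- s) n \<le> sqrt X * wt (- s) n"
      by (rule mult_right_mono) simp
    moreover have "\<bar>wt s n * c n\<bar> * wt (- s) n = (wt s n * wt (- s) n) * \<bar>c n\<bar>"
      by (simp add: abs_mult mult_ac del: wt_mult_minus)
    ultimately show ?thesis by simp
  qed
  then show ?thesis unfolding slow_def by blast
qed

lemma slow_summable:
  assumes "slow c" "k \<in> {1, 2}"
  shows "summable (\<lambda>n. \<bar>c n * cf k n \<psi>\<bar>)"
proof (cases "\<psi> \<in> test_fun")
  case True
  obtain C s where C: "\<And>n. \<bar>c n\<bar> \<le> C * wt s n"
    using assms(1) unfolding slow_def by blast
  have "rapidly_decaying (\<lambda>n. c n * cf k n \<psi>)"
    by (rule rapidly_decaying_le[OF rapidly_decaying_cf[OF assms(2) True], of _ C s])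
       (use C in \<open>auto simp: abs_mult intro!: mult_right_mono\<close>)
  then show ?thesis by (rule rapidly_decaying_summable)
qed (simp add: embed_def)

lemma fseries_sums:
  assumes "slow c" "k \<in> {1, 2}"
  shows "(\<lambda>n. c n * cf k n \<psi>) sums fseries k c \<psi>"
  unfolding fseries_def by (rule summable_sums[OF summable_rabs_cancel[OF slow_summable[OF assms]]])

lemma fseries_linear:
  assumes "slow c" "slow d" "k \<in> {1, 2}"
  shows "fseries k (\<lambda>n. \<alpha> * c n + \<beta> * d n) \<psi> = \<alpha> * fseries k c \<psi> + \<beta> * fseries k d \<psi>"
proof -
  have "(\<lambda>n. \<alpha> * (c n * cf k n \<psi>) + \<beta> * (d n * cf k n \<psi>)) sums
      (\<alpha> * fseries k c \<psi> + \<beta> * fseries k d \<psi>)"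
    using assms by (intro sums_add sums_mult fseries_sums)
  then show ?thesis by (simp add: fseries_def sums_iff algebra_simps)
qed

lemma fseries_fbasis:
  assumes "k \<in> {1, 2}" "j \<in> {1, 2}"
  shows "fseries k c (fbasis j n) = (if k = j \<and> n \<in> idx k then c n else 0)"
proof -
  have "c m * cf k m (fbasis j n) = (if m = n then (if k = j \<and> n \<in> idx k then c n else 0) else 0)" for m
    using cf_fbasis[OF assms, of m n] by auto
  then show ?thesis
    using sums_single[of n "\<lambda>_. if k = j \<and> n \<in> idx k then c n else 0"]
    by (simp add: fseries_def sums_iff)
qed

lemma embed_fbasis:
  assumes "\<phi> \<in> test_fun" "k \<in> {1, 2}"
  shows "embed \<phi> (fbasis k n) = cf k n \<phi>"
  using embed_commute fbasis_in_test_fun assms by blast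

lemma Hnorm_embed:
  assumes "\<phi> \<in> test_fun"
  shows "Hnorm s (embed \<phi>) = sqrt ((\<Sum>n. (wt s n * cf 1 n \<phi>)\<^sup>2) + (\<Sum>n. (wt s n * cf 2 n \<phi>)\<^sup>2))"
    and "k \<in> {1, 2} \<Longrightarrow> (\<Sum>n. (wt s n * cf k n \<phi>)\<^sup>2) \<le> (Hnorm s (embed \<phi>))\<^sup>2"
    and "Hnorm s (embed \<phi>) \<ge> 0"
proof -
  have r: "summable (\<lambda>n. (wt s n * cf 1 n \<phi>)\<^sup>2)" "summable (\<lambda>n. (wt s n * cf 2 n \<phi>)\<^sup>2)"
    using test_fun_expansion[OF assms] by (intro rapidly_decaying_square_summable; simp)+
  have e: "embed \<phi> (fbasis 1 n) = cf 1 n \<phi>" "embed \<phi> (fbasis 2 n) = cf 2 n \<phi>" for n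
    using embed_fbasis[OF assms] by auto
  have "embed \<phi> (\<lambda>x. 0) = 0" by (simp add: embed_def)
  from Hnorm_eq(1)[of "embed \<phi>" s, OF this, unfolded e, OF r]
  show h: "Hnorm s (embed \<phi>) = sqrt ((\<Sum>n. (wt s n * cf 1 n \<phi>)\<^sup>2) + (\<Sum>n. (wt s n * cf 2 n \<phi>)\<^sup>2))" .
  have n: "(\<Sum>n. (wt s n * cf 1 n \<phi>)\<^sup>2) \<ge> 0" "(\<Sum>n. (wt s n * cf 2 n \<phi>)\<^sup>2) \<ge> 0"
    using r by (simp_all add: suminf_nonneg)
  show "k \<in> {1, 2} \<Longrightarrow> (\<Sum>n. (wt s n * cf k n \<phi>)\<^sup>2) \<le> (Hnorm s (embed \<phi>))\<^sup>2"
    using n h by auto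
  show "Hnorm s (embed \<phi>) \<ge> 0" using n h by simp
qed

lemma fseries_distr:
  assumes c: "slow c" and k: "k \<in> {1, 2}"
  shows "fseries k c \<in> distr"
proof -
  have "linear_functional_on test_fun (fseries k c)"
    unfolding linear_functional_on_def
  proof (intro ballI allI)
    fix \<phi> \<psi> \<alpha> \<beta> assume t: "\<phi> \<in> test_fun" "\<psi> \<in> test_fun"
    have "(\<lambda>n. \<alpha> * (c n * cf k n \<phi>) + \<beta> * (c n * cf k n \<psi>)) sums
        (\<alpha> * fseries k c \<phi> + \<beta> * fseries k c \<psi>)"
      by (intro sums_add sums_mult fseries_sums c k)
    then show "fseries k c (\<lambda>x. \<alpha> * \<phi> x + \<beta> * \<psi> x) = \<alpha> * fseries k c \<phi> + \<beta> * fseries k c \<psi>"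
      by (simp add: fseries_def embed_linear_right[OF t continuous_on_fbasis] sums_iff algebra_simps)
  qed
  moreover have "continuous_on_test_fun (fseries k c)"
  proof -
    obtain C s where C: "\<And>n. \<bar>c n\<bar> \<le> C * wt s n" using c unfolding slow_def by blast
    \<comment> \<open>\<open>s + 1 \<le> N\<close> makes the weights of order \<open>s - N\<close>
      square summable; the remaining order \<open>N\<close> goes to the test function in
      Cauchy-Schwarz.\<close>
    define N where "N = nat \<lceil>s + 1\<rceil>"
    have "s + 1 \<le> real N" unfolding N_def by linarith
    then have X: "summable (\<lambda>n. (C * wt (s - real N) n)\<^sup>2)"
      by (simp add: power_mult_distrib wt_square summable_wt summable_mult)
    define X where "X = (\<Sum>n. (C * wt (s - real N) n)\<^sup>2)"
    have X0: "X \<ge> 0" unfolding X_def using assms X by (simp add: suminf_nonneg)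
    have "\<bar>fseries k c \<phi>\<bar> \<le> sqrt X * Hnorm (real N) (embed \<phi>)" if \<phi>: "\<phi> \<in> test_fun" for \<phi>
    proof -
      have Y: "summable (\<lambda>n. (wt (real N) n * cf k n \<phi>)\<^sup>2)"
        by (intro rapidly_decaying_square_summable rapidly_decaying_cf k \<phi>)
      note cs = summable_square_mult[OF X Y]
      have le: "\<bar>c n * cf k n \<phi>\<bar> \<le> \<bar>C * wt (s - real N) n * (wt (real N) n * cf k n \<phi>)\<bar>" for n
      proof -
        have "C * wt (s - real N) n * (wt (real N) n * cf k n \<phi>)
            = C * (wt (s - real N) n * wt (real N) n) * cf k n \<phi>" by (simp only: mult_ac)
        also have "\<dots> = (C * wt s n) * cf k n \<phi>" by (simp add: wt_add[symmetric])
        finally have eq: "C * wt (s - real N) n * (wt (real N) n * cf k n \<phi>) = (C * wt s n) * cf k n \<phi>" .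
        have "\<bar>c n\<bar> \<le> \<bar>C * wt s n\<bar>" using C[of n] by linarith
        then show ?thesis unfolding eq abs_mult by (intro mult_right_mono) (simp_all add: abs_mult)
      qed
      have "\<bar>fseries k c \<phi>\<bar> \<le> (\<Sum>n. \<bar>c n * cf k n \<phi>\<bar>)"
        unfolding fseries_def by (rule summable_rabs[OF slow_summable[OF c k]])
      also have "\<dots> \<le> (\<Sum>n. \<bar>C * wt (s - real N) n * (wt (real N) n * cf k n \<phi>)\<bar>)"
        by (intro suminf_le le slow_summable[OF c k] cs)
      also have "\<dots> \<le> sqrt (X * (\<Sum>n. (wt (real N) n * cf k n \<phi>)\<^sup>2))"
        unfolding X_def using cs(2) by (rule real_le_rsqrt)
      also have "\<dots> \<le> sqrt (X * (Hnorm (real N) (embed \<phi>))\<^sup>2)"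
        using Hnorm_embed(2)[OF \<phi> k] X0 by (intro real_sqrt_le_mono mult_left_mono)
      also have "\<dots> = sqrt X * Hnorm (real N) (embed \<phi>)"
        using Hnorm_embed(3)[OF \<phi>] by (simp add: real_sqrt_mult)
      finally show ?thesis .
    qed
    then show ?thesis unfolding continuous_on_test_fun_def by blast
  qed
  moreover have "fseries k c \<phi> = 0" if "\<phi> \<notin> test_fun" for \<phi>
    using that by (simp add: fseries_def embed_def)
  ultimately show ?thesis by (simp add: distr_def)
qed

lemma fseries_distr_par:
  assumes c: "slow c" and k: "k \<in> {1, 2}"
  shows "fseries k c \<in> distr_par k"
proof -
  have k3: "3 - k \<in> {1, 2}" "k \<noteq> 3 - k" using k by auto
  show ?thesis
    using fseries_distr[OF assms] fseries_fbasis[OF k k3(1)] k3(2) by (simp add: distr_par_def)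
qed

lemma continuous_on_test_fun_linear:
  assumes "continuous_on_test_fun u" "continuous_on_test_fun v"
  shows "continuous_on_test_fun (\<lambda>\<psi>. \<alpha> * u \<psi> + \<beta> * v \<psi>)"
proof -
  obtain N C where C: "\<And>\<phi>. \<phi> \<in> test_fun \<Longrightarrow> \<bar>u \<phi>\<bar> \<le> C * Hnorm (real N) (embed \<phi>)"
    using assms(1) unfolding continuous_on_test_fun_def by blast
  obtain M D where D: "\<And>\<phi>. \<phi> \<in> test_fun \<Longrightarrow> \<bar>v \<phi>\<bar> \<le> D * Hnorm (real M) (embed \<phi>)"
    using assms(2) unfolding continuous_on_test_fun_def by blast
  have mono: "Hnorm s (embed \<phi>) \<le> Hnorm t (embed \<phi>)" if "\<phi> \<in> test_fun" "s \<le> t" for s t \<phi>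
    unfolding Hnorm_embed(1)[OF that(1)]
    by (intro real_sqrt_le_mono add_mono summable_weighted_mono(2) that(2)
          rapidly_decaying_square_summable test_fun_expansion(1,2)[OF that(1)])
  have "\<bar>\<alpha> * u \<phi> + \<beta> * v \<phi>\<bar>
      \<le> (\<bar>\<alpha>\<bar> * \<bar>C\<bar> + \<bar>\<beta>\<bar> * \<bar>D\<bar>) * Hnorm (real (max N M)) (embed \<phi>)"
    if \<phi>: "\<phi> \<in> test_fun" for \<phi>
  proof -
    define H where "H = Hnorm (real (max N M)) (embed \<phi>)"
    have "C * Hnorm (real N) (embed \<phi>) \<le> \<bar>C\<bar> * H" "D * Hnorm (real M) (embed \<phi>) \<le> \<bar>D\<bar> * H"
      unfolding H_def using Hnorm_embed(3)[OF \<phi>] by (auto intro!: mult_mono mono[OF \<phi>])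
    then have "\<bar>\<alpha>\<bar> * \<bar>u \<phi>\<bar> + \<bar>\<beta>\<bar> * \<bar>v \<phi>\<bar> \<le> \<bar>\<alpha>\<bar> * (\<bar>C\<bar> * H) + \<bar>\<beta>\<bar> * (\<bar>D\<bar> * H)"
      using C[OF \<phi>] D[OF \<phi>] by (intro add_mono mult_left_mono) auto
    moreover have "\<bar>\<alpha> * u \<phi> + \<beta> * v \<phi>\<bar> \<le> \<bar>\<alpha>\<bar> * \<bar>u \<phi>\<bar> + \<bar>\<beta>\<bar> * \<bar>v \<phi>\<bar>"
      using abs_triangle_ineq[of "\<alpha> * u \<phi>" "\<beta> * v \<phi>"] by (simp add: abs_mult)
    ultimately show ?thesis by (simp add: H_def algebra_simps)
  qed
  then show ?thesis unfolding continuous_on_test_fun_def by blast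
qed

lemma distr_lincomb:
  assumes "u \<in> distr" "v \<in> distr"
  shows "(\<lambda>\<psi>. \<alpha> * u \<psi> + \<beta> * v \<psi>) \<in> distr"
  using assms continuous_on_test_fun_linear[of u v \<alpha> \<beta>]
  by (auto simp: distr_def linear_functional_on_def algebra_simps)

lemma rapidly_decaying_slow: "rapidly_decaying b \<Longrightarrow> slow b"
  by (rule slow_square_summable[OF rapidly_decaying_square_summable[of _ 0]])

text \<open>The factors 1 give the shape of a linear combination, to which
  \<open>distr_lincomb\<close> applies.\<close>

lemma embed_eq_fseries:
  assumes "\<phi> \<in> test_fun"
  shows "embed \<phi> = (\<lambda>\<psi>. 1 * fseries 1 (\<lambda>n. cf 1 n \<phi>) \<psi> + 1 * fseries 2 (\<lambda>n. cf 2 n \<phi>) \<psi>)"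
proof
  fix \<psi>
  show "embed \<phi> \<psi> = 1 * fseries 1 (\<lambda>n. cf 1 n \<phi>) \<psi> + 1 * fseries 2 (\<lambda>n. cf 2 n \<phi>) \<psi>"
  proof (cases "\<psi> \<in> test_fun")
    case True
    note e = test_fun_expansion[OF assms]
    have "embed \<phi> \<psi> = integral {0..2 * pi} (\<lambda>x. tf (\<lambda>n. cf 1 n \<phi>) (\<lambda>n. cf 2 n \<phi>) x * \<psi> x)"
      unfolding e(3)[symmetric] using True by (simp add: embed_def)
    then show ?thesis using tf_pairing(3)[OF e(1,2) True] by (simp add: fseries_def)
  qed (simp add: fseries_def embed_def)
qed

lemma embed_in_Hs:
  assumes "\<phi> \<in> test_fun"
  shows "embed \<phi> \<in> Hs s"
proof -
  note e = test_fun_expansion[OF assms]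
  have "embed \<phi> \<in> distr"
    by (subst embed_eq_fseries[OF assms])
       (intro distr_lincomb fseries_distr rapidly_decaying_slow e; simp)
  then show ?thesis
    using embed_fbasis[OF assms] rapidly_decaying_square_summable[OF e(1)]
      rapidly_decaying_square_summable[OF e(2)] by (simp add: Hs_iff)
qed

text \<open>Continuity is tested on the basis functions, whose Sobolev norm of order
  \<open>N\<close> is at most \<open>wt N n\<close>.\<close>

lemma distr_slow:
  assumes u: "u \<in> distr" and k: "k \<in> {1, 2}"
  shows "slow (\<lambda>n. u (fbasis k n))"
proof -
  obtain N C where C: "\<And>\<phi>. \<phi> \<in> test_fun \<Longrightarrow> \<bar>u \<phi>\<bar> \<le> C * Hnorm (real N) (embed \<phi>)"
    using u unfolding distr_def continuous_on_test_fun_def by blast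
  have h: "Hnorm (real N) (cf k n) \<le> wt (real N) n" for n
  proof -
    have s: "(\<Sum>i. (wt (real N) i * cf j i (fbasis k n))\<^sup>2)
        = (if j = k \<and> n \<in> idx j then (wt (real N) n)\<^sup>2 else 0)" if j: "j \<in> {1, 2}" for j
    proof -
      have "(\<lambda>i. (wt (real N) i * cf j i (fbasis k n))\<^sup>2)
          = (\<lambda>i. if i = n then (if j = k \<and> n \<in> idx j then (wt (real N) n)\<^sup>2 else 0) else 0)"
        using cf_fbasis[OF j k] by (auto simp: fun_eq_iff)
      then show ?thesis
        using sums_single[of n "\<lambda>_. if j = k \<and> n \<in> idx j then (wt (real N) n)\<^sup>2 else 0"]
        by (simp only: sums_iff)
    qed
    have "Hnorm (real N) (cf k n) \<le> sqrt ((wt (real N) n)\<^sup>2)"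
      unfolding Hnorm_embed(1)[OF fbasis_in_test_fun[OF k]] using s[of 1] s[of 2] k
      by (intro real_sqrt_le_mono) auto
    then show ?thesis by simp
  qed
  have "\<bar>u (fbasis k n)\<bar> \<le> \<bar>C\<bar> * wt (real N) n" for n
  proof -
    have "C * Hnorm (real N) (cf k n) \<le> \<bar>C\<bar> * wt (real N) n"
      using h[of n] Hnorm_embed(3)[OF fbasis_in_test_fun[OF k]] by (intro mult_mono) auto
    then show ?thesis using C[OF fbasis_in_test_fun[OF k], of n] by linarith
  qed
  then show ?thesis unfolding slow_def by blast
qed

text \<open>The tails \<open>r M\<close> of the Fourier series of a test function tend to 0 in every
  Sobolev norm. Continuity of \<open>u\<close> in one of these norms allows evaluation term by
  term.\<close>

lemma distr_expansion:
  assumes u: "u \<in> distr"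
  shows "u \<psi> = fseries 1 (\<lambda>n. u (fbasis 1 n)) \<psi> + fseries 2 (\<lambda>n. u (fbasis 2 n)) \<psi>"
proof (cases "\<psi> \<in> test_fun")
  case False
  then show ?thesis using u by (simp add: distr_def fseries_def embed_def)
next
  case True
  note e = test_fun_expansion[OF True]
  define b1 b2 where "b1 M n = (if n < M then 0 else cf 1 n \<psi>)"
    and "b2 M n = (if n < M then 0 else cf 2 n \<psi>)" for M n :: nat
  have b: "rapidly_decaying (b1 M)" "rapidly_decaying (b2 M)" for M
    by (rule rapidly_decaying_le[OF e(1), of _ 1 0], simp add: b1_def)
       (rule rapidly_decaying_le[OF e(2), of _ 1 0], simp add: b2_def)
  define r where "r M = tf (b1 M) (b2 M)" for M
  have r: "r M \<in> test_fun" for M unfolding r_def by (intro tf_in_test_fun b)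
  define t where "t n = u (fbasis 1 n) * cf 1 n \<psi> + u (fbasis 2 n) * cf 2 n \<psi>" for n
  have step: "u (r M) = u (r (Suc M)) + t M" for M
  proof -
    define d where "d m = (if m = M then 1 else 0 :: real)" for m
    define a1 a2 where "a1 = cf 1 M \<psi>" and "a2 = cf 2 M \<psi>"
    have d: "rapidly_decaying d" unfolding d_def by (rule rapidly_decaying_unit)
    note rd = b d rapidly_decaying_zero rapidly_decaying_add
    have f: "fbasis 1 M = tf d (\<lambda>m. 0)" "fbasis 2 M = tf (\<lambda>m. 0) d"
      unfolding fbasis_tf d_def by simp_all
    \<comment> \<open>The sequences are nested in this way, with zero summands, so that
      \<open>tf_linear\<close> applies twice and peels off the two modes of index
      \<open>M\<close>.\<close>
    have bM: "b1 M = (\<lambda>n. 1 * (1 * b1 (Suc M) n + a1 * d n) + a2 * 0)"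
      "b2 M = (\<lambda>n. 1 * (1 * b2 (Suc M) n + a1 * 0) + a2 * d n)"
      by (auto simp: fun_eq_iff b1_def b2_def d_def a1_def a2_def less_Suc_eq)
    have "r M = (\<lambda>x. 1 * tf (\<lambda>n. 1 * b1 (Suc M) n + a1 * d n) (\<lambda>n. 1 * b2 (Suc M) n + a1 * 0) x
        + a2 * fbasis 2 M x)"
      unfolding r_def bM f by (rule ext) (intro tf_linear rd)
    also have "\<dots> = (\<lambda>x. 1 * (1 * r (Suc M) x + a1 * fbasis 1 M x) + a2 * fbasis 2 M x)"
      unfolding r_def f by (intro ext arg_cong2[where f = "(+)"] arg_cong[where f = "(*) 1"] refl tf_linear rd)
    finally have "u (r M) = u (\<lambda>x. 1 * (1 * r (Suc M) x + a1 * fbasis 1 M x) + a2 * fbasis 2 M x)"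
      by (rule arg_cong)
    also have "\<dots> = 1 * u (\<lambda>x. 1 * r (Suc M) x + a1 * fbasis 1 M x) + a2 * u (fbasis 2 M)"
      by (intro distr_linear test_fun_linear u r fbasis_in_test_fun) simp_all
    also have "u (\<lambda>x. 1 * r (Suc M) x + a1 * fbasis 1 M x) = 1 * u (r (Suc M)) + a1 * u (fbasis 1 M)"
      by (intro distr_linear u r fbasis_in_test_fun) simp
    finally show ?thesis by (simp add: t_def a1_def a2_def)
  qed
  have r0: "r 0 = \<psi>" unfolding r_def using e(3) by (simp add: b1_def[abs_def] b2_def[abs_def])
  have sum: "(\<Sum>n<M. t n) = u \<psi> - u (r M)" for M
  proof (induction M)
    case (Suc M)
    then show ?case using step[of M] by simp
  qed (simp add: r0)
  obtain N C where C: "\<And>\<phi>. \<phi> \<in> test_fun \<Longrightarrow> \<bar>u \<phi>\<bar> \<le> C * Hnorm (real N) (embed \<phi>)"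
    using u unfolding distr_def continuous_on_test_fun_def by blast
  have tail: "(\<lambda>M. \<Sum>n. (wt s n * (if n < M then 0 else c n))\<^sup>2) \<longlonglongrightarrow> 0"
    if c: "rapidly_decaying c" for c s
  proof -
    define g where "g n = (wt s n * c n)\<^sup>2" for n
    have g: "summable g" unfolding g_def by (intro rapidly_decaying_square_summable c)
    have "(\<lambda>n. g n - (if n \<in> {..<M} then g n else 0)) sums (suminf g - (\<Sum>n<M. g n))" for M
      by (intro sums_diff summable_sums g sums_If_finite_set) auto
    moreover have "(\<lambda>n. g n - (if n \<in> {..<M} then g n else 0))
        = (\<lambda>n. (wt s n * (if n < M then 0 else c n))\<^sup>2)" for M
      by (auto simp: g_def)
    ultimately have "(\<Sum>n. (wt s n * (if n < M then 0 else c n))\<^sup>2) = suminf g - (\<Sum>n<M. g n)" for M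
      by (simp add: sums_iff)
    moreover have "(\<lambda>M. suminf g - (\<Sum>n<M. g n)) \<longlonglongrightarrow> suminf g - suminf g"
      by (intro tendsto_diff tendsto_const summable_LIMSEQ g)
    ultimately show ?thesis by simp
  qed
  have cfr: "cf 1 n (r M) = b1 M n" "cf 2 n (r M) = b2 M n" for n M
    unfolding r_def using cf_tf[OF b(1,2), of n M M] by (auto simp: b1_def)
  have "(\<lambda>M. C * Hnorm (real N) (embed (r M))) \<longlonglongrightarrow> C * sqrt (0 + 0)"
    unfolding Hnorm_embed(1)[OF r] cfr b1_def b2_def
    by (intro tendsto_mult tendsto_const tendsto_real_sqrt tendsto_add tail e)
  then have "(\<lambda>M. C * Hnorm (real N) (embed (r M))) \<longlonglongrightarrow> 0" by simp
  then have "(\<lambda>M. u (r M)) \<longlonglongrightarrow> 0"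
    by (rule Lim_null_comparison[rotated]) (use C[OF r] in auto)
  then have "(\<lambda>M. u \<psi> - u (r M)) \<longlonglongrightarrow> u \<psi> - 0"
    by (intro tendsto_diff tendsto_const)
  then have "t sums u \<psi>" by (simp add: sums_def sum)
  moreover have "t sums (fseries 1 (\<lambda>n. u (fbasis 1 n)) \<psi> + fseries 2 (\<lambda>n. u (fbasis 2 n)) \<psi>)"
    unfolding t_def by (intro sums_add fseries_sums distr_slow u) auto
  ultimately show ?thesis by (rule sums_unique2)
qed

lemma distr_par_other:
  assumes u: "u \<in> distr_par k" and k: "k \<in> {1, 2}"
  shows "u (fbasis (3 - k) n) = 0"
proof (cases "n \<in> idx (3 - k)")
  case True
  then show ?thesis using u by (simp add: distr_par_def)
next
  case False
  then have "3 - k = 1" "n = 0" by (auto simp: idx_def split: if_splits)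
  then show ?thesis using u by (simp add: distr_par_def)
qed

lemma distr_par_expansion:
  assumes u: "u \<in> distr_par k" and k: "k \<in> {1, 2}"
  shows "u = fseries k (\<lambda>n. u (fbasis k n))"
proof
  fix \<psi>
  have d: "u \<in> distr" using u by (simp add: distr_par_def)
  have "fseries (3 - k) (\<lambda>n. u (fbasis (3 - k) n)) \<psi> = 0"
    by (simp add: distr_par_other[OF u k] fseries_def)
  then show "u \<psi> = fseries k (\<lambda>n. u (fbasis k n)) \<psi>"
    using distr_expansion[OF d, of \<psi>] k by auto
qed

lemma Hs_par_iff:
  assumes k: "k \<in> {1, 2}"
  shows "u \<in> Hs_par k s \<longleftrightarrow> u \<in> distr_par k \<and> summable (\<lambda>n. (wt s n * u (fbasis k n))\<^sup>2)"
proof -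
  have "u \<in> Hs s \<longleftrightarrow> summable (\<lambda>n. (wt s n * u (fbasis k n))\<^sup>2)" if u: "u \<in> distr_par k"
  proof -
    have d: "u \<in> distr" using u by (simp add: distr_par_def)
    have z: "u (fbasis (3 - k) n) = 0" for n by (rule distr_par_other[OF u k])
    from k consider "k = 1" | "k = 2" by blast
    then show ?thesis using d z by cases (simp_all add: Hs_iff)
  qed
  then show ?thesis by (auto simp: Hs_par_def)
qed

lemma Hnorm_par:
  assumes k: "k \<in> {1, 2}" and u: "u \<in> Hs_par k s"
  shows "Hnorm s u = sqrt (\<Sum>n. (wt s n * u (fbasis k n))\<^sup>2)"
proof -
  have h: "u \<in> Hs s" and p: "u \<in> distr_par k" using u by (simp_all add: Hs_par_def)
  have z: "u (fbasis (3 - k) n) = 0" for n by (rule distr_par_other[OF p k])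
  have eq: "Hnorm s u = sqrt ((\<Sum>n. (wt s n * u (fbasis 1 n))\<^sup>2) + (\<Sum>n. (wt s n * u (fbasis 2 n))\<^sup>2))"
    using h by (intro Hnorm_eq(1)) (simp_all add: Hs_iff)
  from k consider "k = 1" | "k = 2" by blast
  then show ?thesis using eq z by cases simp_all
qed

lemma fseries_in_Hs_par:
  assumes k: "k \<in> {1, 2}" and c: "summable (\<lambda>n. (wt s n * c n)\<^sup>2)"
  shows "fseries k c \<in> Hs_par k s"
proof -
  have "summable (\<lambda>n. (wt s n * fseries k c (fbasis k n))\<^sup>2)"
    by (rule summable_comparison_test[OF _ c]) (auto simp: fseries_fbasis[OF k k])
  then show ?thesis
    using fseries_distr_par[OF slow_square_summable[OF c] k] by (simp add: Hs_par_iff[OF k])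
qed

lemma Lap_eq_fseries:
  assumes u: "u \<in> distr_par k" and k: "k \<in> {1, 2}"
  shows "Lap u = fseries k (\<lambda>n. - (real n)\<^sup>2 * u (fbasis k n))"
proof
  fix \<psi>
  show "Lap u \<psi> = fseries k (\<lambda>n. - (real n)\<^sup>2 * u (fbasis k n)) \<psi>"
  proof (cases "\<psi> \<in> test_fun")
    case True
    have "Lap u \<psi> = fseries k (\<lambda>n. u (fbasis k n)) (deriv (deriv \<psi>))"
      using True distr_par_expansion[OF u k] by (simp add: Lap_def)
    also have "\<dots> = fseries k (\<lambda>n. - (real n)\<^sup>2 * u (fbasis k n)) \<psi>"
      using deriv2_test_fun(2)[OF True k] by (simp add: fseries_def mult_ac)
    finally show ?thesis .
  qed (simp add: Lap_def fseries_def embed_def)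
qed

lemma distr_par_coeff_0:
  assumes u: "u \<in> distr_par k" and n: "n \<notin> idx k"
  shows "u (fbasis k n) = 0"
proof -
  have "k = 1" "n = 0" using n by (auto simp: idx_def split: if_splits)
  then show ?thesis using u by (simp add: distr_par_def)
qed

section \<open>Operators given by kernels\<close>

lemma Hnorm_mono:
  assumes u: "u \<in> Hs t" and st: "s \<le> t"
  shows "Hnorm s u \<le> Hnorm t u"
proof -
  have t: "summable (\<lambda>n. (wt t n * u (fbasis 1 n))\<^sup>2)" "summable (\<lambda>n. (wt t n * u (fbasis 2 n))\<^sup>2)"
    and d: "u \<in> distr" using u by (simp_all add: Hs_iff)
  note s = summable_weighted_mono(1)[OF t(1) st] summable_weighted_mono(1)[OF t(2) st]
  show ?thesis
    unfolding Hnorm_eq(1)[of u s, OF distr_fbasis_1_0[OF d] s] Hnorm_eq(1)[of u t, OF distr_fbasis_1_0[OF d] t]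
    by (intro real_sqrt_le_mono add_mono summable_weighted_mono(2) t st)
qed

lemma Hs_par_lincomb:
  assumes k: "k \<in> {1, 2}" and uv: "u \<in> Hs_par k s" "v \<in> Hs_par k s"
  shows "(\<lambda>\<psi>. \<alpha> * u \<psi> + \<beta> * v \<psi>) \<in> Hs_par k s"
proof -
  have u: "u \<in> distr_par k" "summable (\<lambda>n. (wt s n * u (fbasis k n))\<^sup>2)"
    and v: "v \<in> distr_par k" "summable (\<lambda>n. (wt s n * v (fbasis k n))\<^sup>2)"
    using uv by (simp_all add: Hs_par_iff[OF k])
  have d: "(\<lambda>\<psi>. \<alpha> * u \<psi> + \<beta> * v \<psi>) \<in> distr_par k"
    using u(1) v(1) distr_lincomb[of u v \<alpha> \<beta>] by (simp add: distr_par_def)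
  have le: "(wt s n * (\<alpha> * u (fbasis k n) + \<beta> * v (fbasis k n)))\<^sup>2
      \<le> 2 * \<alpha>\<^sup>2 * (wt s n * u (fbasis k n))\<^sup>2 + 2 * \<beta>\<^sup>2 * (wt s n * v (fbasis k n))\<^sup>2" for n
  proof -
    define x y where "x = \<alpha> * (wt s n * u (fbasis k n))" and "y = \<beta> * (wt s n * v (fbasis k n))"
    have "(x + y)\<^sup>2 \<le> 2 * x\<^sup>2 + 2 * y\<^sup>2"
      using sum_squares_bound[of x y] by (simp add: power2_sum)
    then show ?thesis by (simp add: x_def y_def power_mult_distrib algebra_simps)
  qed
  have sm: "summable (\<lambda>n. 2 * \<alpha>\<^sup>2 * (wt s n * u (fbasis k n))\<^sup>2 + 2 * \<beta>\<^sup>2 * (wt s n * v (fbasis k n))\<^sup>2)"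
    by (intro summable_add summable_mult u v)
  have "summable (\<lambda>n. (wt s n * (\<alpha> * u (fbasis k n) + \<beta> * v (fbasis k n)))\<^sup>2)"
    by (rule summable_comparison_test[OF _ sm]) (use le in auto)
  then show ?thesis using d by (simp add: Hs_par_iff[OF k])
qed

lemma fseries_cong:
  assumes "\<And>n. n \<in> idx k \<Longrightarrow> c n = d n"
  shows "fseries k c = fseries k d"
proof -
  have "c n * cf k n \<psi> = d n * cf k n \<psi>" for n \<psi>
  proof (cases "n \<in> idx k")
    case False
    then have "k = 1" "n = 0" by (auto simp: idx_def split: if_splits)
    then show ?thesis by simp
  qed (simp add: assms)
  then show ?thesis unfolding fseries_def by presburger
qed

text \<open>Duality of the orders \<open>s\<close> and \<open>- s\<close>: the weights cancel in the
  pairing, so Cauchy-Schwarz can be applied to the weighted sequences.\<close>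

lemma Hs_par_pairing:
  assumes k: "k \<in> {1, 2}" and u: "u \<in> Hs_par k s" and \<psi>: "\<psi> \<in> test_fun"
  shows "\<bar>u \<psi>\<bar> \<le> sqrt (\<Sum>n. (wt (- s) n * cf k n \<psi>)\<^sup>2) * Hnorm s u"
proof -
  have X: "summable (\<lambda>n. (wt s n * u (fbasis k n))\<^sup>2)" and p: "u \<in> distr_par k"
    using u by (simp_all add: Hs_par_iff[OF k])
  have Y: "summable (\<lambda>n. (wt (- s) n * cf k n \<psi>)\<^sup>2)"
    by (intro rapidly_decaying_square_summable rapidly_decaying_cf k \<psi>)
  note cs = summable_square_mult[OF X Y]
  have eq: "wt s n * u (fbasis k n) * (wt (- s) n * cf k n \<psi>) = u (fbasis k n) * cf k n \<psi>" for n
  proof -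
    have "wt s n * u (fbasis k n) * (wt (- s) n * cf k n \<psi>)
        = (wt s n * wt (- s) n) * (u (fbasis k n) * cf k n \<psi>)" by (simp only: mult_ac)
    then show ?thesis by simp
  qed
  have "\<bar>u \<psi>\<bar> = \<bar>\<Sum>n. u (fbasis k n) * cf k n \<psi>\<bar>"
    using distr_par_expansion[OF p k] unfolding fseries_def by metis
  also have "\<dots> \<le> (\<Sum>n. \<bar>u (fbasis k n) * cf k n \<psi>\<bar>)"
    using cs(1) unfolding eq by (rule summable_rabs)
  also have "\<dots> \<le> sqrt ((\<Sum>n. (wt s n * u (fbasis k n))\<^sup>2) * (\<Sum>n. (wt (- s) n * cf k n \<psi>)\<^sup>2))"
    using cs(2) unfolding eq by (rule real_le_rsqrt)
  finally show ?thesis by (simp add: Hnorm_par[OF k u] real_sqrt_mult mult.commute)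
qed

text \<open>The formula does not mention an order, so a single operator serves all orders at which
  the rows of \<open>L\<close> converge. It reads only the coefficients of parity
  \<open>k\<close>.\<close>

definition kop :: "nat \<Rightarrow> (nat \<Rightarrow> nat \<Rightarrow> real) \<Rightarrow> functional \<Rightarrow> functional" where
  "kop k L u = fseries k (\<lambda>p. \<Sum>n. L p n * u (fbasis k n))"

context
  fixes k :: nat and m :: real and L :: "nat \<Rightarrow> nat \<Rightarrow> real"
  assumes k: "k \<in> {1, 2}" and L: "kernel m L" and supp: "\<And>p n. p \<notin> idx k \<Longrightarrow> L p n = 0"
begin

lemma kop_coeff: "kop k L u (fbasis k p) = (\<Sum>n. L p n * u (fbasis k n))"
  using supp by (simp add: kop_def fseries_fbasis[OF k k])

lemma kop_summable:
  assumes "u \<in> Hs (m + s)" "s > -3/2"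
  shows "summable (\<lambda>n. L p n * u (fbasis k n))"
  using kernel_summable[OF L assms(2) Hs_coeff(1)[OF assms(1) k]] by (rule summable_rabs_cancel)

lemma kop_bounded:
  assumes s: "\<bar>s\<bar> < 3/2"
  shows "\<exists>Z\<ge>0. \<forall>u\<in>Hs (m + s). kop k L u \<in> Hs_par k (m + s) \<and>
    Hnorm (m + s) (kop k L u) \<le> Z * Hnorm (m + s) u"
proof -
  obtain Z where Z: "Z \<ge> 0"
    "\<And>u p. summable (\<lambda>n. (wt (m + s) n * u n)\<^sup>2) \<Longrightarrow> summable (\<lambda>n. \<bar>L p n * u n\<bar>)"
    "\<And>u. summable (\<lambda>n. (wt (m + s) n * u n)\<^sup>2) \<Longrightarrow>
      summable (\<lambda>p. (wt (m + s) p * (\<Sum>n. \<bar>L p n * u n\<bar>))\<^sup>2)"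
    "\<And>u. summable (\<lambda>n. (wt (m + s) n * u n)\<^sup>2) \<Longrightarrow>
      (\<Sum>p. (wt (m + s) p * (\<Sum>n. \<bar>L p n * u n\<bar>))\<^sup>2) \<le> Z * (\<Sum>n. (wt (m + s) n * u n)\<^sup>2)"
    using kernel_bounded[OF L s] by blast
  have "kop k L u \<in> Hs_par k (m + s) \<and> Hnorm (m + s) (kop k L u) \<le> sqrt Z * Hnorm (m + s) u"
    if u: "u \<in> Hs (m + s)" for u
  proof -
    note c = Hs_coeff(1)[OF u k]
    define w where "w p = (\<Sum>n. L p n * u (fbasis k n))" for p
    have le: "(wt (m + s) p * w p)\<^sup>2 \<le> (wt (m + s) p * (\<Sum>n. \<bar>L p n * u (fbasis k n)\<bar>))\<^sup>2" for p
      unfolding w_def power_mult_distrib using summable_rabs[OF Z(2)[OF c, of p]]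
      by (intro mult_left_mono) (auto simp: abs_le_square_iff[symmetric])
    have s1: "summable (\<lambda>p. (wt (m + s) p * w p)\<^sup>2)"
      by (rule summable_comparison_test[OF _ Z(3)[OF c]]) (use le in auto)
    have mem: "kop k L u \<in> Hs_par k (m + s)"
      unfolding kop_def using s1 by (intro fseries_in_Hs_par k) (simp add: w_def)
    have "Hnorm (m + s) (kop k L u) = sqrt (\<Sum>p. (wt (m + s) p * w p)\<^sup>2)"
      by (simp add: Hnorm_par[OF k mem] kop_coeff w_def)
    also have "\<dots> \<le> sqrt (Z * (Hnorm (m + s) u)\<^sup>2)"
    proof (intro real_sqrt_le_mono)
      have "(\<Sum>p. (wt (m + s) p * w p)\<^sup>2) \<le> (\<Sum>p. (wt (m + s) p * (\<Sum>n. \<bar>L p n * u (fbasis k n)\<bar>))\<^sup>2)"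
        by (intro suminf_le le s1 Z(3) c)
      also have "\<dots> \<le> Z * (\<Sum>n. (wt (m + s) n * u (fbasis k n))\<^sup>2)" by (rule Z(4)[OF c])
      also have "\<dots> \<le> Z * (Hnorm (m + s) u)\<^sup>2"
        using Z(1) Hs_coeff(2)[OF u k] by (intro mult_left_mono)
      finally show "(\<Sum>p. (wt (m + s) p * w p)\<^sup>2) \<le> Z * (Hnorm (m + s) u)\<^sup>2" .
    qed
    also have "\<dots> = sqrt Z * Hnorm (m + s) u"
      using Hs_coeff(3)[OF u k] by (simp add: real_sqrt_mult)
    finally show ?thesis using mem by blast
  qed
  then show ?thesis using Z(1) by (intro exI[of _ "sqrt Z"]) auto
qed

lemma kop_in_Hs_par:
  assumes "u \<in> Hs (m + s)" "\<bar>s\<bar> < 3/2"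
  shows "kop k L u \<in> Hs_par k (m + s)"
  using kop_bounded[OF assms(2)] assms(1) by blast

lemma kop_distr_par:
  assumes "u \<in> Hs (m + s)" "s > -3/2"
  shows "kop k L u \<in> distr_par k"
proof -
  have "u \<in> Hs (m + min s 0)" using assms(1) Hs_mono[of "m + min s 0" "m + s"] by auto
  then have "kop k L u \<in> Hs_par k (m + min s 0)" using assms(2) by (intro kop_in_Hs_par) auto
  then show ?thesis by (simp add: Hs_par_def)
qed

lemma kop_pointwise_bound:
  assumes \<psi>: "\<psi> \<in> test_fun" and s: "s > -3/2"
  shows "\<exists>C. \<forall>u\<in>Hs (m + s). \<bar>kop k L u \<psi>\<bar> \<le> C * Hnorm (m + s) u"
proof -
  \<comment> \<open>The kernel is bounded only for \<open>\<bar>s\<bar> < 3/2\<close>; positive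
    \<open>s\<close> is lowered to 0, where \<open>Hnorm\<close> is smaller.\<close>
  define s' where "s' = min s 0"
  have s': "\<bar>s'\<bar> < 3/2" "m + s' \<le> m + s" using s by (auto simp: s'_def)
  obtain Z where Z: "Z \<ge> 0" "\<And>u. u \<in> Hs (m + s') \<Longrightarrow> kop k L u \<in> Hs_par k (m + s') \<and>
    Hnorm (m + s') (kop k L u) \<le> Z * Hnorm (m + s') u"
    using kop_bounded[OF s'(1)] by blast
  define Y where "Y = sqrt (\<Sum>n. (wt (- (m + s')) n * cf k n \<psi>)\<^sup>2)"
  have Y: "Y \<ge> 0" unfolding Y_def
    by (intro real_sqrt_ge_zero suminf_nonneg rapidly_decaying_square_summable rapidly_decaying_cf k \<psi>) auto
  have "\<bar>kop k L u \<psi>\<bar> \<le> (Y * Z) * Hnorm (m + s) u" if u: "u \<in> Hs (m + s)" for u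
  proof -
    have u': "u \<in> Hs (m + s')" using u Hs_mono[OF s'(2)] by blast
    have "\<bar>kop k L u \<psi>\<bar> \<le> Y * Hnorm (m + s') (kop k L u)"
      unfolding Y_def using Z(2)[OF u'] by (intro Hs_par_pairing k \<psi>) auto
    also have "\<dots> \<le> Y * (Z * Hnorm (m + s') u)" using Z(2)[OF u'] Y by (intro mult_left_mono) auto
    also have "\<dots> \<le> Y * (Z * Hnorm (m + s) u)"
      using Hnorm_mono[OF u s'(2)] Y Z(1) by (intro mult_left_mono) auto
    finally show ?thesis by simp
  qed
  then show ?thesis by blast
qed

lemma kop_linear:
  assumes u: "u \<in> Hs (m + s)" and v: "v \<in> Hs (m + s)" and s: "s > -3/2"
  shows "kop k L (\<lambda>x. \<alpha> * u x + \<beta> * v x) = (\<lambda>y. \<alpha> * kop k L u y + \<beta> * kop k L v y)"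
proof
  fix y
  have "(\<Sum>n. L p n * (\<alpha> * u (fbasis k n) + \<beta> * v (fbasis k n)))
      = \<alpha> * (\<Sum>n. L p n * u (fbasis k n)) + \<beta> * (\<Sum>n. L p n * v (fbasis k n))" for p
  proof -
    have "(\<lambda>n. \<alpha> * (L p n * u (fbasis k n)) + \<beta> * (L p n * v (fbasis k n))) sums
        (\<alpha> * (\<Sum>n. L p n * u (fbasis k n)) + \<beta> * (\<Sum>n. L p n * v (fbasis k n)))"
      by (intro sums_add sums_mult summable_sums kop_summable[OF u s] kop_summable[OF v s])
    then show ?thesis by (simp add: sums_iff algebra_simps)
  qed
  moreover have "slow (\<lambda>p. \<Sum>n. L p n * w (fbasis k n))" if w: "w \<in> Hs (m + s)" for w
    using distr_slow[of "kop k L w" k] kop_distr_par[OF w s] k by (simp add: kop_coeff distr_par_def)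
  ultimately show "kop k L (\<lambda>x. \<alpha> * u x + \<beta> * v x) y = \<alpha> * kop k L u y + \<beta> * kop k L v y"
    unfolding kop_def using u v k by (simp add: fseries_linear)
qed

end

lemma kop_inverse:
  assumes k: "k \<in> {1, 2}" and L: "kernel m L" "kernel m L'"
    and supp: "\<And>p n. p \<notin> idx k \<Longrightarrow> L p n = 0" "\<And>p n. p \<notin> idx k \<Longrightarrow> L' p n = 0"
    and id: "\<And>p q. (\<Sum>n. L p n * L' n q) = (if p = q \<and> p \<in> idx k then 1 else 0)"
    and u: "u \<in> Hs_par k (m + s)" and s: "\<bar>s\<bar> < 3/2"
  shows "kop k L (kop k L' u) = u"
proof -
  have p: "u \<in> distr_par k" and c: "summable (\<lambda>n. (wt (m + s) n * u (fbasis k n))\<^sup>2)"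
    using u by (simp_all add: Hs_par_iff[OF k])
  have "(\<Sum>n. L p n * (\<Sum>q. L' n q * u (fbasis k q))) = u (fbasis k p)" for p
    by (rule kernel_inverse[OF L s c id]) (rule distr_par_coeff_0[OF p])
  then have "kop k L (kop k L' u) = fseries k (\<lambda>p. u (fbasis k p))"
    by (simp add: kop_def[of k L] kop_coeff[OF k L(2) supp(2)])
  then show ?thesis using distr_par_expansion[OF p k] by simp
qed

lemma kop_isomorphism:
  assumes k: "k \<in> {1, 2}" and L: "kernel m L" "kernel m L'"
    and supp: "\<And>p n. p \<notin> idx k \<Longrightarrow> L p n = 0" "\<And>p n. p \<notin> idx k \<Longrightarrow> L' p n = 0"
    and id: "\<And>p q. (\<Sum>n. L p n * L' n q) = (if p = q \<and> p \<in> idx k then 1 else 0)"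
      "\<And>p q. (\<Sum>n. L' p n * L n q) = (if p = q \<and> p \<in> idx k then 1 else 0)"
    and s: "\<bar>s\<bar> < 3/2"
  shows "isomorphism_on_Hs_par k (m + s) (kop k L)"
proof -
  have s': "s > -3/2" using s by linarith
  obtain Z where Z: "\<And>u. u \<in> Hs (m + s) \<Longrightarrow> kop k L u \<in> Hs_par k (m + s) \<and>
    Hnorm (m + s) (kop k L u) \<le> Z * Hnorm (m + s) u"
    using kop_bounded[OF k L(1) supp(1) s] by blast
  obtain Z' where Z': "\<And>u. u \<in> Hs (m + s) \<Longrightarrow> kop k L' u \<in> Hs_par k (m + s) \<and>
    Hnorm (m + s) (kop k L' u) \<le> Z' * Hnorm (m + s) u"
    using kop_bounded[OF k L(2) supp(2) s] by blast
  have H: "u \<in> Hs (m + s)" if "u \<in> Hs_par k (m + s)" for u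
    using that by (simp add: Hs_par_def)
  have inv1: "kop k L (kop k L' u) = u" if "u \<in> Hs_par k (m + s)" for u
    by (rule kop_inverse[OF k L supp id(1) that s])
  have inv2: "kop k L' (kop k L u) = u" if "u \<in> Hs_par k (m + s)" for u
    by (rule kop_inverse[OF k L(2,1) supp(2,1) id(2) that s])
  have "linear_operator_on (Hs_par k (m + s)) (kop k L)"
    unfolding linear_operator_on_def using kop_linear[OF k L(1) supp(1) H H s'] by blast
  moreover have "bij_betw (kop k L) (Hs_par k (m + s)) (Hs_par k (m + s))"
    by (rule bij_betw_byWitness[where f' = "kop k L'"]) (use inv1 inv2 Z Z' H in auto)
  moreover have "\<forall>u\<in>Hs_par k (m + s). Hnorm (m + s) (kop k L u) \<le> Z * Hnorm (m + s) u"
    using Z H by blast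
  \<comment> \<open>Continuity of the inverse is the upper bound for \<open>L'\<close>, applied to
    \<open>kop k L u\<close>.\<close>
  moreover have "Hnorm (m + s) u \<le> Z' * Hnorm (m + s) (kop k L u)" if u: "u \<in> Hs_par k (m + s)" for u
  proof -
    have "Hnorm (m + s) (kop k L' (kop k L u)) \<le> Z' * Hnorm (m + s) (kop k L u)"
      using Z[OF H[OF u]] Z'[OF H] by blast
    then show ?thesis by (simp add: inv2[OF u])
  qed
  ultimately show ?thesis unfolding isomorphism_on_Hs_par_def by blast
qed

section \<open>The matrix of the transform and its inverse\<close>

lemma embed_linear_left:
  assumes "\<phi> \<in> test_fun" "\<psi> \<in> test_fun"
  shows "embed (\<lambda>x. \<alpha> * \<phi> x + \<beta> * \<psi> x) = (\<lambda>\<eta>. \<alpha> * embed \<phi> \<eta> + \<beta> * embed \<psi> \<eta>)"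
proof
  fix \<eta>
  show "embed (\<lambda>x. \<alpha> * \<phi> x + \<beta> * \<psi> x) \<eta> = \<alpha> * embed \<phi> \<eta> + \<beta> * embed \<psi> \<eta>"
  proof (cases "\<eta> \<in> test_fun")
    case True
    then show ?thesis
      using embed_linear_right[OF assms test_fun_continuous[OF True], of \<alpha> \<beta>]
        embed_commute[OF True] assms test_fun_linear[OF assms] by simp
  qed (simp add: embed_def)
qed

text \<open>
  With \<open>R = res J lam\<close> and \<open>S = res J (- lam)\<close>, the Cauchy matrix \<open>1 / (p\<^sup>2 + lam - n\<^sup>2)\<close> has
  the inverse \<open>- R n * S p / (p\<^sup>2 + lam - n\<^sup>2)\<close>; the weights \<open>a\<close> and \<open>R / a\<close> turn these two
  matrices into \<open>L\<close> and \<open>L'\<close>.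
\<close>

lemma transform_kernels:
  fixes a :: "nat \<Rightarrow> real"
  assumes lam: "lam \<notin> sq_diffs" and c: "c > 0"
    and a: "\<And>n. n \<in> J \<Longrightarrow> c * wt (- m) n \<le> \<bar>a n\<bar> \<and> \<bar>a n\<bar> \<le> C * wt (- m) n"
  defines "K \<equiv> \<lambda>n. res J lam n / a n"
    and "S \<equiv> res J (- lam)"
  defines "L \<equiv> \<lambda>p n. if p \<in> J \<and> n \<in> J then - a p * (1 / ((real p)\<^sup>2 + lam - (real n)\<^sup>2)) * K n else 0"
    and "L' \<equiv> \<lambda>n p. if p \<in> J \<and> n \<in> J then a n * S p * (1 / ((real p)\<^sup>2 + lam - (real n)\<^sup>2)) / a p else 0"
  shows "\<exists>B. \<forall>n. \<bar>K n\<bar> \<le> B * wt m n"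
    and "kernel m L" and "kernel m L'"
    and "\<And>p q. (\<Sum>n. L p n * L' n q) = (if p = q \<and> p \<in> J then 1 else 0)"
    and "\<And>p q. (\<Sum>n. L' p n * L n q) = (if p = q \<and> p \<in> J then 1 else 0)"
proof -
  define M where "M p n = 1 / ((real p)\<^sup>2 + lam - (real n)\<^sup>2)" for p n :: nat
  obtain BM where BM: "\<And>p n. \<bar>M p n\<bar> \<le> BM * kap p n"
    using cauchy_kernel_bound[OF lam] unfolding M_def by blast
  obtain BR where BR: "\<And>n. \<bar>res J lam n\<bar> \<le> BR" using res_bounded by blast
  obtain BS where BS: "\<And>n. \<bar>S n\<bar> \<le> BS" unfolding S_def using res_bounded by blast
  have nn: "BR \<ge> 0" "BS \<ge> 0" using BR[of 0] BS[of 0] by linarith+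
  have anz: "a n \<noteq> 0" if "n \<in> J" for n
    using a[OF that] c wt_pos[of "- m" n] by (metis abs_zero mult_pos_pos not_less)
  have inva: "1 / \<bar>a n\<bar> \<le> 1 / c * wt m n" if "n \<in> J" for n
  proof -
    have "1 / \<bar>a n\<bar> \<le> 1 / (c * wt (- m) n)"
      using a[OF that] c by (intro divide_left_mono mult_pos_pos) (auto intro!: anz that)
    then show ?thesis by (simp add: wt_minus field_simps)
  qed
  have K: "\<bar>K n\<bar> \<le> (BR / c) * wt m n" for n
  proof (cases "n \<in> J")
    case True
    have "\<bar>K n\<bar> = \<bar>res J lam n\<bar> * (1 / \<bar>a n\<bar>)" by (simp add: K_def)
    also have "\<dots> \<le> BR * (1 / c * wt m n)"
      by (intro mult_mono BR inva True nn) auto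
    finally show ?thesis by simp
  next
    case False
    then show ?thesis using nn c by (simp add: K_def res_def)
  qed
  then show "\<exists>B. \<forall>n. \<bar>K n\<bar> \<le> B * wt m n" by blast
  have bl: "\<bar>L p n\<bar> \<le> (\<bar>C\<bar> * \<bar>BM\<bar> * (BR / c)) * (wt (- m) p * kap p n * wt m n)" for p n
  proof (cases "p \<in> J \<and> n \<in> J")
    case True
    then have "\<bar>L p n\<bar> = \<bar>a p\<bar> * \<bar>M p n\<bar> * \<bar>K n\<bar>" by (simp add: L_def M_def abs_mult)
    also have "\<dots> \<le> (\<bar>C\<bar> * wt (- m) p) * (\<bar>BM\<bar> * kap p n) * ((BR / c) * wt m n)"
    proof (intro mult_mono K)
      show "\<bar>a p\<bar> \<le> \<bar>C\<bar> * wt (- m) p"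
        using a[of p] True mult_right_mono[OF abs_ge_self[of C] wt_nonneg[of "- m" p]] by linarith
      show "\<bar>M p n\<bar> \<le> \<bar>BM\<bar> * kap p n"
        using BM[of p n] mult_right_mono[OF abs_ge_self[of BM] kap_nonneg[of p n]] by linarith
    qed (use nn c in auto)
    finally show ?thesis by (simp only: mult_ac)
  qed (use nn c in \<open>auto simp: L_def\<close>)
  then show "kernel m L" unfolding kernel_def by blast
  have "\<bar>L' n p\<bar> \<le> (\<bar>C\<bar> * BS * \<bar>BM\<bar> * (1 / c)) * (wt (- m) n * kap n p * wt m p)" for p n
  proof (cases "p \<in> J \<and> n \<in> J")
    case True
    then have "\<bar>L' n p\<bar> = \<bar>a n\<bar> * \<bar>S p\<bar> * \<bar>M p n\<bar> * (1 / \<bar>a p\<bar>)"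
      by (simp add: L'_def M_def abs_mult)
    also have "\<dots> \<le> (\<bar>C\<bar> * wt (- m) n) * BS * (\<bar>BM\<bar> * kap p n) * (1 / c * wt m p)"
    proof (intro mult_mono BS inva)
      show "\<bar>a n\<bar> \<le> \<bar>C\<bar> * wt (- m) n"
        using a[of n] True mult_right_mono[OF abs_ge_self[of C] wt_nonneg[of "- m" n]] by linarith
      show "\<bar>M p n\<bar> \<le> \<bar>BM\<bar> * kap p n"
        using BM[of p n] mult_right_mono[OF abs_ge_self[of BM] kap_nonneg[of p n]] by linarith
    qed (use nn c True in auto)
    finally show ?thesis by (simp only: mult_ac kap_commute[of p n])
  qed (use nn c in \<open>auto simp: L'_def\<close>)
  then show "kernel m L'" unfolding kernel_def by blast
  have Ka: "K n * a n = res J lam n" if "n \<in> J" for n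
    using anz[OF that] by (simp add: K_def)
  show "(\<Sum>n. L p n * L' n q) = (if p = q \<and> p \<in> J then 1 else 0)" for p q
  proof (cases "p \<in> J \<and> q \<in> J")
    case True
    \<comment> \<open>The factor \<open>K n\<close> of \<open>L\<close> meets the factor
      \<open>a n\<close> of \<open>L'\<close>, and their product is the residue, as required by
      \<open>cauchy_orth\<close>.\<close>
    have "L p n * L' n q = (- a p * S q / a q) * (res J lam n * (M q n * M p n))" for n
    proof (cases "n \<in> J")
      case n: True
      have "L p n * L' n q = (- a p * S q / a q) * ((K n * a n) * (M q n * M p n))"
        using True n by (simp add: L_def L'_def M_def mult_ac)
      then show ?thesis by (simp only: Ka[OF n])
    qed (simp add: L_def res_def)
    moreover have "summable (\<lambda>n. res J lam n * (M q n * M p n))"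
    proof (rule summable_comparison_test[OF _ summable_mult[OF summable_cauchy[OF lam, of p], of "BR * \<bar>BM\<bar>"]],
        intro exI allI impI)
      fix n
      have "\<bar>M q n\<bar> \<le> \<bar>BM\<bar>"
        using order_trans[OF BM[of q n] mult_mono[of BM "\<bar>BM\<bar>" "kap q n" 1]] kap_le_1[of q n] by simp
      then have "\<bar>res J lam n\<bar> * (\<bar>M q n\<bar> * \<bar>M p n\<bar>) \<le> BR * (\<bar>BM\<bar> * \<bar>M p n\<bar>)"
        using nn BR by (intro mult_mono) auto
      then show "norm (res J lam n * (M q n * M p n)) \<le> BR * \<bar>BM\<bar> * \<bar>1 / ((real p)\<^sup>2 + lam - (real n)\<^sup>2)\<bar>"
        by (simp add: M_def abs_mult)
    qed
    ultimately have "(\<Sum>n. L p n * L' n q) = (- a p * S q / a q) * (\<Sum>n. res J lam n * (M q n * M p n))"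
      by (simp only: suminf_mult)
    also have "\<dots> = (- a p / a q) * (S q * (\<Sum>n. res J lam n * (M q n * M p n)))"
      by simp
    also have "\<dots> = (- a p / a q) * (if q = p then -1 else 0)"
      using cauchy_orth[OF lam, of q J p] True by (simp add: S_def M_def)
    finally show ?thesis using True anz[of p] by auto
  qed (auto simp: L_def L'_def)
  show "(\<Sum>n. L' p n * L n q) = (if p = q \<and> p \<in> J then 1 else 0)" for p q
  proof (cases "p \<in> J \<and> q \<in> J")
    case True
    note lam' = sq_diffs_uminus[OF lam]
    define M' where "M' p n = 1 / ((real p)\<^sup>2 + - lam - (real n)\<^sup>2)" for p n :: nat
    \<comment> \<open>Exchanging the indices and reversing the sign of \<open>lam\<close> only
      changes the sign of the Cauchy kernel, so the second inverse identity is the orthogonality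
      relation for \<open>- lam\<close>.\<close>
    have MM: "M n p = - M' p n" for n p
      using sq_diffs_nz(2)[OF lam, of n p] by (simp add: M_def M'_def divide_simps)
    have "L' p n * L n q = (- a p * K q) * (S n * (M' p n * M' q n))" for n
    proof (cases "n \<in> J")
      case n: True
      have "L' p n * L n q = (- a p * K q) * (S n * (M n p * M n q))"
        using True n anz[OF n] by (simp add: L_def L'_def M_def)
      then show ?thesis by (simp add: MM)
    qed (simp add: L_def res_def S_def)
    moreover have "summable (\<lambda>n. S n * (M' p n * M' q n))"
    proof (rule summable_comparison_test[OF _ summable_mult[OF summable_cauchy[OF lam', of q], of "BS * \<bar>BM\<bar>"]],
        intro exI allI impI)
      fix n
      have "\<bar>M n p\<bar> \<le> \<bar>BM\<bar>"
        using order_trans[OF BM[of n p] mult_mono[of BM "\<bar>BM\<bar>" "kap n p" 1]] kap_le_1[of n p] by simp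
      then have "\<bar>S n\<bar> * (\<bar>M' p n\<bar> * \<bar>M' q n\<bar>) \<le> BS * (\<bar>BM\<bar> * \<bar>M' q n\<bar>)"
        using nn BS MM[of n p] by (intro mult_mono) auto
      then show "norm (S n * (M' p n * M' q n)) \<le> BS * \<bar>BM\<bar> * \<bar>1 / ((real q)\<^sup>2 + - lam - (real n)\<^sup>2)\<bar>"
        by (simp add: M'_def abs_mult)
    qed
    ultimately have sum: "(\<Sum>n. L' p n * L n q) = (- a p * K q) * (\<Sum>n. S n * (M' p n * M' q n))"
      by (simp only: suminf_mult)
    \<comment> \<open>This relation carries the factor \<open>res J lam p\<close>. On the diagonal
      it is supplied by \<open>a p * K p\<close>; off the diagonal it is divided out, being nonzero
      by \<open>res_nz\<close>.\<close>
    have orth: "res J lam p * (\<Sum>n. S n * (M' p n * M' q n)) = (if p = q then -1 else 0)"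
      using cauchy_orth[OF lam', of p J q] True by (simp add: S_def M'_def)
    show ?thesis
    proof (cases "p = q")
      case eq: True
      have "(- a p * K q) = - res J lam p" using eq True Ka[of p] by (simp add: mult.commute)
      then show ?thesis using sum orth eq True by simp
    next
      case False
      then have "(\<Sum>n. S n * (M' p n * M' q n)) = 0"
        using orth res_nz[OF lam, of p J] True by simp
      then show ?thesis using sum False by simp
    qed
  qed (auto simp: L_def L'_def)
qed

text \<open>With \<open>K n = res J lam n / a k n\<close> the size of \<open>K\<close>, the decay
  and the fixed point property become statements about residues. The orders are dictated by growth:
  \<open>K n\<close> is of size \<open>n^m\<close>, whence \<open>m + 1/2\<close>;
  \<open>a k n\<close> is of size \<open>n^(- m)\<close>, whence \<open>m - 1/2\<close>; and
  \<open>m - 3/2\<close> is the lower end of the range of the kernel.\<close>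

theorem proposition3p4:
  fixes m :: real and k :: nat and a :: "nat \<Rightarrow> nat \<Rightarrow> real" and c C lam :: real
  assumes "k \<in> {1, 2}"
    and "c > 0" and "C > 0"
    and "\<And>j n. j \<in> {1, 2} \<Longrightarrow> n \<ge> 1 \<Longrightarrow>
           c * real n powr (- m) < \<bar>a j n\<bar> \<and> \<bar>a j n\<bar> < C * real n powr (- m)"
    and "a 2 0 \<noteq> 0"
    and "lam \<notin> sq_diffs"
  shows "\<exists>K :: nat \<Rightarrow> real.
      (k = 2 \<longrightarrow> K 0 \<noteq> 0) \<and>
      (\<exists>c' > 0. \<exists>C' > 0. \<forall>n\<ge>1.
         c' * real n powr m < \<bar>K n\<bar> \<and> \<bar>K n\<bar> < C' * real n powr m) \<and>
      (\<forall>r \<in> {0..<1/2}. summable (\<lambda>n. ((lam + a k n * K n) * real n powr r)\<^sup>2)) \<and>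
      (\<exists>Kf :: functional \<Rightarrow> real.
         (\<forall>n \<in> idx k. Kf (embed (fbasis k n)) = K n) \<and>
         (\<forall>\<epsilon> > 0. bounded_functional_on_Hs_par k (m + 1/2 + \<epsilon>) Kf) \<and>
         (\<exists>T0. is_transform k lam (a k) K T0 \<and>
           (\<exists>T :: functional \<Rightarrow> functional.
             (\<forall>\<epsilon> > 0. is_extension_to (m - 3/2 + \<epsilon>) k T0 T) \<and>
             (\<forall>s \<in> {-3/2<..<3/2}. isomorphism_on_Hs_par k (m + s) T) \<and>
             (\<forall>\<epsilon> > 0. fseries k (a k) \<in> Hs_par k (m - 1/2 - \<epsilon>) \<and>
                T (fseries k (a k)) = fseries k (a k)) \<and>
             (\<forall>r \<in> {-1/2<..<1/2}. \<forall>\<phi> \<in> Hs_par k (m + r + 1).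
                (\<lambda>\<psi>. T (Lap \<phi>) \<psi> + Kf \<phi> * T (fseries k (a k)) \<psi>) \<in> Hs_par k (m + r - 1) \<and>
                (\<lambda>\<psi>. Lap (T \<phi>) \<psi> - lam * T \<phi> \<psi>) \<in> Hs_par k (m + r - 1) \<and>
                (\<lambda>\<psi>. T (Lap \<phi>) \<psi> + Kf \<phi> * T (fseries k (a k)) \<psi>) =
                (\<lambda>\<psi>. Lap (T \<phi>) \<psi> - lam * T \<phi> \<psi>)))))"
proof -
  note k = assms(1) and c = assms(2) and C = assms(3) and lam = assms(6)
  define J where "J = idx k"
  have J: "n \<in> J" if "n \<ge> 1" for n using that by (auto simp: J_def idx_def)
  define b where "b = a k"
  have bn: "c * wt (- m) n < \<bar>b n\<bar>" "\<bar>b n\<bar> < C * wt (- m) n" if "n \<ge> 1" for n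
    using assms(4)[OF k that] that by (simp_all add: b_def wt_pos_index)
  \<comment> \<open>The bounds are assumed for \<open>n \<ge> 1\<close> only. For
    \<open>k = 2\<close> the constants are adjusted to cover \<open>b 0\<close>, which is nonzero;
    for \<open>k = 1\<close> the index 0 is outside \<open>J\<close> and \<open>b 0\<close> may
    vanish, so it must not enter \<open>c0\<close>.\<close>
  define c0 C0 where "c0 = (if k = 2 then min c \<bar>b 0\<bar> else c)" and "C0 = max C \<bar>b 0\<bar>"
  have c0: "c0 > 0" using c assms(5) by (simp add: c0_def b_def)
  have b: "c0 * wt (- m) n \<le> \<bar>b n\<bar> \<and> \<bar>b n\<bar> \<le> C0 * wt (- m) n" if "n \<in> J" for n
  proof (cases "n = 0")
    case True
    then have "k = 2" using that k by (auto simp: J_def idx_def)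
    then show ?thesis using True by (simp add: c0_def C0_def wt_def)
  next
    case False
    then have n: "n \<ge> 1" by simp
    have "c0 \<le> c" "C \<le> C0" by (simp_all add: c0_def C0_def)
    then have "c0 * wt (- m) n \<le> c * wt (- m) n" "C * wt (- m) n \<le> C0 * wt (- m) n"
      using wt_nonneg by (blast intro: mult_right_mono)+
    then show ?thesis using bn[OF n] by linarith
  qed
  have bnz: "b n \<noteq> 0" if "n \<in> J" for n
    using b[OF that] mult_pos_pos[OF c0 wt_pos[of "- m" n]] by auto
  define M where "M p n = 1 / ((real p)\<^sup>2 + lam - (real n)\<^sup>2)" for p n :: nat
  define K where "K n = res J lam n / b n" for n
  define L where "L p n = (if p \<in> J \<and> n \<in> J then - b p * M p n * K n else 0)" for p n
  define L' where "L' n p = (if p \<in> J \<and> n \<in> J then b n * res J (- lam) p * M p n / b p else 0)" for n p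
  note kernels = transform_kernels[where J = J and m = m and a = b and C = C0, OF lam c0 b,
      folded M_def K_def, folded L_def L'_def]
  have KL: "kernel m L" and KL': "kernel m L'"
    and id1: "\<And>p q. (\<Sum>n. L p n * L' n q) = (if p = q \<and> p \<in> idx k then 1 else 0)"
    and id2: "\<And>p q. (\<Sum>n. L' p n * L n q) = (if p = q \<and> p \<in> idx k then 1 else 0)"
    using kernels(2-5) by (simp_all add: J_def)
  obtain BK where BK: "\<And>n. \<bar>K n\<bar> \<le> BK * wt m n" using kernels(1) by blast
  have supp: "\<And>p n. p \<notin> idx k \<Longrightarrow> L p n = 0" "\<And>p n. p \<notin> idx k \<Longrightarrow> L' p n = 0"
    by (simp_all add: L_def L'_def J_def)
  have Koff: "K n = 0" if "n \<notin> J" for n using that by (simp add: K_def res_def)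
  have bK: "b n * K n = res J lam n" if "n \<in> J" for n using bnz[OF that] by (simp add: K_def)
  define T where "T = kop k L"
  define T0 where "T0 \<phi> = T (embed \<phi>)" for \<phi>
  define Kf where "Kf u = (\<Sum>n. K n * u (fbasis k n))" for u :: functional

  have K0: "k = 2 \<longrightarrow> K 0 \<noteq> 0"
    using res_nz[OF lam, of 0 J] bnz[of 0] by (auto simp: K_def J_def idx_def)

  have Kbounds: "\<exists>c' > 0. \<exists>C' > 0. \<forall>n\<ge>1. c' * real n powr m < \<bar>K n\<bar> \<and> \<bar>K n\<bar> < C' * real n powr m"
  proof -
    obtain \<rho> where \<rho>: "\<rho> > 0" "\<And>n. n \<in> J \<Longrightarrow> \<rho> \<le> \<bar>res J lam n\<bar>"
      using res_bounded_below[OF lam] by blast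
    obtain B where B: "\<And>n. \<bar>res J lam n\<bar> \<le> B" using res_bounded by blast
    have B0: "B > 0" using \<rho>(1) \<rho>(2)[OF J[of 1]] B[of 1] by simp
    have "\<rho> / C * real n powr m < \<bar>K n\<bar> \<and> \<bar>K n\<bar> < B / c * real n powr m" if n: "n \<ge> 1" for n
    proof -
      have bpos: "\<bar>b n\<bar> > 0" using bnz[OF J[OF n]] by simp
      have w: "wt (- m) n * wt m n = 1" by simp
      have "\<bar>b n\<bar> * wt m n < C * (wt (- m) n * wt m n)"
        using mult_strict_right_mono[OF bn(2)[OF n] wt_pos[of m n]] by (simp only: mult.assoc)
      then have 1: "\<bar>b n\<bar> * wt m n < C" by (simp only: w mult_1_right)
      have "c * (wt (- m) n * wt m n) < \<bar>b n\<bar> * wt m n"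
        using mult_strict_right_mono[OF bn(1)[OF n] wt_pos[of m n]] by (simp only: mult.assoc)
      then have 2: "c < \<bar>b n\<bar> * wt m n" by (simp only: w mult_1_right)
      have "\<rho> * (\<bar>b n\<bar> * wt m n) < \<rho> * C" using 1 \<rho>(1) by (intro mult_strict_left_mono)
      also have "\<dots> \<le> \<bar>res J lam n\<bar> * C" using \<rho>(2)[OF J[OF n]] C by (intro mult_right_mono) auto
      finally have lo: "\<rho> / C * wt m n < \<bar>K n\<bar>"
        using bpos C by (simp add: K_def field_simps)
      have "\<bar>res J lam n\<bar> * c \<le> B * c" using B c by (intro mult_right_mono) auto
      also have "\<dots> < B * (\<bar>b n\<bar> * wt m n)" using 2 B0 by (intro mult_strict_left_mono)
      finally have "\<bar>K n\<bar> < B / c * wt m n"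
        using bpos c by (simp add: K_def field_simps)
      then show ?thesis using lo n by (simp add: wt_pos_index)
    qed
    then show ?thesis using \<rho>(1) B0 C c by (meson divide_pos_pos)
  qed

  have decay: "summable (\<lambda>n. ((lam + a k n * K n) * real n powr r)\<^sup>2)" if r: "r \<in> {0..<1/2}" for r
  proof -
    \<comment> \<open>Half of the gap between \<open>r\<close> and 1/2, so that
      \<open>r + (\<delta> - 1)\<close> is still below -1/2.\<close>
    define \<delta> where "\<delta> = (1/2 - r) / 2"
    have \<delta>: "0 < \<delta>" "\<delta> < 1" "r + (\<delta> - 1) < -1/2" using r by (auto simp: \<delta>_def field_simps)
    obtain B where B: "\<And>n. n \<in> J \<Longrightarrow> \<bar>res J lam n + lam\<bar> \<le> B * wt (\<delta> - 1) n"
      using res_near[OF \<delta>(1,2)] by blast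
    have "\<bar>lam + a k n * K n\<bar> \<le> B * wt (\<delta> - 1) n" if "n \<ge> 1" for n
      using B[OF J[OF that]] bK[OF J[OF that]] by (simp add: b_def add.commute)
    then have "summable (\<lambda>n. (wt r n * (lam + a k n * K n))\<^sup>2)"
      using \<delta>(3) by (rule summable_wt_bound)
    then show ?thesis
      by (rule summable_cong[THEN iffD1, rotated])
        (auto simp: eventually_sequentially wt_pos_index mult.commute intro!: exI[of _ 1])
  qed

  have single: "(\<Sum>j. x j * cf k n (fbasis k j)) = (if n \<in> J then x n else 0)" for x :: "nat \<Rightarrow> real" and n
  proof -
    have "x j * cf k n (fbasis k j) = (if j = n then (if n \<in> J then x n else 0) else 0)" for j
      using cf_fbasis[OF k k, of n j] by (auto simp: J_def)
    then show ?thesis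
      using sums_single[of n "\<lambda>_. if n \<in> J then x n else 0"] by (simp add: sums_iff)
  qed

  have Kf_sum: "summable (\<lambda>n. \<bar>K n * u (fbasis k n)\<bar>)"
    "\<bar>Kf u\<bar> \<le> sqrt (\<Sum>n. (wt (- s) n * K n)\<^sup>2) * Hnorm s u"
    if u: "u \<in> Hs_par k s" and s: "s > m + 1/2" for u s
  proof -
    have X: "summable (\<lambda>n. (wt (- s) n * K n)\<^sup>2)"
      by (rule summable_wt_bound[where B = BK and t = m]) (use BK s in auto)
    have Y: "summable (\<lambda>n. (wt s n * u (fbasis k n))\<^sup>2)"
      using u by (simp add: Hs_par_iff[OF k])
    note cs = summable_square_mult[OF X Y]
    have eq: "wt (- s) n * K n * (wt s n * u (fbasis k n)) = K n * u (fbasis k n)" for n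
    proof -
      have "wt (- s) n * K n * (wt s n * u (fbasis k n))
          = (wt (- s) n * wt s n) * (K n * u (fbasis k n))" by (simp only: mult_ac)
      then show ?thesis by simp
    qed
    show sm: "summable (\<lambda>n. \<bar>K n * u (fbasis k n)\<bar>)" using cs(1) unfolding eq .
    have "\<bar>Kf u\<bar> \<le> (\<Sum>n. \<bar>K n * u (fbasis k n)\<bar>)" unfolding Kf_def using sm by (rule summable_rabs)
    also have "\<dots> \<le> sqrt ((\<Sum>n. (wt (- s) n * K n)\<^sup>2) * (\<Sum>n. (wt s n * u (fbasis k n))\<^sup>2))"
      using cs(2) unfolding eq by (rule real_le_rsqrt)
    finally show "\<bar>Kf u\<bar> \<le> sqrt (\<Sum>n. (wt (- s) n * K n)\<^sup>2) * Hnorm s u"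
      by (simp add: Hnorm_par[OF k u] real_sqrt_mult)
  qed
  have Kf_basis: "\<forall>n \<in> idx k. Kf (embed (fbasis k n)) = K n"
    by (simp add: Kf_def single J_def)
  have Kf_bounded: "bounded_functional_on_Hs_par k (m + 1/2 + \<epsilon>) Kf" if "\<epsilon> > 0" for \<epsilon>
  proof -
    have e: "m + 1/2 + \<epsilon> > m + 1/2" using that by simp
    have "linear_functional_on (Hs_par k (m + 1/2 + \<epsilon>)) Kf"
      unfolding linear_functional_on_def
    proof (intro ballI allI)
      fix u v \<alpha> \<beta> assume u: "u \<in> Hs_par k (m + 1/2 + \<epsilon>)" and v: "v \<in> Hs_par k (m + 1/2 + \<epsilon>)"
      have "(\<lambda>n. \<alpha> * (K n * u (fbasis k n)) + \<beta> * (K n * v (fbasis k n))) sums (\<alpha> * Kf u + \<beta> * Kf v)"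
        unfolding Kf_def
        by (intro sums_add sums_mult summable_sums summable_rabs_cancel[OF Kf_sum(1)[OF u e]]
            summable_rabs_cancel[OF Kf_sum(1)[OF v e]])
      then show "Kf (\<lambda>x. \<alpha> * u x + \<beta> * v x) = \<alpha> * Kf u + \<beta> * Kf v"
        by (simp add: Kf_def sums_iff algebra_simps)
    qed
    then show ?thesis
      unfolding bounded_functional_on_Hs_par_def using Kf_sum(2)[OF _ e] by blast
  qed

  have embed_in: "embed \<phi> \<in> Hs (m + s)" if "\<phi> \<in> test_fun" for \<phi> s
    by (rule embed_in_Hs[OF that])
  have T0_bound: "continuous_on_test_fun (\<lambda>\<phi>. T0 \<phi> \<psi>)" if \<psi>: "\<psi> \<in> test_fun" for \<psi>
  proof -
    \<comment> \<open>Continuity on test functions asks for a natural order; rounding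
      \<open>m\<close> up keeps it above \<open>m - 3/2\<close>.\<close>
    define N where "N = nat \<lceil>m\<rceil>"
    have "real N - m > -3/2" unfolding N_def by linarith
    from kop_pointwise_bound[OF k KL supp(1) \<psi> this]
    obtain B where "\<And>u. u \<in> Hs (real N) \<Longrightarrow> \<bar>T u \<psi>\<bar> \<le> B * Hnorm (real N) u"
      by (auto simp: T_def)
    then show ?thesis
      unfolding continuous_on_test_fun_def T0_def using embed_in_Hs by blast
  qed
  have transform: "is_transform k lam (a k) K T0"
    unfolding is_transform_def
  proof (intro conjI ballI)
    show "T0 \<phi> \<in> distr_par k" if "\<phi> \<in> test_fun" for \<phi>
      unfolding T0_def T_def by (rule kop_distr_par[OF k KL supp(1) embed_in[OF that, of 0]]) auto
    show "linear_operator_on test_fun T0"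
      unfolding linear_operator_on_def
    proof (intro ballI allI)
      fix u v \<alpha> \<beta> assume u: "u \<in> test_fun" and v: "v \<in> test_fun"
      show "T0 (\<lambda>x. \<alpha> * u x + \<beta> * v x) = (\<lambda>y. \<alpha> * T0 u y + \<beta> * T0 v y)"
        unfolding T0_def T_def embed_linear_left[OF u v]
        by (rule kop_linear[OF k KL supp(1) embed_in[OF u, of 0] embed_in[OF v, of 0]]) auto
    qed
    show "continuous_on_test_fun (\<lambda>\<phi>. T0 \<phi> \<psi>)" if "\<psi> \<in> test_fun" for \<psi>
      by (rule T0_bound[OF that])
    show "T0 (fbasis k n) = (\<lambda>\<psi>. - K n * fseries k (\<lambda>p. a k p / ((real p)\<^sup>2 + lam - (real n)\<^sup>2)) \<psi>)"
      if n: "n \<in> idx k" for n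
    proof
      fix \<psi>
      define x where "x p = (if p \<in> J then b p * M p n else 0)" for p
      have "cf k n \<in> Hs (m + 0)" by (rule embed_in[OF fbasis_in_test_fun[OF k]])
      from kop_distr_par[OF k KL supp(1) this]
      have "slow (\<lambda>p. L p n)"
        using distr_slow[OF _ k, of "T (cf k n)"] n
        by (simp add: T_def kop_coeff[OF k KL supp(1)] single J_def distr_par_def)
      \<comment> \<open>Dividing by \<open>- K n\<close> transfers the polynomial bound from the
        column of \<open>L\<close> to \<open>x\<close>, which \<open>fseries_linear\<close>
        requires.\<close>
      have "K n \<noteq> 0"
        using res_nz[OF lam, of n J] bnz[of n] n by (simp add: K_def J_def)
      then have xL: "x = (\<lambda>p. (- 1 / K n) * L p n + 0 * L p n)"
        using n by (auto simp: x_def L_def J_def)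
      have "slow x" unfolding xL by (intro slow_linear \<open>slow (\<lambda>p. L p n)\<close>)
      have "T0 (fbasis k n) = fseries k (\<lambda>p. L p n)"
        using n by (simp add: T0_def T_def kop_def single J_def)
      also have "\<dots> = fseries k (\<lambda>p. (- K n) * x p + 0 * x p)"
        using n by (intro fseries_cong) (simp add: x_def L_def J_def)
      finally have "T0 (fbasis k n) \<psi> = - K n * fseries k x \<psi>"
        using fseries_linear[OF \<open>slow x\<close> \<open>slow x\<close> k, of "- K n" 0 \<psi>] by simp
      also have "fseries k x = fseries k (\<lambda>p. a k p / ((real p)\<^sup>2 + lam - (real n)\<^sup>2))"
        by (intro fseries_cong) (simp add: x_def J_def b_def M_def)
      finally show "T0 (fbasis k n) \<psi>
          = - K n * fseries k (\<lambda>p. a k p / ((real p)\<^sup>2 + lam - (real n)\<^sup>2)) \<psi>" .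
    qed
    show "T0 (fbasis (3 - k) n) = (\<lambda>\<psi>. 0)" if "n \<in> idx (3 - k)" for n
    proof -
      have k3: "3 - k \<in> {1, 2}" "3 - k \<noteq> k" using k by auto
      have "cf (3 - k) n (fbasis k j) = 0" for j using cf_fbasis[OF k3(1) k] k3(2) by simp
      then show ?thesis by (simp add: T0_def T_def kop_def fseries_def)
    qed
  qed

  have extension: "is_extension_to (m - 3/2 + \<epsilon>) k T0 T" if "\<epsilon> > 0" for \<epsilon>
  proof -
    define s where "s = \<epsilon> - 3/2"
    have s: "s > -3/2" "m - 3/2 + \<epsilon> = m + s" using that by (auto simp: s_def)
    show ?thesis
      unfolding is_extension_to_def s(2)
    proof (intro conjI ballI)
      show "T (embed \<phi>) = T0 \<phi>" for \<phi> by (simp add: T0_def)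
      show "T u \<in> distr_par k" if "u \<in> Hs (m + s)" for u
        unfolding T_def by (rule kop_distr_par[OF k KL supp(1) that s(1)])
      show "linear_operator_on (Hs (m + s)) T"
        unfolding linear_operator_on_def T_def
        by (intro ballI allI kop_linear[OF k KL supp(1) _ _ s(1)])
      show "\<exists>C. \<forall>u\<in>Hs (m + s). \<bar>T u \<psi>\<bar> \<le> C * Hnorm (m + s) u" if "\<psi> \<in> test_fun" for \<psi>
        unfolding T_def by (rule kop_pointwise_bound[OF k KL supp(1) that s(1)])
    qed
  qed

  have iso: "isomorphism_on_Hs_par k (m + s) T" if "s \<in> {-3/2<..<3/2}" for s
    unfolding T_def using that by (intro kop_isomorphism[OF k KL KL' supp id1 id2]) auto

  have phi: "fseries k b \<in> Hs_par k s" if "s < m - 1/2" for s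
    by (intro fseries_in_Hs_par[OF k] summable_wt_bound[where B = C and t = "- m"])
       (use bn that in \<open>auto intro: less_imp_le\<close>)
  have T_phi: "T (fseries k b) = fseries k b"
  proof -
    have "(\<Sum>n. L p n * fseries k b (fbasis k n)) = b p" if p: "p \<in> idx k" for p
    proof -
      have "L p n * fseries k b (fbasis k n) = - b p * (res J lam n * M p n)" for n
      proof (cases "n \<in> J")
        case True
        have "L p n * fseries k b (fbasis k n) = - b p * ((b n * K n) * M p n)"
          using True p by (simp add: L_def J_def fseries_fbasis[OF k k])
        then show ?thesis by (simp only: bK[OF True])
      qed (simp add: L_def res_def)
      note eq = this
      \<comment> \<open>Order \<open>m - 1\<close> lies between \<open>m - 3/2\<close>, above which
        the rows of \<open>L\<close> converge, and \<open>m - 1/2\<close>, below which the series of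
        \<open>b\<close> belongs to the space.\<close>
      have bH: "fseries k b \<in> Hs (m + - 1)"
        using phi[of "m + - 1"] by (simp add: Hs_par_def)
      have "summable (\<lambda>n. L p n * fseries k b (fbasis k n))"
        by (rule kop_summable[OF k KL supp(1) bH]) simp_all
      then have sm: "summable (\<lambda>n. res J lam n * M p n)"
        unfolding eq summable_cmult_iff using bnz[of p] p by (simp add: J_def)
      have "(\<Sum>n. L p n * fseries k b (fbasis k n)) = - b p * (\<Sum>n. res J lam n * M p n)"
        unfolding eq by (rule suminf_mult[OF sm])
      then show ?thesis using cauchy_row[OF lam, of p J] p by (simp add: M_def J_def)
    qed
    then show ?thesis unfolding T_def kop_def by (rule fseries_cong)
  qed

  have main: "(\<lambda>\<psi>. T (Lap \<phi>) \<psi> + Kf \<phi> * T (fseries k b) \<psi>) \<in> Hs_par k (m + r - 1) \<and>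
      (\<lambda>\<psi>. T (Lap \<phi>) \<psi> + Kf \<phi> * T (fseries k b) \<psi>) = (\<lambda>\<psi>. Lap (T \<phi>) \<psi> - lam * T \<phi> \<psi>)"
    if r: "r \<in> {-1/2<..<1/2}" and \<phi>: "\<phi> \<in> Hs_par k (m + r + 1)" for r \<phi>
  proof -
    define v where "v n = \<phi> (fbasis k n)" for n
    have \<phi>p: "\<phi> \<in> distr_par k" and v: "summable (\<lambda>n. (wt (m + r + 1) n * v n)\<^sup>2)"
      using \<phi> by (simp_all add: Hs_par_iff[OF k] v_def)
    have \<phi>H: "\<phi> \<in> Hs (m + (r + 1))" using \<phi> by (simp add: Hs_par_def add.assoc)
    \<comment> \<open>\<open>r > -1/2\<close> puts \<open>r - 1\<close> above -3/2, as the transform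
      of \<open>Lap \<phi>\<close> needs, and \<open>r + 1\<close> above 1/2, as \<open>Kf\<close>
      needs. \<open>r < 1/2\<close> later puts the series of \<open>b\<close> into order
      \<open>m + r - 1\<close>.\<close>
    have r1: "r + 1 > -3/2" "r - 1 > -3/2" "\<bar>r - 1\<bar> < 3/2" "m + r + 1 > m + 1/2"
      using r by auto
    have Lap\<phi>: "Lap \<phi> = fseries k (\<lambda>n. - (real n)\<^sup>2 * v n)"
      unfolding v_def by (rule Lap_eq_fseries[OF \<phi>p k])
    have sq: "summable (\<lambda>n. (wt (m + (r - 1)) n * (- (real n)\<^sup>2 * v n))\<^sup>2)"
    proof (rule summable_comparison_test[OF _ v], intro exI allI impI)
      fix n
      have "(real n)\<^sup>2 \<le> wt 2 n" by (simp add: wt_def powr_numeral)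
      then have "wt (m + (r - 1)) n * (real n)\<^sup>2 \<le> wt (m + (r - 1)) n * wt 2 n"
        by (intro mult_left_mono) auto
      also have "\<dots> = wt (m + r + 1) n" by (simp add: wt_add[symmetric] algebra_simps)
      finally have "(wt (m + (r - 1)) n * (real n)\<^sup>2)\<^sup>2 * (v n)\<^sup>2 \<le> (wt (m + r + 1) n)\<^sup>2 * (v n)\<^sup>2"
        by (intro mult_right_mono power_mono) auto
      then show "norm ((wt (m + (r - 1)) n * (- (real n)\<^sup>2 * v n))\<^sup>2) \<le> (wt (m + r + 1) n * v n)\<^sup>2"
        by (simp add: power_mult_distrib mult.assoc)
    qed
    have Lap_in: "Lap \<phi> \<in> Hs_par k (m + (r - 1))"
      unfolding Lap\<phi> by (rule fseries_in_Hs_par[OF k sq])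
    then have Lap_H: "Lap \<phi> \<in> Hs (m + (r - 1))" by (simp add: Hs_par_def)
    have Lap_coeff: "Lap \<phi> (fbasis k n) = - (real n)\<^sup>2 * v n" for n
      using distr_par_coeff_0[OF \<phi>p, of n] by (simp add: Lap\<phi> fseries_fbasis[OF k k] v_def)
    have TLap: "T (Lap \<phi>) \<in> Hs_par k (m + (r - 1))"
      unfolding T_def by (rule kop_in_Hs_par[OF k KL supp(1) Lap_H r1(3)])
    define t where "t p = (\<Sum>n. L p n * v n)" for p
    have T\<phi>_par: "T \<phi> \<in> distr_par k"
      unfolding T_def by (rule kop_distr_par[OF k KL supp(1) \<phi>H r1(1)])
    have T\<phi>_coeff: "T \<phi> (fbasis k p) = t p" for p
      unfolding T_def t_def v_def by (rule kop_coeff[OF k KL supp(1)])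
    have T\<phi>_eq: "T \<phi> = fseries k t" by (simp add: T_def kop_def t_def [abs_def] v_def)
    have "fseries k b \<in> Hs_par k (m + (r - 1))" using r by (intro phi) auto
    then have mem: "(\<lambda>\<psi>. 1 * T (Lap \<phi>) \<psi> + Kf \<phi> * T (fseries k b) \<psi>) \<in> Hs_par k (m + (r - 1))"
      unfolding T_phi by (intro Hs_par_lincomb k TLap)
    have key: "(\<Sum>n. L p n * (- (real n)\<^sup>2 * v n)) + Kf \<phi> * b p = - (real p)\<^sup>2 * t p + (- lam) * t p"
      if p: "p \<in> idx k" for p
    proof -
      have s1: "summable (\<lambda>n. L p n * (- (real n)\<^sup>2 * v n))"
        using kop_summable[OF k KL supp(1) Lap_H r1(2)] by (simp add: Lap_coeff)
      have s2: "summable (\<lambda>n. K n * v n)"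
        unfolding v_def by (rule summable_rabs_cancel[OF Kf_sum(1)[OF \<phi> r1(4)]])
      have s3: "summable (\<lambda>n. L p n * v n)"
        unfolding v_def by (rule kop_summable[OF k KL supp(1) \<phi>H r1(1)])
      \<comment> \<open>Termwise this is \<open>(p^2 + lam - n^2) * M p n = 1\<close>: up to the
        multiple \<open>lam\<close> of \<open>L\<close>, the commutator of \<open>L\<close> with
        multiplication by squares is the rank one matrix \<open>b p * K n\<close>. The three series
        converge separately, so the identity may be summed.\<close>
      have "L p n * (- (real n)\<^sup>2 * v n) + K n * v n * b p = (- (real p)\<^sup>2 - lam) * (L p n * v n)" for n
      proof (cases "n \<in> J")
        case True
        have "(real p)\<^sup>2 + lam - (real n)\<^sup>2 \<noteq> 0" by (rule sq_diffs_nz(2)[OF lam])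
        then have "1 + (real n)\<^sup>2 * M p n = ((real p)\<^sup>2 + lam) * M p n"
          by (simp add: M_def field_simps)
        then have "(b p * K n * v n) * (1 + (real n)\<^sup>2 * M p n) = (b p * K n * v n) * (((real p)\<^sup>2 + lam) * M p n)"
          by simp
        then show ?thesis using True p by (simp add: L_def J_def algebra_simps)
      qed (simp add: L_def Koff)
      then have "(\<lambda>n. L p n * (- (real n)\<^sup>2 * v n) + K n * v n * b p) sums ((- (real p)\<^sup>2 - lam) * t p)"
        unfolding t_def using s3 by (simp add: sums_mult summable_sums)
      moreover have "(\<lambda>n. L p n * (- (real n)\<^sup>2 * v n) + K n * v n * b p) sums
          ((\<Sum>n. L p n * (- (real n)\<^sup>2 * v n)) + Kf \<phi> * b p)"
        unfolding Kf_def v_def[symmetric]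
        by (intro sums_add sums_mult2 summable_sums s1 s2)
      ultimately have "(\<Sum>n. L p n * (- (real n)\<^sup>2 * v n)) + Kf \<phi> * b p = (- (real p)\<^sup>2 - lam) * t p"
        by (rule sums_unique2[symmetric])
      then show ?thesis by (simp add: algebra_simps)
    qed
    have slow_b: "slow b"
      by (rule slow_square_summable[of "m - 1"], rule summable_wt_bound[where B = C and t = "- m"])
         (use bn in \<open>auto intro: less_imp_le\<close>)
    have slow_L: "slow (\<lambda>p. \<Sum>n. L p n * (- (real n)\<^sup>2 * v n))"
      using distr_slow[of "T (Lap \<phi>)", OF _ k] TLap
      by (simp add: T_def kop_coeff[OF k KL supp(1)] Lap_coeff Hs_par_def distr_par_def)
    have slow_t: "slow t"
      using distr_slow[of "T \<phi>", OF _ k] T\<phi>_par T\<phi>_coeff by (simp add: distr_par_def)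
    have LapT: "Lap (T \<phi>) = fseries k (\<lambda>n. - (real n)\<^sup>2 * t n)"
      using Lap_eq_fseries[OF T\<phi>_par k] by (simp add: T\<phi>_coeff)
    have slow_LapT: "slow (\<lambda>n. - (real n)\<^sup>2 * t n)"
    proof -
      obtain D s where D: "\<And>n. \<bar>t n\<bar> \<le> D * wt s n" using slow_t unfolding slow_def by blast
      have "\<bar>- (real n)\<^sup>2 * t n\<bar> \<le> D * wt (s + 2) n" for n
      proof -
        have "(real n)\<^sup>2 \<le> wt 2 n" by (simp add: wt_def powr_numeral)
        then have "(real n)\<^sup>2 * \<bar>t n\<bar> \<le> wt 2 n * (D * wt s n)" using D by (intro mult_mono) auto
        then show ?thesis by (simp add: abs_mult wt_add mult_ac)
      qed
      then show ?thesis unfolding slow_def by blast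
    qed
    have eq: "T (Lap \<phi>) \<psi> + Kf \<phi> * T (fseries k b) \<psi> = Lap (T \<phi>) \<psi> - lam * T \<phi> \<psi>" for \<psi>
    proof -
      have "T (Lap \<phi>) \<psi> + Kf \<phi> * T (fseries k b) \<psi>
          = 1 * fseries k (\<lambda>p. \<Sum>n. L p n * (- (real n)\<^sup>2 * v n)) \<psi> + Kf \<phi> * fseries k b \<psi>"
        unfolding T_phi by (simp add: T_def kop_def Lap_coeff)
      also have "\<dots> = fseries k (\<lambda>p. 1 * (\<Sum>n. L p n * (- (real n)\<^sup>2 * v n)) + Kf \<phi> * b p) \<psi>"
        by (rule fseries_linear[OF slow_L slow_b k, symmetric])
      also have "fseries k (\<lambda>p. 1 * (\<Sum>n. L p n * (- (real n)\<^sup>2 * v n)) + Kf \<phi> * b p)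
          = fseries k (\<lambda>p. 1 * (- (real p)\<^sup>2 * t p) + (- lam) * t p)"
        by (rule fseries_cong) (simp only: mult_1 key)
      also have "\<dots> \<psi> = 1 * fseries k (\<lambda>p. - (real p)\<^sup>2 * t p) \<psi> + (- lam) * fseries k t \<psi>"
        by (rule fseries_linear[OF slow_LapT slow_t k])
      also have "\<dots> = Lap (T \<phi>) \<psi> - lam * T \<phi> \<psi>"
        unfolding LapT unfolding T\<phi>_eq by simp
      finally show ?thesis .
    qed
    show ?thesis using mem eq by (simp add: add_diff_eq)
  qed

  have phi_k: "fseries k (a k) \<in> Hs_par k (m - 1/2 - \<epsilon>) \<and> T (fseries k (a k)) = fseries k (a k)"
    if "\<epsilon> > 0" for \<epsilon>
    using phi[of "m - 1/2 - \<epsilon>"] T_phi that by (simp add: b_def)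
  \<comment> \<open>Membership of the right-hand side is inherited from the left through the
    equality.\<close>
  have identity: "(\<lambda>\<psi>. T (Lap \<phi>) \<psi> + Kf \<phi> * T (fseries k (a k)) \<psi>) \<in> Hs_par k (m + r - 1) \<and>
      (\<lambda>\<psi>. Lap (T \<phi>) \<psi> - lam * T \<phi> \<psi>) \<in> Hs_par k (m + r - 1) \<and>
      (\<lambda>\<psi>. T (Lap \<phi>) \<psi> + Kf \<phi> * T (fseries k (a k)) \<psi>) = (\<lambda>\<psi>. Lap (T \<phi>) \<psi> - lam * T \<phi> \<psi>)"
    if "r \<in> {-1/2<..<1/2}" "\<phi> \<in> Hs_par k (m + r + 1)" for r \<phi>
    using main[OF that] unfolding b_def by metis
  show ?thesis
    by (rule exI[of _ K], intro conjI K0 Kbounds ballI decay, assumption,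
        rule exI[of _ Kf], intro conjI Kf_basis allI impI Kf_bounded, assumption,
        rule exI[of _ T0], intro conjI transform, rule exI[of _ T])
       (use extension iso phi_k identity in blast)
qed

end
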